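(* The following multi-valued functions are pairwise Weihrauch equivalent: $\mathsf{WKL}''$, $\mathsf{RSg}$, $\mathsf{RSgr}$, $3\text{-}\mathsf{DNR}_2$, $\mathsf{oCOH\text{-}in\text{-}}\mathbf{\Delta}^0_2$, $\mathsf{INForONE\text{-}in\text{-}}\mathbf{\Delta}^0_2$, and $\mathsf{INForONE\text{-}in}^*\mathsf{\text{-}}\mathbf{\Delta}^0_2$. In particular, \begin{align*} \mathsf{WKL}'' \equiv_\mathrm{W} \mathsf{RSg} \equiv_\mathrm{W} \mathsf{RSgr}. \end{align*}
   Context: Multi-valued functions (problems) are partial multi-valued functions $\omega^\omega \rightrightarrows \omega^\omega$; $\leq_\mathrm{W}$ is Weihrauch reducibility and $\equiv_\mathrm{W}$ Weihrauch equivalence. For a problem $\mathcal{F}$, its jump $\mathcal{F}'$ takes as input a $\mathbf{\Delta}^0_2$-approximation $f$ (i.e. $g(n)=\lim_s f(n,s)$ for all $n$) to some $g\in\operatorname{dom}(\mathcal{F})$ and outputs an element of $\mathcal{F}(g)$; $\mathcal{F}''=(\mathcal{F}')'$. $\mathsf{WKL}$: input an infinite tree $T\subseteq 2^{<\omega}$, output an infinite path through $T$. For a graph $G=(V,E)$, $N(x)$ is the set of neighbors of $x$. $\mathsf{RSg}$: input an infinite graph $G=(V,E)$, output an infinite $H\subseteq V$ such that for all $v\in V$, $|H\cap N(v)|=\omega$ or $|H\cap N(v)|\le 1$. $\mathsf{RSgr}$: same, with the additional requirement that for all $v\in H$, $|H\cap N(v)|=\omega$ or $|H\cap N(v)|=0$.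 $3\text{-}\mathsf{DNR}_2$: input $p\in\omega^\omega$, output a $\{0,1\}$-valued $f$ that is diagonally non-recursive relative to $p''$ (i.e. $f(e)\neq\Phi_e(p'')(e)$ whenever the latter converges). For a sequence $\vec A=(A_i)$ of subsets of $\omega$ and $\sigma\in 2^{<\omega}$, $A^\sigma=\bigcap_{i<|\sigma|,\sigma(i)=0}\overline{A_i}\cap\bigcap_{i<|\sigma|,\sigma(i)=1}A_i$ (with $A^\emptyset=\omega$). $\mathsf{oCOH\text{-}in\text{-}}\mathbf{\Delta}^0_2$: input a pair $\langle f,\vec A\rangle$ with $f$ a $\mathbf{\Delta}^0_2$-approximation to an infinite set $Z\subseteq\omega$ and $\vec A$ a sequence of subsets of $\omega$; output $p\in 2^\omega$ such that $Z\cap A^{p\restriction n}$ is infinite for every $n$. $\mathsf{INForONE\text{-}in\text{-}}\mathbf{\Delta}^0_2$: input $\langle f,\vec A\rangle$ with $f$ a $\mathbf{\Delta}^0_2$-approximation to an infinite $Z\subseteq\omega$ and each $x\in Z$ in only finitely many $A_i$; output an infinite $D\subseteq Z$ such that for every $i$, $|D\cap A_i|=\omega$ or $|D\cap A_i|\le 1$. $\mathsf{INForONE\text{-}in}^*\mathsf{\text{-}}\mathbf{\Delta}^0_2$: same but the output need only satisfy $D\subseteq^* Z$ (i.e. $D\setminus Z$ finite). *)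

theory Defs
  imports Complex_Main "HOL-Library.Nat_Bijection"
begin

section \<open>Turing functionals\<close>

type_synonym baire = "nat \<Rightarrow> nat"

text \<open>
  Partial recursive functions relative to an oracle in \<open>\<omega>\<^sup>\<omega>\<close>. All programs are unary; several
  arguments are passed as one number by means of the Cantor pairing \<^const>\<open>prod_encode\<close>.
\<close>

datatype prog =
    Zero | Succ | Fst | Snd | Query
  | Pair prog prog | Comp prog prog | Prec prog prog | Mu prog

primrec run :: "prog \<Rightarrow> baire \<Rightarrow> nat \<rightharpoonup> nat" where
  "run Zero p n = Some 0"
| "run Succ p n = Some (Suc n)"
| "run Fst p n = Some (fst (prod_decode n))"
| "run Snd p n = Some (snd (prod_decode n))"
| "run Query p n = Some (p n)"
| "run (Pair c d) p n =
     Option.bind (run c p n) (\<lambda>a. Option.bind (run d p n) (\<lambda>b. Some (prod_encode (a, b))))"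
| "run (Comp c d) p n = Option.bind (run d p n) (run c p)"
| "run (Prec c d) p n = (case prod_decode n of (a, m) \<Rightarrow>
     rec_nat (run c p a)
       (\<lambda>k r. Option.bind r (\<lambda>v. run d p (prod_encode (a, prod_encode (k, v))))) m)"
| "run (Mu c) p n =
     (let Q = (\<lambda>m. run c p (prod_encode (n, m)) = Some 0 \<and>
                   (\<forall>i<m. \<exists>v>0. run c p (prod_encode (n, i)) = Some v))
      in if \<exists>m. Q m then Some (LEAST m. Q m) else None)"

primrec prog_encode :: "prog \<Rightarrow> nat" where
  "prog_encode Zero = 0"
| "prog_encode Succ = 1"
| "prog_encode Fst = 2"
| "prog_encode Snd = 3"
| "prog_encode Query = 4"
| "prog_encode (Pair c d) = 5 + 4 * prod_encode (prog_encode c, prog_encode d)"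
| "prog_encode (Comp c d) = 6 + 4 * prod_encode (prog_encode c, prog_encode d)"
| "prog_encode (Prec c d) = 7 + 4 * prod_encode (prog_encode c, prog_encode d)"
| "prog_encode (Mu c) = 8 + 4 * prog_encode c"

lemma inj_prog_encode: "prog_encode c = prog_encode d \<Longrightarrow> c = d"
proof (induction c arbitrary: d)
  case (Pair c1 c2) then show ?case by (cases d) ((simp; fail) | (simp, presburger))+
next
  case (Comp c1 c2) then show ?case by (cases d) ((simp; fail) | (simp, presburger))+
next
  case (Prec c1 c2) then show ?case by (cases d) ((simp; fail) | (simp, presburger))+
next
  case (Mu c) then show ?case by (cases d) ((simp; fail) | (simp, presburger))+
qed (case_tac d; simp)+

lemma surj_prog_encode: "\<exists>c. prog_encode c = e"
proof (induction e rule: less_induct)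
  case (less e)
  show ?case
  proof (cases "e < 5")
    case True
    then consider "e = 0" | "e = 1" | "e = 2" | "e = 3" | "e = 4" by linarith
    then show ?thesis by cases (metis prog_encode.simps(1-5))+
  next
    case False
    define x where "x = (e - 5) div 4"
    obtain a b where ab: "x = prod_encode (a, b)" by (metis prod_decode_inverse surj_pair)
    have "x < e" using False by (simp add: x_def)
    moreover have "a \<le> x" "b \<le> x" using ab le_prod_encode_1 le_prod_encode_2 by auto
    ultimately obtain c d f where c: "prog_encode c = a" "prog_encode d = b" "prog_encode f = x"
      using less by (meson le_less_trans)
    have "e = 5 + 4 * x + (e - 5) mod 4" using False by (simp add: x_def)
    moreover have "(e - 5) mod 4 \<in> {0, 1, 2, 3}" by auto
    ultimately consider "e = 5 + 4 * x" | "e = 6 + 4 * x" | "e = 7 + 4 * x" | "e = 8 + 4 * x"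
      by auto
    then show ?thesis
      by cases (metis ab c prog_encode.simps(6-9))+
  qed
qed

lemma bij_prog_encode: "bij prog_encode"
  by (metis bijI' inj_prog_encode surj_prog_encode)

definition prog_decode :: "nat \<Rightarrow> prog" where
  "prog_decode = inv prog_encode"

definition Phi :: "nat \<Rightarrow> baire \<Rightarrow> nat \<rightharpoonup> nat" where
  "Phi e p = run (prog_decode e) p"

definition maps_to :: "nat \<Rightarrow> baire \<Rightarrow> baire \<Rightarrow> bool" where
  "maps_to e p q \<longleftrightarrow> (\<forall>n. Phi e p n = Some (q n))"

definition turing_jump :: "baire \<Rightarrow> baire" where
  "turing_jump p e = of_bool (Phi e p e \<noteq> None)"

definition dnr :: "baire \<Rightarrow> baire \<Rightarrow> bool" where
  "dnr q f \<longleftrightarrow> (\<forall>e v. Phi e q e = Some v \<longrightarrow> f e \<noteq> v)"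


section \<open>Problems and Weihrauch reducibility\<close>

text \<open>
  A partial multi-valued function on Baire space is given by its set of values at each point; it is
  undefined exactly where this set is empty.
\<close>

type_synonym problem = "baire \<Rightarrow> baire set"

definition pdom :: "problem \<Rightarrow> baire set" where
  "pdom F = {p. F p \<noteq> {}}"

definition join :: "baire \<Rightarrow> baire \<Rightarrow> baire" where
  "join p q n = (if even n then p (n div 2) else q (n div 2))"

definition weihrauch_le :: "problem \<Rightarrow> problem \<Rightarrow> bool"  (infix "\<le>\<^sub>W" 50) where
  "F \<le>\<^sub>W G \<longleftrightarrow> (\<exists>d e. \<forall>p\<in>pdom F. \<exists>q\<in>pdom G. maps_to d p q \<and>
     (\<forall>r\<in>G q. \<exists>s\<in>F p. maps_to e (join p r) s))"

definition weihrauch_eq :: "problem \<Rightarrow> problem \<Rightarrow> bool"  (infix "\<equiv>\<^sub>W" 50) where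
  "F \<equiv>\<^sub>W G \<longleftrightarrow> F \<le>\<^sub>W G \<and> G \<le>\<^sub>W F"

text \<open>A \<open>\<Delta>\<^sup>0\<^sub>2\<close>-approximation \<open>f : \<omega> \<times> \<omega> \<rightarrow> \<omega>\<close> is coded as an element of Baire space.\<close>

definition approximates :: "baire \<Rightarrow> baire \<Rightarrow> bool" where
  "approximates f g \<longleftrightarrow> (\<forall>n. (\<lambda>s. f (prod_encode (n, s))) \<longlonglongrightarrow> g n)"

definition jump :: "problem \<Rightarrow> problem" where
  "jump F f = {q. \<exists>g\<in>pdom F. approximates f g \<and> q \<in> F g}"


section \<open>Names of sets, trees, graphs and sequences of sets\<close>

definition chi :: "nat set \<Rightarrow> baire" where
  "chi A n = of_bool (n \<in> A)"

text \<open>Finite binary strings are lists over \<open>{0, 1}\<close>, and \<open>restr p n\<close> is \<open>p \<restriction> n\<close>.\<close>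

definition restr :: "baire \<Rightarrow> nat \<Rightarrow> nat list" where
  "restr p n = map p [0..<n]"

definition cantor :: "baire set" where
  "cantor = {p. range p \<subseteq> {0, 1}}"

definition binary_tree :: "nat list set \<Rightarrow> bool" where
  "binary_tree T \<longleftrightarrow> T \<subseteq> lists {0, 1} \<and> (\<forall>\<sigma>\<in>T. \<forall>n. take n \<sigma> \<in> T)"

definition tree_name :: "nat list set \<Rightarrow> baire" where
  "tree_name T = chi (list_encode ` T)"

definition graph :: "nat set \<Rightarrow> (nat \<times> nat) set \<Rightarrow> bool" where
  "graph V E \<longleftrightarrow> E \<subseteq> V \<times> V \<and> sym E \<and> irrefl E"

definition nbrs :: "(nat \<times> nat) set \<Rightarrow> nat \<Rightarrow> nat set" where
  "nbrs E x = {y. (x, y) \<in> E}"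

definition graph_name :: "nat set \<Rightarrow> (nat \<times> nat) set \<Rightarrow> baire" where
  "graph_name V E = join (chi V) (chi (prod_encode ` E))"

definition seq_name :: "(nat \<Rightarrow> nat set) \<Rightarrow> baire" where
  "seq_name A = chi {prod_encode (i, x) |i x. x \<in> A i}"

text \<open>\<open>cell A \<sigma>\<close> is \<open>A\<^sup>\<sigma>\<close>.\<close>

definition cell :: "(nat \<Rightarrow> nat set) \<Rightarrow> nat list \<Rightarrow> nat set" where
  "cell A \<sigma> = (\<Inter>i\<in>{i. i < length \<sigma> \<and> \<sigma> ! i = 0}. - A i) \<inter> (\<Inter>i\<in>{i. i < length \<sigma> \<and> \<sigma> ! i = 1}. A i)"


section \<open>The problems\<close>

definition WKL :: problem where
  "WKL p = {g. \<exists>T. binary_tree T \<and> infinite T \<and> p = tree_name T \<and>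
     g \<in> cantor \<and> (\<forall>n. restr g n \<in> T)}"

definition RSg :: problem where
  "RSg p = {h. \<exists>V E H. graph V E \<and> infinite V \<and> p = graph_name V E \<and>
     h = chi H \<and> H \<subseteq> V \<and> infinite H \<and>
     (\<forall>v\<in>V. infinite (H \<inter> nbrs E v) \<or> (finite (H \<inter> nbrs E v) \<and> card (H \<inter> nbrs E v) \<le> 1))}"

definition RSgr :: problem where
  "RSgr p = {h. \<exists>V E H. graph V E \<and> infinite V \<and> p = graph_name V E \<and>
     h = chi H \<and> H \<subseteq> V \<and> infinite H \<and>
     (\<forall>v\<in>V. infinite (H \<inter> nbrs E v) \<or> (finite (H \<inter> nbrs E v) \<and> card (H \<inter> nbrs E v) \<le> 1)) \<and>
     (\<forall>v\<in>H. infinite (H \<inter> nbrs E v) \<or> H \<inter> nbrs E v = {})}"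

definition three_DNR2 :: problem where
  "three_DNR2 p = {f \<in> cantor. dnr (turing_jump (turing_jump p)) f}"

definition oCOH_in_Delta2 :: problem where
  "oCOH_in_Delta2 x = {p. \<exists>f A Z. x = join f (seq_name A) \<and> approximates f (chi Z) \<and> infinite Z \<and>
     p \<in> cantor \<and> (\<forall>n. infinite (Z \<inter> cell A (restr p n)))}"

definition INForONE_in_Delta2 :: problem where
  "INForONE_in_Delta2 x = {h. \<exists>f A Z D. x = join f (seq_name A) \<and> approximates f (chi Z) \<and>
     infinite Z \<and> (\<forall>z\<in>Z. finite {i. z \<in> A i}) \<and>
     h = chi D \<and> infinite D \<and> D \<subseteq> Z \<and>
     (\<forall>i. infinite (D \<inter> A i) \<or> (finite (D \<inter> A i) \<and> card (D \<inter> A i) \<le> 1))}"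

definition INForONE_in_star_Delta2 :: problem where
  "INForONE_in_star_Delta2 x = {h. \<exists>f A Z D. x = join f (seq_name A) \<and> approximates f (chi Z) \<and>
     infinite Z \<and> (\<forall>z\<in>Z. finite {i. z \<in> A i}) \<and>
     h = chi D \<and> infinite D \<and> finite (D - Z) \<and>
     (\<forall>i. infinite (D \<inter> A i) \<or> (finite (D \<inter> A i) \<and> card (D \<inter> A i) \<le> 1))}"

end

theory Submission imports Defs begin

text \<open>
  All problems are arranged in a cycle of reductions. Write \<open>F\<close> for the set of vertices of finite degree.

  \<^item> \<open>WKL''\<close> to \<open>3-DNR\<^sub>2\<close>: the instance \<open>f\<close> approximates a tree computable from \<open>f''\<close>. A program with
    oracle \<open>f''\<close> can find out which child of an extendible string dies first, and a diagonally
    non-recursive bit avoids that child.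
  \<^item> \<open>3-DNR\<^sub>2\<close> to \<open>oCOH\<close>: by the limit lemma the values \<open>\<Phi>\<^sub>e(p'')(e)\<close> are double limits of guesses
    computable from \<open>p\<close>. The set \<open>Z\<close> consists of the pairs of a stage \<open>s\<close> and the modulus of the inner
    limit at \<open>s\<close>, and \<open>A\<^sub>e\<close> consists of the pairs whose guess for \<open>e\<close> is 1. If the value exists, then
    almost all of \<open>Z\<close> agrees about it.
  \<^item> \<open>oCOH\<close> to \<open>INForONE*\<close>: take the cells \<open>A\<^sup>\<sigma>\<close> themselves as the sets. Two elements of a solution in
    a cell witness that the cell is infinite, so a path of infinite cells can be searched for.
  \<^item> \<open>INForONE\<close> to \<open>RSgr\<close> and \<open>INForONE*\<close> to \<open>RSg\<close>: the graph has a vertex for every number \<open>x\<close>, for every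
    set \<open>A\<^sub>i\<close> and for every pair \<open>{i, j}\<close>. Numbers are joined to the sets containing them and to all
    smaller pairs, \<open>x < y\<close> are joined if \<open>x \<notin> Z\<close> according to stage \<open>y\<close>, and pairs are joined to
    their two sets. Elements of \<open>Z\<close> have finite degree and are adjacent to any two given pairs or
    false numbers once they are large, so a solution contains at most one of these; and it cannot
    consist of set vertices only, as two of them share a pair as common neighbour.
  \<^item> \<open>RSgr\<close> to \<open>WKL''\<close>: paths of a tree computable from \<open>p''\<close> consist of a sequence \<open>q\<close> with the property
    that for all \<open>m\<close>, if \<open>F\<close> has an element above \<open>m\<close>, then it has one in the cell of \<open>q \<restriction> m\<close>, together with a
    sparse sequence of vertices from \<open>F\<close> following \<open>q\<close>. If it turns out that \<open>F\<close> is finite, almost all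
    vertices are added to the sequence instead; thus no case distinction is needed.
\<close>

section \<open>A calculus of computable functionals\<close>

text \<open>One program serves all oracles in \<open>S\<close>, since Weihrauch reductions are
  uniform. Restricting to \<open>S\<close> admits searches that end only for these oracles.\<close>

definition computable_on :: "baire set \<Rightarrow> (baire \<Rightarrow> nat \<Rightarrow> nat) \<Rightarrow> bool" where
  "computable_on S F \<longleftrightarrow> (\<exists>c. \<forall>p\<in>S. \<forall>n. run c p n = Some (F p n))"

abbreviation decidable_on :: "baire set \<Rightarrow> (baire \<Rightarrow> nat \<Rightarrow> bool) \<Rightarrow> bool" where
  "decidable_on S R \<equiv> computable_on S (\<lambda>p n. of_bool (R p n))"

abbreviation pfst :: "nat \<Rightarrow> nat" where "pfst n \<equiv> fst (prod_decode n)"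
abbreviation psnd :: "nat \<Rightarrow> nat" where "psnd n \<equiv> snd (prod_decode n)"

named_theorems comp_intros

lemma computable_onI: "(\<And>p n. p \<in> S \<Longrightarrow> run c p n = Some (F p n)) \<Longrightarrow> computable_on S F"
  by (auto simp: computable_on_def)

lemma computable_onE:
  assumes "computable_on S F"
  obtains c where "\<And>p n. p \<in> S \<Longrightarrow> run c p n = Some (F p n)"
  using assms by (auto simp: computable_on_def)

lemma computable_on_subset: "computable_on S F \<Longrightarrow> S' \<subseteq> S \<Longrightarrow> computable_on S' F"
  by (auto simp: computable_on_def)

text \<open>There is no identity program; decoding a pair and encoding it again supplies
  one.\<close>

lemma computable_on_id [comp_intros]: "computable_on S (\<lambda>p n. n)"
  by (rule computable_onI[where c = "Pair Fst Snd"]) simp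

primrec const_prog :: "nat \<Rightarrow> prog" where
  "const_prog 0 = Zero"
| "const_prog (Suc k) = Comp Succ (const_prog k)"

lemma run_const_prog [simp]: "run (const_prog k) p n = Some k"
  by (induction k) auto

lemma computable_on_const [comp_intros]: "computable_on S (\<lambda>p n. k)"
  by (rule computable_onI[where c = "const_prog k"]) simp

lemma computable_on_compose:
  assumes "computable_on S F" "computable_on S G"
  shows "computable_on S (\<lambda>p n. F p (G p n))"
proof -
  obtain c d where "\<And>p n. p \<in> S \<Longrightarrow> run c p n = Some (F p n)"
    "\<And>p n. p \<in> S \<Longrightarrow> run d p n = Some (G p n)"
    using assms by (auto elim!: computable_onE)
  then show ?thesis by (intro computable_onI[where c = "Comp c d"]) simp
qed

lemma computable_on_pair [comp_intros]:
  assumes "computable_on S F" "computable_on S G"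
  shows "computable_on S (\<lambda>p n. prod_encode (F p n, G p n))"
proof -
  obtain c d where "\<And>p n. p \<in> S \<Longrightarrow> run c p n = Some (F p n)"
    "\<And>p n. p \<in> S \<Longrightarrow> run d p n = Some (G p n)"
    using assms by (auto elim!: computable_onE)
  then show ?thesis by (intro computable_onI[where c = "Pair c d"]) simp
qed

lemma computable_on_query [comp_intros]:
  "computable_on S F \<Longrightarrow> computable_on S (\<lambda>p n. p (F p n))"
  by (rule computable_on_compose[where F = "\<lambda>p n. p n"])
    (auto intro: computable_onI[where c = Query])

lemma computable_on_Suc [comp_intros]:
  "computable_on S F \<Longrightarrow> computable_on S (\<lambda>p n. Suc (F p n))"
  by (rule computable_on_compose[where F = "\<lambda>p n. Suc n"])
    (auto intro: computable_onI[where c = Succ])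

lemma computable_on_pfst [comp_intros]:
  "computable_on S F \<Longrightarrow> computable_on S (\<lambda>p n. pfst (F p n))"
  by (rule computable_on_compose[where F = "\<lambda>p n. pfst n"])
    (auto intro: computable_onI[where c = Fst])

lemma computable_on_psnd [comp_intros]:
  "computable_on S F \<Longrightarrow> computable_on S (\<lambda>p n. psnd (F p n))"
  by (rule computable_on_compose[where F = "\<lambda>p n. psnd n"])
    (auto intro: computable_onI[where c = Snd])

text \<open>Programs are unary, so binary functions are shown computable on coded pairs; this
  substitutes arbitrary terms for the two components.\<close>

lemma computable_on_compose2:
  assumes "computable_on S (\<lambda>p m. H p (pfst m) (psnd m))" "computable_on S F" "computable_on S G"
  shows "computable_on S (\<lambda>p n. H p (F p n) (G p n))"
  using computable_on_compose[OF assms(1) computable_on_pair[OF assms(2,3)]] by simp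

lemma computable_on_rec_nat [comp_intros]:
  assumes F: "computable_on S F"
    and G: "computable_on S (\<lambda>p m. G p (pfst m) (pfst (psnd m)) (psnd (psnd m)))"
    and B: "computable_on S B"
  shows "computable_on S (\<lambda>p n. rec_nat (F p n) (\<lambda>k v. G p n k v) (B p n))"
proof -
  obtain c d b where c: "\<And>p n. p \<in> S \<Longrightarrow> run c p n = Some (F p n)"
    and d: "\<And>p n. p \<in> S \<Longrightarrow> run d p n = Some (G p (pfst n) (pfst (psnd n)) (psnd (psnd n)))"
    and b: "\<And>p n. p \<in> S \<Longrightarrow> run b p n = Some (B p n)"
    using assms by (auto elim!: computable_onE)
  have "rec_nat (run c p n)
      (\<lambda>k r. Option.bind r (\<lambda>v. run d p (prod_encode (n, prod_encode (k, v))))) m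
    = Some (rec_nat (F p n) (\<lambda>k v. G p n k v) m)" if "p \<in> S" for p n m
    using that by (induction m) (simp_all add: c d)
  with b show ?thesis
    by (intro computable_onI[where c = "Comp (Prec c d) (Pair (Pair Fst Snd) b)"]) simp
qed

lemma computable_on_add [comp_intros]:
  assumes "computable_on S F" "computable_on S G"
  shows "computable_on S (\<lambda>p n. F p n + G p n)"
proof -
  have "rec_nat a (\<lambda>k v. Suc v) b = a + b" for a b by (induction b) auto
  moreover have "computable_on S (\<lambda>p n. rec_nat (F p n) (\<lambda>k v. Suc v) (G p n))"
    by (intro comp_intros assms)
  ultimately show ?thesis by simp
qed

lemma computable_on_mult [comp_intros]:
  assumes "computable_on S F" "computable_on S G"
  shows "computable_on S (\<lambda>p n. F p n * G p n)"
proof -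
  have "rec_nat 0 (\<lambda>k v. v + a) b = a * b" for a b :: nat by (induction b) auto
  moreover have "computable_on S (\<lambda>p n. rec_nat 0 (\<lambda>k v. v + F p n) (G p n))"
    by (intro comp_intros assms computable_on_compose[OF assms(1)])
  ultimately show ?thesis by simp
qed

lemma computable_on_minus [comp_intros]:
  assumes "computable_on S F" "computable_on S G"
  shows "computable_on S (\<lambda>p n. F p n - G p n)"
proof -
  have pred: "rec_nat 0 (\<lambda>k v. k) b = b - 1" for b :: nat by (cases b) auto
  have "rec_nat a (\<lambda>k v. rec_nat 0 (\<lambda>k v. k) v) b = a - b" for a b :: nat
    by (induction b) (auto simp: pred)
  moreover have "computable_on S (\<lambda>p n. rec_nat (F p n) (\<lambda>k v. rec_nat 0 (\<lambda>k v. k) v) (G p n))"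
    by (intro comp_intros assms)
  ultimately show ?thesis by simp
qed

lemma computable_on_power [comp_intros]:
  assumes "computable_on S F" "computable_on S G"
  shows "computable_on S (\<lambda>p n. F p n ^ G p n)"
proof -
  have "rec_nat 1 (\<lambda>k v. v * a) b = a ^ b" for a b :: nat by (induction b) auto
  moreover have "computable_on S (\<lambda>p n. rec_nat 1 (\<lambda>k v. v * F p n) (G p n))"
    by (intro comp_intros assms computable_on_compose[OF assms(1)])
  ultimately show ?thesis by simp
qed

lemma decidable_on_not [comp_intros]:
  assumes "decidable_on S R"
  shows "decidable_on S (\<lambda>p n. \<not> R p n)"
proof -
  have *: "(\<lambda>p n. of_bool (\<not> R p n)) = (\<lambda>p n. 1 - (of_bool (R p n) :: nat))" by (auto simp: fun_eq_iff)
  show ?thesis unfolding * by (intro comp_intros assms)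
qed

lemma decidable_on_conj [comp_intros]:
  assumes "decidable_on S R" "decidable_on S Q"
  shows "decidable_on S (\<lambda>p n. R p n \<and> Q p n)"
proof -
  have *: "(\<lambda>p n. of_bool (R p n \<and> Q p n)) = (\<lambda>p n. of_bool (R p n) * (of_bool (Q p n) :: nat))"
    by (auto simp: fun_eq_iff)
  show ?thesis unfolding * by (intro comp_intros assms)
qed

lemma decidable_on_disj [comp_intros]:
  assumes "decidable_on S R" "decidable_on S Q"
  shows "decidable_on S (\<lambda>p n. R p n \<or> Q p n)"
proof -
  have "decidable_on S (\<lambda>p n. \<not> (\<not> R p n \<and> \<not> Q p n))" by (intro comp_intros assms)
  then show ?thesis by simp
qed

lemma decidable_on_imp [comp_intros]:
  assumes "decidable_on S R" "decidable_on S Q"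
  shows "decidable_on S (\<lambda>p n. R p n \<longrightarrow> Q p n)"
proof -
  have "decidable_on S (\<lambda>p n. \<not> R p n \<or> Q p n)" by (intro comp_intros assms)
  then show ?thesis unfolding imp_conv_disj .
qed

lemma decidable_on_iff [comp_intros]:
  assumes "decidable_on S R" "decidable_on S Q"
  shows "decidable_on S (\<lambda>p n. R p n \<longleftrightarrow> Q p n)"
proof -
  have "decidable_on S (\<lambda>p n. (R p n \<longrightarrow> Q p n) \<and> (Q p n \<longrightarrow> R p n))" by (intro comp_intros assms)
  then show ?thesis by (simp add: iff_conv_conj_imp)
qed

lemma decidable_on_le [comp_intros]:
  assumes "computable_on S F" "computable_on S G"
  shows "decidable_on S (\<lambda>p n. F p n \<le> G p n)"
proof -
  have *: "(\<lambda>p n. of_bool (F p n \<le> G p n)) = (\<lambda>p n. 1 - (F p n - G p n))" by (auto simp: fun_eq_iff)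
  show ?thesis unfolding * by (intro comp_intros assms)
qed

lemma decidable_on_less [comp_intros]:
  assumes "computable_on S F" "computable_on S G"
  shows "decidable_on S (\<lambda>p n. F p n < G p n)"
  using decidable_on_not[OF decidable_on_le[OF assms(2,1)]] by (simp add: not_le)

lemma decidable_on_eq [comp_intros]:
  assumes "computable_on S F" "computable_on S G"
  shows "decidable_on S (\<lambda>p n. F p n = G p n)"
proof -
  have "decidable_on S (\<lambda>p n. F p n \<le> G p n \<and> G p n \<le> F p n)" by (intro comp_intros assms)
  then show ?thesis by (simp add: eq_iff)
qed

lemma computable_on_if [comp_intros]:
  assumes "decidable_on S R" "computable_on S F" "computable_on S G"
  shows "computable_on S (\<lambda>p n. if R p n then F p n else G p n)"
proof -
  have *: "(\<lambda>p n. if R p n then F p n else G p n) =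
    (\<lambda>p n. of_bool (R p n) * F p n + of_bool (\<not> R p n) * G p n)" by (auto simp: fun_eq_iff)
  show ?thesis unfolding * by (intro comp_intros assms)
qed

lemma decidable_on_ex_less [comp_intros]:
  assumes R: "decidable_on S (\<lambda>p m. R p (pfst m) (psnd m))" and B: "computable_on S B"
  shows "decidable_on S (\<lambda>p n. \<exists>i<B p n. R p n i)"
proof -
  have "rec_nat 0 (\<lambda>k v. of_bool (v = 1 \<or> R p n k)) b = (of_bool (\<exists>i<b. R p n i) :: nat)" for p n b
    by (induction b) (auto simp: less_Suc_eq)
  moreover have "computable_on S (\<lambda>p n. rec_nat 0 (\<lambda>k v. of_bool (v = 1 \<or> R p n k)) (B p n))"
    by (intro comp_intros B computable_on_compose2[OF R])
  ultimately show ?thesis by simp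
qed

lemma decidable_on_all_less [comp_intros]:
  assumes "decidable_on S (\<lambda>p m. R p (pfst m) (psnd m))" "computable_on S B"
  shows "decidable_on S (\<lambda>p n. \<forall>i<B p n. R p n i)"
proof -
  have "decidable_on S (\<lambda>p n. \<not> (\<exists>i<B p n. \<not> R p n i))" by (intro comp_intros assms)
  then show ?thesis by simp
qed

lemma decidable_on_ex_le [comp_intros]:
  assumes "decidable_on S (\<lambda>p m. R p (pfst m) (psnd m))" "computable_on S B"
  shows "decidable_on S (\<lambda>p n. \<exists>i\<le>B p n. R p n i)"
  using decidable_on_ex_less[OF assms(1) computable_on_Suc[OF assms(2)]] by (simp add: less_Suc_eq_le)

lemma decidable_on_all_le [comp_intros]:
  assumes "decidable_on S (\<lambda>p m. R p (pfst m) (psnd m))" "computable_on S B"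
  shows "decidable_on S (\<lambda>p n. \<forall>i\<le>B p n. R p n i)"
  using decidable_on_all_less[OF assms(1) computable_on_Suc[OF assms(2)]] by (simp add: less_Suc_eq_le)

text \<open>The program diverges if there is no witness. This partiality is wanted: the jump, or a
  diagonally non-recursive function, can then be asked about the search.\<close>

lemma decidable_on_search:
  assumes "decidable_on S (\<lambda>p m. R p (pfst m) (psnd m))"
  obtains c where "\<And>p n. p \<in> S \<Longrightarrow>
    run c p n = (if \<exists>m. R p n m then Some (LEAST m. R p n m) else None)"
proof -
  \<comment> \<open>\<open>Mu\<close> looks for a zero, hence the negation.\<close>
  obtain c where c: "\<And>p n. p \<in> S \<Longrightarrow> run c p n = Some (of_bool (\<not> R p (pfst n) (psnd n)))"
    using decidable_on_not[OF assms] by (auto elim!: computable_onE)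
  have "run (Mu c) p n = (if \<exists>m. R p n m then Some (LEAST m. R p n m) else None)" if "p \<in> S" for p n
  proof -
    define Q where "Q = (\<lambda>m. run c p (prod_encode (n, m)) = Some 0 \<and>
      (\<forall>i<m. \<exists>v>0. run c p (prod_encode (n, i)) = Some v))"
    have Q: "Q m \<longleftrightarrow> R p n m \<and> (\<forall>i<m. \<not> R p n i)" for m
      using that by (auto simp: Q_def c)
    have ex: "(\<exists>m. Q m) \<longleftrightarrow> (\<exists>m. R p n m)"
      unfolding Q by (metis exists_least_iff)
    have "(LEAST m. Q m) = (LEAST m. R p n m)" if "R p n m" for m
    proof (rule Least_equality)
      show "Q (LEAST m. R p n m)"
        using that unfolding Q by (metis LeastI not_less_Least)
      show "(LEAST m. R p n m) \<le> y" if "Q y" for y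
        using that unfolding Q by (simp add: Least_le)
    qed
    with ex show ?thesis by (auto simp: Q_def Let_def)
  qed
  then show ?thesis by (rule that)
qed

lemma computable_on_Least:
  assumes "decidable_on S (\<lambda>p m. R p (pfst m) (psnd m))" "\<And>p n. p \<in> S \<Longrightarrow> \<exists>m. R p n m"
  shows "computable_on S (\<lambda>p n. LEAST m. R p n m)"
proof -
  obtain c where "\<And>p n. p \<in> S \<Longrightarrow>
      run c p n = (if \<exists>m. R p n m then Some (LEAST m. R p n m) else None)"
    using decidable_on_search[OF assms(1)] by blast
  with assms(2) show ?thesis by (intro computable_onI[where c = c]) simp
qed

lemma computable_on_div [comp_intros]:
  assumes "computable_on S F" "computable_on S G"
  shows "computable_on S (\<lambda>p n. F p n div G p n)"
proof -
  \<comment> \<open>The disjunct \<open>b = 0\<close> ends the search at once with 0, which is the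
    value of division by 0.\<close>
  have *: "(LEAST q. b = 0 \<or> a < Suc q * b) = a div b" for a b :: nat
  proof (cases "b = 0")
    case False
    then show ?thesis
      using dividend_less_div_times[of b a]
      by (intro Least_equality)
        (auto simp: add.commute div_less_iff_less_mult less_Suc_eq_le[symmetric] simp del: mult_Suc,
          simp)
  qed simp
  have "computable_on S (\<lambda>p n. LEAST q. G p n = 0 \<or> F p n < Suc q * G p n)"
  proof (rule computable_on_Least)
    show "decidable_on S (\<lambda>p m. G p (pfst m) = 0 \<or> F p (pfst m) < Suc (psnd m) * G p (pfst m))"
      by (intro comp_intros computable_on_compose[OF assms(1)] computable_on_compose[OF assms(2)])
    show "\<exists>m. G p n = 0 \<or> F p n < Suc m * G p n" for p n
      by (cases "G p n") (auto intro!: exI[of _ "F p n"])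
  qed
  then show ?thesis unfolding * .
qed

lemma computable_on_mod [comp_intros]:
  assumes "computable_on S F" "computable_on S G"
  shows "computable_on S (\<lambda>p n. F p n mod G p n)"
proof -
  have "computable_on S (\<lambda>p n. F p n - F p n div G p n * G p n)" by (intro comp_intros assms)
  then show ?thesis by (simp add: minus_div_mult_eq_mod)
qed

lemma decidable_on_even [comp_intros]:
  assumes "computable_on S F"
  shows "decidable_on S (\<lambda>p n. even (F p n))"
  unfolding even_iff_mod_2_eq_zero by (intro comp_intros assms)

lemma decidable_on_mem_set_decode [comp_intros]:
  assumes "computable_on S F" "computable_on S G"
  shows "decidable_on S (\<lambda>p n. F p n \<in> set_decode (G p n))"
  unfolding set_decode_def mem_Collect_eq by (intro comp_intros assms)

lemma computable_on_join [comp_intros]: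
  assumes F: "computable_on S (\<lambda>p m. F p (pfst m) (psnd m))"
    and G: "computable_on S (\<lambda>p m. G p (pfst m) (psnd m))" and "computable_on S B"
  shows "computable_on S (\<lambda>p n. join (F p n) (G p n) (B p n))"
  unfolding join_def
  by (intro comp_intros assms(3) computable_on_compose2[OF F] computable_on_compose2[OF G])

lemma join_even [simp]: "join p q (2 * n) = p n"
  and join_odd [simp]: "join p q (Suc (2 * n)) = q n"
  by (auto simp: join_def)

section \<open>Lists coded as numbers\<close>

definition code_nth :: "nat \<Rightarrow> nat \<Rightarrow> nat" where
  "code_nth c i = pfst (rec_nat c (\<lambda>k v. psnd (v - 1)) i - 1)"

definition code_length :: "nat \<Rightarrow> nat" where
  "code_length c = (LEAST i. rec_nat c (\<lambda>k v. psnd (v - 1)) i = 0)"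

text \<open>The code of a nonempty list is the successor of the pair of its head and its coded tail,
  so \<open>psnd (v - 1)\<close> passes to the tail.\<close>

lemma code_drop: "i \<le> length xs \<Longrightarrow>
  rec_nat (list_encode xs) (\<lambda>k v. psnd (v - 1)) i = list_encode (drop i xs)"
proof (induction i)
  case (Suc i)
  then obtain y ys where "drop i xs = y # ys" "drop (Suc i) xs = ys"
    by (metis Cons_nth_drop_Suc Suc_le_eq)
  with Suc show ?case by simp
qed simp

lemma code_nth [simp]: "i < length xs \<Longrightarrow> code_nth (list_encode xs) i = xs ! i"
  by (simp add: code_nth_def code_drop Cons_nth_drop_Suc[symmetric] del: One_nat_def)

lemma list_encode_eq_0 [simp]: "list_encode xs = 0 \<longleftrightarrow> xs = []"
  by (cases xs) auto

lemma code_length [simp]: "code_length (list_encode xs) = length xs"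
  unfolding code_length_def
proof (rule Least_equality)
  show "length xs \<le> i" if "rec_nat (list_encode xs) (\<lambda>k v. psnd (v - 1)) i = 0" for i
    using that by (cases "length xs \<le> i") (auto simp: code_drop simp del: One_nat_def)
qed (simp add: code_drop del: One_nat_def)

lemma computable_on_code_nth [comp_intros]:
  assumes "computable_on S F" "computable_on S G"
  shows "computable_on S (\<lambda>p n. code_nth (F p n) (G p n))"
  unfolding code_nth_def by (intro comp_intros assms)

lemma computable_on_code_length [comp_intros]:
  assumes "computable_on S F"
  shows "computable_on S (\<lambda>p n. code_length (F p n))"
proof (rule computable_on_compose[where F = "\<lambda>p n. code_length n", OF _ assms])
  show "computable_on S (\<lambda>p n. code_length n)"
    unfolding code_length_def
  proof (rule computable_on_Least)
    show "\<exists>m. rec_nat n (\<lambda>k v. psnd (v - 1)) m = 0" for n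
      using code_drop[of "length (list_decode n)" "list_decode n"] by auto
    show "decidable_on S (\<lambda>p m. rec_nat (pfst m) (\<lambda>k v. psnd (v - 1)) (psnd m) = 0)"
      by (intro comp_intros)
  qed
qed

section \<open>Weihrauch reductions\<close>

text \<open>\<open>Query\<close> is the only access to the oracle, so replacing it by a program that
  computes a second oracle composes functionals.\<close>

primrec subst_oracle :: "prog \<Rightarrow> prog \<Rightarrow> prog" where
  "subst_oracle b Zero = Zero"
| "subst_oracle b Succ = Succ"
| "subst_oracle b Fst = Fst"
| "subst_oracle b Snd = Snd"
| "subst_oracle b Query = b"
| "subst_oracle b (Pair c d) = Pair (subst_oracle b c) (subst_oracle b d)"
| "subst_oracle b (Comp c d) = Comp (subst_oracle b c) (subst_oracle b d)"
| "subst_oracle b (Prec c d) = Prec (subst_oracle b c) (subst_oracle b d)"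
| "subst_oracle b (Mu c) = Mu (subst_oracle b c)"

lemma run_subst_oracle:
  assumes "\<And>n. run b p n = Some (q n)"
  shows "run (subst_oracle b c) p n = run c q n"
proof -
  have "run (subst_oracle b c) p = run c q" by (induction c) (auto simp: assms intro!: ext)
  then show ?thesis by simp
qed

lemma prog_decode_encode [simp]: "prog_decode (prog_encode c) = c"
  unfolding prog_decode_def by (simp add: inj_prog_encode inv_f_f inj_def)

definition reduces_via :: "problem \<Rightarrow> problem \<Rightarrow> prog \<Rightarrow> prog \<Rightarrow> bool" where
  "reduces_via F G c d \<longleftrightarrow> (\<forall>p\<in>pdom F. \<exists>q\<in>pdom G. (\<forall>n. run c p n = Some (q n)) \<and>
     (\<forall>r\<in>G q. \<exists>s\<in>F p. \<forall>n. run d (join p r) n = Some (s n)))"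

lemma weihrauch_le_iff_reduces_via: "F \<le>\<^sub>W G \<longleftrightarrow> (\<exists>c d. reduces_via F G c d)"
proof -
  have "F \<le>\<^sub>W G \<longleftrightarrow> (\<exists>d e. reduces_via F G (prog_decode d) (prog_decode e))"
    by (simp add: weihrauch_le_def maps_to_def Phi_def reduces_via_def)
  also have "\<dots> \<longleftrightarrow> (\<exists>c d. reduces_via F G c d)"
    by (metis prog_decode_encode)
  finally show ?thesis .
qed

text \<open>\<open>L\<close> has to be computable only on joins of an instance with a solution, so
  it may search for objects whose existence the solution guarantees.\<close>

lemma weihrauch_leI:
  assumes "computable_on (pdom F) K" "\<And>p. p \<in> pdom F \<Longrightarrow> K p \<in> pdom G"
    and "computable_on {join p r |p r. p \<in> pdom F \<and> r \<in> G (K p)} L"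
    and "\<And>p r. p \<in> pdom F \<Longrightarrow> r \<in> G (K p) \<Longrightarrow> L (join p r) \<in> F p"
  shows "F \<le>\<^sub>W G"
proof -
  obtain c where c: "\<And>p n. p \<in> pdom F \<Longrightarrow> run c p n = Some (K p n)"
    using assms(1) unfolding computable_on_def by blast
  obtain d where d: "\<forall>x\<in>{join p r |p r. p \<in> pdom F \<and> r \<in> G (K p)}. \<forall>n. run d x n = Some (L x n)"
    using assms(3) unfolding computable_on_def ..
  have "reduces_via F G c d"
    unfolding reduces_via_def
  proof
    fix p assume p: "p \<in> pdom F"
    have "\<exists>s\<in>F p. \<forall>n. run d (join p r) n = Some (s n)" if "r \<in> G (K p)" for r
      using assms(4)[OF p that] d p that by blast
    then show "\<exists>q\<in>pdom G. (\<forall>n. run c p n = Some (q n)) \<and>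
       (\<forall>r\<in>G q. \<exists>s\<in>F p. \<forall>n. run d (join p r) n = Some (s n))"
      using assms(2)[OF p] c[OF p] by blast
  qed
  then show ?thesis unfolding weihrauch_le_iff_reduces_via by blast
qed

text \<open>From \<open>join p t\<close> the composed backward functional recovers the intermediate
  instance \<open>q\<close>, then a solution \<open>r\<close> of it from \<open>q\<close> and
  \<open>t\<close>, and finally \<open>s\<close> from \<open>p\<close> and \<open>r\<close>.\<close>

lemma weihrauch_le_trans:
  assumes "F \<le>\<^sub>W G" "G \<le>\<^sub>W H"
  shows "F \<le>\<^sub>W H"
proof -
  obtain c d c' d' where cd: "reduces_via F G c d" and cd': "reduces_via G H c' d'"
    using assms unfolding weihrauch_le_iff_reduces_via by blast
  have "computable_on UNIV (\<lambda>x n. x (2 * n))" "computable_on UNIV (\<lambda>x n. x (Suc (2 * n)))"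
    by (intro comp_intros)+
  then obtain l o' where l: "\<And>x n. run l x n = Some (x (2 * n))"
    and o': "\<And>x n. run o' x n = Some (x (Suc (2 * n)))"
    unfolding computable_on_def by blast
  \<comment> \<open>Joins the outputs of two functionals; the program is correct for every oracle on
    which both are total.\<close>
  have glue: "\<exists>e. \<forall>x u v. (\<forall>n. run a x n = Some (u n)) \<longrightarrow> (\<forall>n. run b x n = Some (v n)) \<longrightarrow>
      (\<forall>n. run e x n = Some (join u v n))" for a b
  proof -
    let ?S = "{x. \<forall>n. run a x n \<noteq> None \<and> run b x n \<noteq> None}"
    have a: "computable_on ?S (\<lambda>x n. the (run a x n))" and b: "computable_on ?S (\<lambda>x n. the (run b x n))"
      by (rule computable_onI[where c = a], force, rule computable_onI[where c = b], force)
    have "computable_on ?S (\<lambda>x n. join (\<lambda>n. the (run a x n)) (\<lambda>n. the (run b x n)) n)"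
      by (intro comp_intros computable_on_compose[OF a] computable_on_compose[OF b])
    then obtain e where e: "\<And>x n. x \<in> ?S \<Longrightarrow>
        run e x n = Some (join (\<lambda>n. the (run a x n)) (\<lambda>n. the (run b x n)) n)"
      unfolding computable_on_def by blast
    have "run e x n = Some (join u v n)"
      if "\<forall>n. run a x n = Some (u n)" "\<forall>n. run b x n = Some (v n)" for x u v n
      using e[of x n] that by simp
    then show ?thesis by blast
  qed
  define a where "a = subst_oracle l c"
  have a: "\<forall>n. run a (join p t) n = Some (q n)" if "\<forall>n. run c p n = Some (q n)" for p t q
    unfolding a_def using that by (subst run_subst_oracle[where q = p]) (auto simp: l)
  obtain e1 where e1: "\<And>x u v. \<forall>n. run a x n = Some (u n) \<Longrightarrow> \<forall>n. run o' x n = Some (v n) \<Longrightarrow>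
      \<forall>n. run e1 x n = Some (join u v n)" using glue[of a o'] by blast
  define b where "b = subst_oracle e1 d'"
  obtain e2 where e2: "\<And>x u v. \<forall>n. run l x n = Some (u n) \<Longrightarrow> \<forall>n. run b x n = Some (v n) \<Longrightarrow>
      \<forall>n. run e2 x n = Some (join u v n)" using glue[of l b] by blast
  have "reduces_via F H (subst_oracle c c') (subst_oracle e2 d)"
    unfolding reduces_via_def
  proof
    fix p assume "p \<in> pdom F"
    with cd obtain q where q: "q \<in> pdom G" "\<forall>n. run c p n = Some (q n)"
      "\<forall>r\<in>G q. \<exists>s\<in>F p. \<forall>n. run d (join p r) n = Some (s n)"
      unfolding reduces_via_def by blast
    with cd' obtain z where z: "z \<in> pdom H" "\<forall>n. run c' q n = Some (z n)"
      "\<forall>r\<in>H z. \<exists>s\<in>G q. \<forall>n. run d' (join q r) n = Some (s n)"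
      unfolding reduces_via_def by blast
    have "\<exists>s\<in>F p. \<forall>n. run (subst_oracle e2 d) (join p t) n = Some (s n)" if t: "t \<in> H z" for t
    proof -
      obtain r where r: "r \<in> G q" "\<forall>n. run d' (join q t) n = Some (r n)" using z t by blast
      obtain s where s: "s \<in> F p" "\<forall>n. run d (join p r) n = Some (s n)" using q r by blast
      have "\<forall>n. run e1 (join p t) n = Some (join q t n)"
        by (rule e1[OF a[OF q(2)]]) (simp add: o')
      then have "\<forall>n. run b (join p t) n = Some (r n)"
        unfolding b_def using r(2) by (simp add: run_subst_oracle)
      then have "\<forall>n. run e2 (join p t) n = Some (join p r n)"
        by (intro e2) (auto simp: l)
      then have "\<forall>n. run (subst_oracle e2 d) (join p t) n = Some (s n)"
        using s(2) by (simp add: run_subst_oracle)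
      with s(1) show ?thesis by blast
    qed
    moreover have "\<forall>n. run (subst_oracle c c') p n = Some (z n)"
      using q(2) z(2) by (simp add: run_subst_oracle)
    ultimately show "\<exists>q\<in>pdom H. (\<forall>n. run (subst_oracle c c') p n = Some (q n)) \<and>
       (\<forall>r\<in>H q. \<exists>s\<in>F p. \<forall>n. run (subst_oracle e2 d) (join p r) n = Some (s n))"
      using z(1) by blast
  qed
  then show ?thesis unfolding weihrauch_le_iff_reduces_via by blast
qed

section \<open>Trees, paths and jumps\<close>

lemma length_restr [simp]: "length (restr g n) = n"
  by (simp add: restr_def)

lemma nth_restr [simp]: "i < n \<Longrightarrow> restr g n ! i = g i"
  by (simp add: restr_def)

lemma restr_Suc: "restr g (Suc n) = restr g n @ [g n]"
  by (simp add: restr_def)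

lemma recursive_path:
  assumes "P []" "\<And>\<sigma>. P \<sigma> \<Longrightarrow> P (\<sigma> @ [r \<sigma>])" "\<And>n. g n = r (restr g n)"
  shows "P (restr g n)"
proof (induction n)
  case 0
  show ?case using assms(1) by (simp add: restr_def)
next
  case (Suc n)
  show ?case using assms(2)[OF Suc.IH] by (simp only: restr_Suc assms(3)[of n])
qed

lemma ex_recursive_path:
  fixes r :: "nat list \<Rightarrow> nat"
  shows "\<exists>g. \<forall>n. g n = r (restr g n)"
proof -
  define \<sigma> where "\<sigma> n = ((\<lambda>\<sigma>. \<sigma> @ [r \<sigma>]) ^^ n) []" for n
  define g where "g n = r (\<sigma> n)" for n
  have "restr g n = \<sigma> n" for n
    by (induction n) (simp_all add: restr_Suc \<sigma>_def g_def, simp add: restr_def)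
  then have "g n = r (restr g n)" for n by (simp add: g_def)
  then show ?thesis by blast
qed

lemma ex_path:
  assumes "P []" "\<And>\<sigma>. P \<sigma> \<Longrightarrow> P (\<sigma> @ [0]) \<or> P (\<sigma> @ [1])"
  shows "\<exists>g\<in>cantor. \<forall>n. P (restr g n)"
proof -
  define r where "r \<sigma> = (if P (\<sigma> @ [0]) then 0 else 1 :: nat)" for \<sigma>
  obtain g where g: "\<And>n. g n = r (restr g n)" using ex_recursive_path[of r] by blast
  have "P (restr g n)" for n
    using assms(1) _ g
  proof (rule recursive_path)
    show "P (\<sigma> @ [r \<sigma>])" if "P \<sigma>" for \<sigma>
      using assms(2)[OF that] by (auto simp: r_def)
  qed
  moreover have "g \<in> cantor"
    unfolding cantor_def by (auto simp: g r_def)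
  ultimately show ?thesis by blast
qed

text \<open>Extendibility is stated level by level, so that its negation names a level at which the
  string has no extension; such a level can be searched for.\<close>

definition alive :: "nat list set \<Rightarrow> nat list \<Rightarrow> bool" where
  "alive T \<sigma> \<longleftrightarrow> (\<forall>N\<ge>length \<sigma>. \<exists>\<tau>\<in>T. length \<tau> = N \<and> take (length \<sigma>) \<tau> = \<sigma>)"

lemma aliveD: "alive T \<sigma> \<Longrightarrow> \<sigma> \<in> T"
  by (force simp: alive_def)

lemma finite_lists_bounded:
  assumes "T \<subseteq> lists {0, 1 :: nat}" "\<And>\<tau>. \<tau> \<in> T \<Longrightarrow> length \<tau> \<le> N"
  shows "finite T"
  by (rule finite_subset[OF _ finite_lists_length_le[of "{0, 1}" N]]) (use assms in \<open>auto\<close>)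

lemma alive_Nil:
  assumes "binary_tree T" "infinite T"
  shows "alive T []"
  unfolding alive_def
proof (intro allI impI)
  fix N
  obtain \<tau> where "\<tau> \<in> T" "N \<le> length \<tau>"
    using finite_lists_bounded[of T N] assms unfolding binary_tree_def by (meson linear)
  then show "\<exists>\<tau>\<in>T. length \<tau> = N \<and> take (length []) \<tau> = []"
    using assms(1) by (intro bexI[of _ "take N \<tau>"]) (auto simp: binary_tree_def)
qed

lemma alive_append:
  assumes T: "binary_tree T" and "alive T \<sigma>"
  shows "alive T (\<sigma> @ [0]) \<or> alive T (\<sigma> @ [1])"
proof (rule ccontr)
  assume "\<not> ?thesis"
  then obtain N M where NM: "N > length \<sigma>" "M > length \<sigma>"
    "\<And>\<tau>. \<tau> \<in> T \<Longrightarrow> length \<tau> = N \<Longrightarrow> take (Suc (length \<sigma>)) \<tau> \<noteq> \<sigma> @ [0]"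
    "\<And>\<tau>. \<tau> \<in> T \<Longrightarrow> length \<tau> = M \<Longrightarrow> take (Suc (length \<sigma>)) \<tau> \<noteq> \<sigma> @ [1]"
    by (auto simp: alive_def Suc_le_eq)
  \<comment> \<open>\<open>\<tau>\<close> reaches both levels. Its bit after \<open>\<sigma>\<close>
    is 0 or 1, and truncating \<open>\<tau>\<close> to \<open>N\<close> or \<open>M\<close>
    contradicts the death of that child.\<close>
  obtain \<tau> where \<tau>: "\<tau> \<in> T" "length \<tau> = max N M" "take (length \<sigma>) \<tau> = \<sigma>"
    using assms(2) NM(1) unfolding alive_def by (meson le_max_iff_disj less_imp_le)
  have "length \<sigma> < length \<tau>" using \<tau> NM by simp
  then have t: "take (Suc (length \<sigma>)) \<tau> = \<sigma> @ [\<tau> ! length \<sigma>]"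
    using \<tau>(3) by (simp add: take_Suc_conv_app_nth)
  have "\<tau> ! length \<sigma> \<in> {0, 1}"
    using \<tau> T \<open>length \<sigma> < length \<tau>\<close> unfolding binary_tree_def
    by (meson in_listsD nth_mem subsetD)
  moreover have "take K \<tau> \<in> T" for K using T \<tau>(1) by (auto simp: binary_tree_def)
  moreover have "length (take K \<tau>) = K \<and> take (Suc (length \<sigma>)) (take K \<tau>) = \<sigma> @ [\<tau> ! length \<sigma>]"
    if "K \<in> {N, M}" for K
    using that NM(1,2) \<tau>(2) t by (auto simp: min_absorb1 Suc_le_eq)
  ultimately show False
    using NM(3)[of "take N \<tau>"] NM(4)[of "take M \<tau>"] by auto
qed

lemma weak_koenig:
  assumes "binary_tree T" "infinite T"
  shows "\<exists>g\<in>cantor. \<forall>n. restr g n \<in> T"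
  using ex_path[of "alive T", OF alive_Nil[OF assms] alive_append[OF assms(1)]] aliveD by blast

section \<open>Names of trees and limits of approximations\<close>

lemma chi_inject [simp]: "chi A = chi B \<longleftrightarrow> A = B"
  by (auto simp: chi_def fun_eq_iff set_eq_iff)

lemma tree_name_inject [simp]: "tree_name S = tree_name T \<longleftrightarrow> S = T"
  by (auto simp: tree_name_def inj_image_eq_iff[OF inj_list_encode])

lemma WKL_tree_name:
  assumes "binary_tree T" "infinite T"
  shows "WKL (tree_name T) = {g \<in> cantor. \<forall>n. restr g n \<in> T}"
  using assms by (auto simp: WKL_def)

lemma tree_name_in_pdom_WKL:
  assumes "binary_tree T" "infinite T"
  shows "tree_name T \<in> pdom WKL"
  using weak_koenig[OF assms] by (auto simp: pdom_def WKL_tree_name[OF assms])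

lemma pdom_WKLE:
  assumes "p \<in> pdom WKL"
  obtains T where "binary_tree T" "infinite T" "p = tree_name T"
  using assms by (auto simp: pdom_def WKL_def)

lemma approximates_unique: "approximates f g \<Longrightarrow> approximates f h \<Longrightarrow> g = h"
  unfolding approximates_def by (metis LIMSEQ_unique ext)

lemma approximates_eventually:
  "approximates f g \<longleftrightarrow> (\<forall>n. \<forall>\<^sub>F s in sequentially. f (prod_encode (n, s)) = g n)"
  by (simp add: approximates_def tendsto_discrete)

text \<open>Limits are unique; if \<open>g\<close> lies outside the domain, both sides are
  empty.\<close>

lemma jump_approximates: "approximates f g \<Longrightarrow> jump F f = F g"
  by (auto simp: jump_def pdom_def dest: approximates_unique)

lemma pdom_jumpE:
  assumes "f \<in> pdom (jump F)"
  obtains g where "g \<in> pdom F" "approximates f g"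
  using assms by (auto simp: jump_def pdom_def)

section \<open>Double limits of decidable predicates\<close>

text \<open>By the limit lemma these are the predicates uniformly decidable from the double jump.
  The inner limit must exist for every \<open>s\<close>, because it is itself the object
  approximated in a double jump of a problem.\<close>

definition delta3 :: "(baire \<Rightarrow> nat \<Rightarrow> bool) \<Rightarrow> bool" where
  "delta3 R \<longleftrightarrow> (\<exists>r. decidable_on UNIV r \<and> (\<forall>p n. \<exists>l.
     (\<forall>s. \<forall>\<^sub>F t in sequentially. r p (prod_encode (prod_encode (n, s), t)) = l s) \<and>
     (\<forall>\<^sub>F s in sequentially. l s = R p n)))"

named_theorems delta3_intros

lemma delta3I:
  assumes "decidable_on UNIV r"
    "\<And>p n s. \<forall>\<^sub>F t in sequentially. r p (prod_encode (prod_encode (n, s), t)) = l p n s"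
    "\<And>p n. \<forall>\<^sub>F s in sequentially. l p n s = R p n"
  shows "delta3 R"
  unfolding delta3_def using assms by blast

lemma delta3E:
  assumes "delta3 R"
  obtains r l where "decidable_on UNIV r"
    "\<And>p n s. \<forall>\<^sub>F t in sequentially. r p (prod_encode (prod_encode (n, s), t)) = l p n s"
    "\<And>p n. \<forall>\<^sub>F s in sequentially. l p n s = R p n"
proof -
  obtain r where r: "decidable_on UNIV r" "\<forall>p n. \<exists>l.
     (\<forall>s. \<forall>\<^sub>F t in sequentially. r p (prod_encode (prod_encode (n, s), t)) = l s) \<and>
     (\<forall>\<^sub>F s in sequentially. l s = R p n)"
    using assms unfolding delta3_def by blast
  obtain l where l: "\<And>p n. (\<forall>s. \<forall>\<^sub>F t in sequentially. r p (prod_encode (prod_encode (n, s), t)) = l p n s) \<and>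
     (\<forall>\<^sub>F s in sequentially. l p n s = R p n)"
    using r(2) by metis
  show thesis by (rule that[OF r(1)]) (use l in blast)+
qed

lemma delta3_decidable:
  assumes "decidable_on UNIV R"
  shows "delta3 R"
proof (rule delta3I)
  show "decidable_on UNIV (\<lambda>p m. R p (pfst (pfst m)))"
    by (intro comp_intros computable_on_compose[OF assms])
qed auto

lemma delta3_not [delta3_intros]:
  assumes "delta3 R"
  shows "delta3 (\<lambda>p n. \<not> R p n)"
proof -
  obtain r l where r: "decidable_on UNIV r"
    "\<And>p n s. \<forall>\<^sub>F t in sequentially. r p (prod_encode (prod_encode (n, s), t)) = l p n s"
    "\<And>p n. \<forall>\<^sub>F s in sequentially. l p n s = R p n"
    using delta3E[OF assms] by blast
  show ?thesis
    by (rule delta3I[where r = "\<lambda>p m. \<not> r p m" and l = "\<lambda>p n s. \<not> l p n s"])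
      (simp_all add: r decidable_on_not)
qed

lemma delta3_conj [delta3_intros]:
  assumes "delta3 R" "delta3 Q"
  shows "delta3 (\<lambda>p n. R p n \<and> Q p n)"
proof -
  obtain r l where r: "decidable_on UNIV r"
    "\<And>p n s. \<forall>\<^sub>F t in sequentially. r p (prod_encode (prod_encode (n, s), t)) = l p n s"
    "\<And>p n. \<forall>\<^sub>F s in sequentially. l p n s = R p n"
    using delta3E[OF assms(1)] by blast
  obtain q m where q: "decidable_on UNIV q"
    "\<And>p n s. \<forall>\<^sub>F t in sequentially. q p (prod_encode (prod_encode (n, s), t)) = m p n s"
    "\<And>p n. \<forall>\<^sub>F s in sequentially. m p n s = Q p n"
    using delta3E[OF assms(2)] by blast
  show ?thesis
  proof (rule delta3I)
    show "decidable_on UNIV (\<lambda>p n. r p n \<and> q p n)" by (intro comp_intros r q)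
    show "\<forall>\<^sub>F t in sequentially. (r p (prod_encode (prod_encode (n, s), t)) \<and>
      q p (prod_encode (prod_encode (n, s), t))) = (l p n s \<and> m p n s)" for p n s
      using r(2)[of p n s] q(2)[of p n s] by eventually_elim simp
    show "\<forall>\<^sub>F s in sequentially. (l p n s \<and> m p n s) = (R p n \<and> Q p n)" for p n
      using r(3)[of p n] q(3)[of p n] by eventually_elim simp
  qed
qed

lemma delta3_disj [delta3_intros]:
  assumes "delta3 R" "delta3 Q"
  shows "delta3 (\<lambda>p n. R p n \<or> Q p n)"
proof -
  have "delta3 (\<lambda>p n. \<not> (\<not> R p n \<and> \<not> Q p n))" by (intro delta3_intros assms)
  then show ?thesis by simp
qed

lemma delta3_imp [delta3_intros]:
  assumes "delta3 R" "delta3 Q"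
  shows "delta3 (\<lambda>p n. R p n \<longrightarrow> Q p n)"
proof -
  have "delta3 (\<lambda>p n. \<not> R p n \<or> Q p n)" by (intro delta3_intros assms)
  then show ?thesis unfolding imp_conv_disj .
qed

lemma delta3_iff [delta3_intros]:
  assumes "delta3 R" "delta3 Q"
  shows "delta3 (\<lambda>p n. R p n \<longleftrightarrow> Q p n)"
proof -
  have "delta3 (\<lambda>p n. (R p n \<longrightarrow> Q p n) \<and> (Q p n \<longrightarrow> R p n))" by (intro delta3_intros assms)
  then show ?thesis by (simp add: iff_conv_conj_imp)
qed

lemma delta3_all_less [delta3_intros]:
  assumes "delta3 (\<lambda>p m. R p (pfst m) (psnd m))" "computable_on UNIV B"
  shows "delta3 (\<lambda>p n. \<forall>i<B p n. R p n i)"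
proof -
  obtain r l where r: "decidable_on UNIV r"
    "\<And>p n s. \<forall>\<^sub>F t in sequentially. r p (prod_encode (prod_encode (n, s), t)) = l p n s"
    "\<And>p n. \<forall>\<^sub>F s in sequentially. l p n s = R p (pfst n) (psnd n)"
    using delta3E[OF assms(1)] by blast
  show ?thesis
  proof (rule delta3I)
    show "decidable_on UNIV (\<lambda>p m. \<forall>i<B p (pfst (pfst m)).
      r p (prod_encode (prod_encode (prod_encode (pfst (pfst m), i), psnd (pfst m)), psnd m)))"
      by (intro comp_intros computable_on_compose[OF r(1)] computable_on_compose[OF assms(2)])
    show "\<forall>\<^sub>F t in sequentially. (\<forall>i<B p (pfst (pfst (prod_encode (prod_encode (n, s), t)))).
      r p (prod_encode (prod_encode (prod_encode (pfst (pfst (prod_encode (prod_encode (n, s), t))), i),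
        psnd (pfst (prod_encode (prod_encode (n, s), t)))), psnd (prod_encode (prod_encode (n, s), t)))))
      = (\<forall>i<B p n. l p (prod_encode (n, i)) s)" for p n s
    proof -
      \<comment> \<open>Finitely many limits settle simultaneously.\<close>
      have "\<forall>\<^sub>F t in sequentially. \<forall>i\<in>{..<B p n}.
          r p (prod_encode (prod_encode (prod_encode (n, i), s), t)) = l p (prod_encode (n, i)) s"
        by (intro eventually_ball_finite) (auto intro: r)
      then show ?thesis by eventually_elim simp
    qed
    show "\<forall>\<^sub>F s in sequentially. (\<forall>i<B p n. l p (prod_encode (n, i)) s) = (\<forall>i<B p n. R p n i)" for p n
    proof -
      have "\<forall>\<^sub>F s in sequentially. \<forall>i\<in>{..<B p n}. l p (prod_encode (n, i)) s = R p n i"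
        by (intro eventually_ball_finite) (use r(3)[of p "prod_encode (n, _)"] in auto)
      then show ?thesis by eventually_elim simp
    qed
  qed
qed

lemma delta3_ex_le [delta3_intros]:
  assumes "delta3 (\<lambda>p m. R p (pfst m) (psnd m))" "computable_on UNIV B"
  shows "delta3 (\<lambda>p n. \<exists>i\<le>B p n. R p n i)"
proof -
  have "delta3 (\<lambda>p n. \<not> (\<forall>i<Suc (B p n). \<not> R p n i))" by (intro delta3_intros comp_intros assms)
  then show ?thesis by (simp add: less_Suc_eq_le)
qed

text \<open>Inner stages bound \<open>b\<close> and outer stages bound \<open>a\<close>: for fixed
  \<open>s\<close>, finitely many universal statements are decided in the limit, and the existential
  statement shows its value once \<open>s\<close> exceeds a witness.\<close>

lemma delta3_sigma2:
  assumes "decidable_on UNIV (\<lambda>p m. R p (pfst m) (pfst (psnd m)) (psnd (psnd m)))"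
  shows "delta3 (\<lambda>p n. \<exists>a. \<forall>b. R p n a b)"
proof (rule delta3I)
  show "decidable_on UNIV (\<lambda>p m. \<exists>a\<le>psnd (pfst m). \<forall>b\<le>psnd m. R p (pfst (pfst m)) a b)"
  proof -
    have "computable_on UNIV (\<lambda>p n. of_bool (R p (X p n) (Y p n) (Z p n)))"
      if "computable_on UNIV X" "computable_on UNIV Y" "computable_on UNIV Z" for X Y Z
      using computable_on_compose[OF assms computable_on_pair[OF that(1) computable_on_pair[OF that(2,3)]]]
      by simp
    note [comp_intros] = this
    show ?thesis by (intro comp_intros)
  qed
  show "\<forall>\<^sub>F t in sequentially. (\<exists>a\<le>psnd (pfst (prod_encode (prod_encode (n, s), t))).
      \<forall>b\<le>psnd (prod_encode (prod_encode (n, s), t)). R p (pfst (pfst (prod_encode (prod_encode (n, s), t)))) a b)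
    = (\<exists>a\<le>s. \<forall>b. R p n a b)" for p n s
  proof -
    have "\<forall>\<^sub>F t in sequentially. (\<forall>b\<le>t. R p n a b) = (\<forall>b. R p n a b)" for a
    proof (cases "\<forall>b. R p n a b")
      case False
      then obtain b where "\<not> R p n a b" by blast
      then show ?thesis by (intro eventually_sequentiallyI[of b]) blast
    qed simp
    then have "\<forall>\<^sub>F t in sequentially. \<forall>a\<in>{..s}. (\<forall>b\<le>t. R p n a b) = (\<forall>b. R p n a b)"
      by (intro eventually_ball_finite) auto
    then show ?thesis by eventually_elim auto
  qed
  show "\<forall>\<^sub>F s in sequentially. (\<exists>a\<le>s. \<forall>b. R p n a b) = (\<exists>a. \<forall>b. R p n a b)" for p n
  proof (cases "\<exists>a. \<forall>b. R p n a b")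
    case True
    then obtain a where "\<forall>b. R p n a b" by blast
    then show ?thesis by (intro eventually_sequentiallyI[of a]) blast
  next
    case False
    then show ?thesis by (intro eventuallyI) blast
  qed
qed

text \<open>The two limits are the two approximations: \<open>K\<close> approximates the inner limit
  \<open>L\<close>, and \<open>L\<close> approximates the name of the tree.\<close>

lemma WKL_jump_jump_name:
  assumes "delta3 (\<lambda>p n. n \<in> list_encode ` T p)"
  obtains K where "computable_on UNIV K"
    "\<And>p. jump (jump WKL) (K p) = WKL (tree_name (T p))"
proof -
  obtain r l where r: "decidable_on UNIV r"
    "\<And>p n s. \<forall>\<^sub>F t in sequentially. r p (prod_encode (prod_encode (n, s), t)) = l p n s"
    "\<And>p n. \<forall>\<^sub>F s in sequentially. l p n s \<longleftrightarrow> n \<in> list_encode ` T p"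
    using delta3E[OF assms] by blast
  define K :: "baire \<Rightarrow> baire" where "K p m = of_bool (r p m)" for p m
  define L :: "baire \<Rightarrow> baire" where "L p m = of_bool (l p (pfst m) (psnd m))" for p m
  have "approximates (K p) (L p)" for p
    unfolding approximates_eventually
  proof
    fix m
    show "\<forall>\<^sub>F s in sequentially. K p (prod_encode (m, s)) = L p m"
      using r(2)[of p "pfst m" "psnd m"] by eventually_elim (simp add: K_def L_def)
  qed
  moreover have "approximates (L p) (tree_name (T p))" for p
    unfolding approximates_eventually
  proof
    fix m
    show "\<forall>\<^sub>F s in sequentially. L p (prod_encode (m, s)) = tree_name (T p) m"
      using r(3)[of p m] by eventually_elim (simp add: L_def tree_name_def chi_def)
  qed
  ultimately have "jump (jump WKL) (K p) = WKL (tree_name (T p))" for p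
    by (metis jump_approximates)
  moreover have "computable_on UNIV K" unfolding K_def by (rule r(1))
  ultimately show thesis using that by blast
qed

section \<open>The tree whose paths compute solutions of RSgr\<close>

definition fin_deg :: "nat set \<Rightarrow> (nat \<times> nat) set \<Rightarrow> nat \<Rightarrow> bool" where
  "fin_deg V E x \<longleftrightarrow> x \<in> V \<and> (\<exists>a. \<forall>b\<ge>a. (x, b) \<notin> E)"

definition fin_deg_above :: "nat set \<Rightarrow> (nat \<times> nat) set \<Rightarrow> nat \<Rightarrow> bool" where
  "fin_deg_above V E m \<longleftrightarrow> (\<exists>x\<ge>m. fin_deg V E x)"

definition fin_deg_in_cell :: "nat set \<Rightarrow> (nat \<times> nat) set \<Rightarrow> baire \<Rightarrow> nat \<Rightarrow> bool" where
  "fin_deg_in_cell V E g m \<longleftrightarrow> (\<exists>x\<ge>m. fin_deg V E x \<and> (\<forall>i<m. g (2 * i) = 1 \<longleftrightarrow> (i, x) \<in> E))"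

definition nbrs_bound :: "nat set \<Rightarrow> (nat \<times> nat) set \<Rightarrow> nat \<Rightarrow> nat \<Rightarrow> bool" where
  "nbrs_bound V E a m \<longleftrightarrow> a \<le> m \<and> (\<forall>i<a. fin_deg V E i \<longrightarrow> (\<forall>y. (i, y) \<in> E \<longrightarrow> y < m))"

text \<open>
  Bit \<open>2 * i\<close> of a path \<open>g\<close> through \<open>rs_tree V E\<close> guesses whether almost all chosen vertices are adjacent
  to \<open>i\<close>, and bit \<open>2 * x + 1\<close> tells whether \<open>x\<close> is chosen. In \<open>admissible_at\<close>, \<open>k\<close> bounds the vertices
  of finite degree chosen before \<open>x\<close>, \<open>l\<close> bounds their neighbours, and \<open>m\<close> bounds the neighbours of
  these neighbours, as far as the latter have finite degree. So the guesses below \<open>m\<close> prevent \<open>x\<close> from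
  being a second chosen neighbour of a vertex guessed to have only finitely many.
\<close>

definition admissible_at ::
    "nat set \<Rightarrow> (nat \<times> nat) set \<Rightarrow> baire \<Rightarrow> nat \<Rightarrow> nat \<Rightarrow> nat \<Rightarrow> nat \<Rightarrow> bool" where
  "admissible_at V E g x k l m \<longleftrightarrow>
     (\<forall>j<x. g (Suc (2 * j)) = 1 \<longrightarrow> fin_deg V E j \<longrightarrow> j < k) \<and>
     nbrs_bound V E k l \<and> nbrs_bound V E l m \<and>
     (fin_deg V E x \<and> (\<forall>i<m. g (2 * i) = 1 \<longleftrightarrow> (i, x) \<in> E) \<or>
      \<not> fin_deg_above V E m \<and> nbrs_bound V E m x)"

text \<open>The bounds by \<open>x\<close> keep the quantifiers bounded, so that the predicate stays
  in \<open>delta3\<close>, and ensure that only bits below \<open>Suc (2 * x)\<close>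
  matter.\<close>

definition admissible :: "nat set \<Rightarrow> (nat \<times> nat) set \<Rightarrow> baire \<Rightarrow> nat \<Rightarrow> bool" where
  "admissible V E g x \<longleftrightarrow>
     x \<in> V \<and> (\<exists>k\<le>x. \<exists>l\<le>x. \<exists>m\<le>x. admissible_at V E g x k l m)"

definition rs_ok :: "nat set \<Rightarrow> (nat \<times> nat) set \<Rightarrow> baire \<Rightarrow> nat \<Rightarrow> bool" where
  "rs_ok V E g k \<longleftrightarrow>
     (even k \<longrightarrow> fin_deg_above V E (k div 2) \<longrightarrow> fin_deg_in_cell V E g (k div 2)) \<and>
     (odd k \<longrightarrow> (g k = 1 \<longleftrightarrow> admissible V E g (k div 2)))"

definition rs_tree :: "nat set \<Rightarrow> (nat \<times> nat) set \<Rightarrow> nat list set" where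
  "rs_tree V E = {\<sigma>. \<forall>k<length \<sigma>. \<sigma> ! k < 2 \<and> rs_ok V E ((!) \<sigma>) k}"

lemma admissible_cong:
  assumes "\<And>i. i < Suc (2 * x) \<Longrightarrow> g i = h i"
  shows "admissible V E g x \<longleftrightarrow> admissible V E h x"
proof -
  have 1: "(\<forall>j<x. g (Suc (2 * j)) = 1 \<longrightarrow> fin_deg V E j \<longrightarrow> j < k) \<longleftrightarrow>
      (\<forall>j<x. h (Suc (2 * j)) = 1 \<longrightarrow> fin_deg V E j \<longrightarrow> j < k)" for k
    using assms by simp
  have 2: "(\<forall>i<m. g (2 * i) = 1 \<longleftrightarrow> (i, x) \<in> E) \<longleftrightarrow> (\<forall>i<m. h (2 * i) = 1 \<longleftrightarrow> (i, x) \<in> E)"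
    if "m \<le> x" for m using assms that by auto
  show ?thesis unfolding admissible_def admissible_at_def by (simp only: 1 2 cong: conj_cong)
qed

text \<open>The condition at position \<open>k\<close> inspects no bit beyond \<open>k\<close>,
  which makes \<open>rs_tree\<close> closed under initial segments.\<close>

lemma rs_ok_cong:
  assumes "\<And>i. i \<le> k \<Longrightarrow> g i = h i"
  shows "rs_ok V E g k \<longleftrightarrow> rs_ok V E h k"
proof (cases "even k")
  case True
  then have "fin_deg_in_cell V E g (k div 2) \<longleftrightarrow> fin_deg_in_cell V E h (k div 2)"
    unfolding fin_deg_in_cell_def using assms by auto
  with True show ?thesis by (simp add: rs_ok_def)
next
  case False
  then have "admissible V E g (k div 2) \<longleftrightarrow> admissible V E h (k div 2)"
    by (intro admissible_cong assms) (auto elim!: oddE)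
  with False show ?thesis using assms[of k] by (simp add: rs_ok_def)
qed

lemma binary_tree_rs_tree: "binary_tree (rs_tree V E)"
  unfolding binary_tree_def
proof (intro conjI ballI allI)
  show "rs_tree V E \<subseteq> lists {0, 1}"
    by (force simp: rs_tree_def in_set_conv_nth)
  fix \<sigma> n assume \<sigma>: "\<sigma> \<in> rs_tree V E"
  have "rs_ok V E ((!) (take n \<sigma>)) k" if "k < length (take n \<sigma>)" for k
    using \<sigma> that rs_ok_cong[of k "(!) (take n \<sigma>)" "(!) \<sigma>"] by (simp add: rs_tree_def)
  with \<sigma> show "take n \<sigma> \<in> rs_tree V E" by (simp add: rs_tree_def)
qed

lemma rs_tree_path:
  "g \<in> cantor \<and> (\<forall>n. restr g n \<in> rs_tree V E) \<longleftrightarrow> g \<in> cantor \<and> (\<forall>k. rs_ok V E g k)"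
proof -
  have *: "rs_ok V E ((!) (restr g n)) k \<longleftrightarrow> rs_ok V E g k" if "k < n" for n k
    by (rule rs_ok_cong) (use that in simp)
  have "g k < 2" if "g \<in> cantor" for k
  proof -
    have "g k \<in> {0, 1}" using that by (auto simp: cantor_def)
    then show ?thesis by auto
  qed
  then have "restr g n \<in> rs_tree V E \<longleftrightarrow> (\<forall>k<n. rs_ok V E g k)" if "g \<in> cantor" for n
    using that by (simp add: rs_tree_def *)
  then show ?thesis by (metis lessI)
qed

text \<open>For each length \<open>N\<close> one vertex \<open>x\<close> serves as witness for all
  relevant \<open>m\<close> at once; the even bits copy its adjacencies, and the odd bits are
  forced.\<close>

lemma infinite_rs_tree: "infinite (rs_tree V E)"
proof -
  have "\<exists>\<sigma>\<in>rs_tree V E. length \<sigma> = N" for N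
  proof -
    \<comment> \<open>Either some vertex of finite degree lies at or beyond \<open>N\<close>, or
      there are only finitely many and the largest serves; if there are none, \<open>x\<close> is
      arbitrary.\<close>
    obtain x where x: "\<And>m. m \<le> N \<Longrightarrow> fin_deg_above V E m \<Longrightarrow> fin_deg V E x \<and> m \<le> x"
    proof (cases "fin_deg_above V E N")
      case True
      then show thesis using that unfolding fin_deg_above_def by (meson le_trans)
    next
      case False
      let ?F = "{x. fin_deg V E x}"
      have "x \<le> N" if "fin_deg V E x" for x
        using False that unfolding fin_deg_above_def by (meson nat_le_linear)
      then have "finite ?F" by (intro finite_subset[of ?F "{..N}"]) auto
      then have "fin_deg V E (Max ?F) \<and> m \<le> Max ?F" if "fin_deg_above V E m" for m
        using that Max_in[of ?F] Max_ge[of ?F] unfolding fin_deg_above_def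
        by (metis empty_iff le_trans mem_Collect_eq)
      then show thesis using that by blast
    qed
    define r :: "nat list \<Rightarrow> nat" where "r \<sigma> = of_bool (if even (length \<sigma>) then (length \<sigma> div 2, x) \<in> E
       else admissible V E ((!) \<sigma>) (length \<sigma> div 2))" for \<sigma>
    obtain g where g: "\<And>n. g n = r (restr g n)" using ex_recursive_path[of r] by blast
    have even: "g (2 * i) = 1 \<longleftrightarrow> (i, x) \<in> E" for i
      by (subst g) (simp add: r_def)
    have "admissible V E ((!) (restr g (Suc (2 * i)))) i = admissible V E g i" for i
      by (rule admissible_cong) simp
    then have odd: "g (Suc (2 * i)) = 1 \<longleftrightarrow> admissible V E g i" for i
      by (subst g) (simp add: r_def)
    have "rs_ok V E g k" if "k < N" for k
    proof -
      have "fin_deg_in_cell V E g (k div 2)" if "fin_deg_above V E (k div 2)"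
        using x[OF _ that] \<open>k < N\<close> unfolding fin_deg_in_cell_def
        by (intro exI[of _ x]) (simp add: even[simplified])
      moreover have "g k = 1 \<longleftrightarrow> admissible V E g (k div 2)" if "odd k"
        using odd[of "k div 2"] that by simp
      ultimately show ?thesis by (simp add: rs_ok_def)
    qed
    moreover have "rs_ok V E ((!) (restr g N)) k \<longleftrightarrow> rs_ok V E g k" if "k < N" for k
      by (rule rs_ok_cong) (use that in simp)
    moreover have "g k < 2" for k by (subst g) (simp add: r_def)
    ultimately have "restr g N \<in> rs_tree V E" by (simp add: rs_tree_def)
    then show ?thesis by (intro bexI[of _ "restr g N"]) auto
  qed
  then have "N \<in> length ` rs_tree V E" for N by (metis image_eqI)
  then have "UNIV \<subseteq> length ` rs_tree V E" by blast
  then show ?thesis using finite_surj infinite_UNIV_nat by blast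
qed

text \<open>The bounds \<open>k\<close>, \<open>l\<close>, \<open>m\<close> control the neighbours
  of vertices of finite degree. For \<open>v\<close> of infinite degree the bit
  \<open>g (2 * v)\<close> decides between infinitely many and at most one neighbour, unless only
  finitely many vertices have finite degree; then \<open>H\<close> contains almost all of
  \<open>V\<close>.\<close>

lemma rs_solution:
  assumes gr: "graph V E" and V: "infinite V" and ok: "\<And>k. rs_ok V E g k"
  defines "H \<equiv> {x. g (Suc (2 * x)) = 1}"
  shows "H \<subseteq> V" "infinite H"
    "\<forall>v\<in>V. infinite (H \<inter> nbrs E v) \<or> (finite (H \<inter> nbrs E v) \<and> card (H \<inter> nbrs E v) \<le> 1)"
    "\<forall>v\<in>H. infinite (H \<inter> nbrs E v) \<or> H \<inter> nbrs E v = {}"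
proof -
  let ?F = "fin_deg V E"
  have sym: "(a, b) \<in> E \<longleftrightarrow> (b, a) \<in> E" for a b using gr by (auto simp: graph_def sym_def)
  have irr: "(a, a) \<notin> E" for a using gr by (auto simp: graph_def irrefl_def)
  have inV: "b \<in> V" if "(a, b) \<in> E" for a b using gr that by (auto simp: graph_def)
  have H: "x \<in> H \<longleftrightarrow> admissible V E g x" for x
    using ok[of "Suc (2 * x)"] by (simp add: rs_ok_def H_def)
  have C: "fin_deg_in_cell V E g m" if "fin_deg_above V E m" for m
    using ok[of "2 * m"] that by (simp add: rs_ok_def)
  show "H \<subseteq> V" by (auto simp: H admissible_def)
  have fin: "finite {y. (x, y) \<in> E}" if F: "?F x" for x
  proof -
    obtain a where "\<forall>b\<ge>a. (x, b) \<notin> E" using F unfolding fin_deg_def by blast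
    then have "y < a" if "(x, y) \<in> E" for y using that by (meson not_le)
    then have "{y. (x, y) \<in> E} \<subseteq> {..<a}" by blast
    then show ?thesis using finite_subset by blast
  qed
  have inf: "infinite {y. (x, y) \<in> E}" if "x \<in> V" "\<not> ?F x" for x
  proof
    assume "finite {y. (x, y) \<in> E}"
    then obtain a where "\<forall>y\<in>{y. (x, y) \<in> E}. y < a"
      using finite_nat_set_iff_bounded by blast
    then have "\<forall>b\<ge>a. (x, b) \<notin> E" by (meson mem_Collect_eq not_le)
    with that show False unfolding fin_deg_def by blast
  qed
  have bound: "\<exists>m. nbrs_bound V E a m" for a
  proof -
    have "finite (\<Union>i\<in>{i. i < a \<and> ?F i}. {y. (i, y) \<in> E})"
      using fin by auto
    then obtain m where "\<forall>y\<in>(\<Union>i\<in>{i. i < a \<and> ?F i}. {y. (i, y) \<in> E}). y < m"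
      using finite_nat_set_iff_bounded by blast
    then show ?thesis unfolding nbrs_bound_def
      by (intro exI[of _ "max a m"]) (auto simp: less_max_iff_disj)
  qed
  have mono: "nbrs_bound V E a m'" if "nbrs_bound V E a m" "m \<le> m'" for a m m'
    using that unfolding nbrs_bound_def by (meson le_trans less_le_trans)
  \<comment> \<open>The chain \<open>k \<le> l \<le> m \<le> x\<close> is made explicit, since the
    contradictions below rest on it.\<close>
  have adm: "\<exists>k l m. k \<le> l \<and> l \<le> m \<and> m \<le> x \<and> (\<forall>j\<in>H. j < x \<longrightarrow> ?F j \<longrightarrow> j < k) \<and>
     nbrs_bound V E k l \<and> nbrs_bound V E l m \<and>
     (?F x \<and> (\<forall>i<m. g (2 * i) = 1 \<longleftrightarrow> (i, x) \<in> E) \<or>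
      \<not> fin_deg_above V E m \<and> nbrs_bound V E m x)" if xH: "x \<in> H" for x
  proof -
    obtain k l m where "m \<le> x" "admissible_at V E g x k l m"
      using xH unfolding H admissible_def by blast
    then have klm: "m \<le> x" "\<forall>j<x. g (Suc (2 * j)) = 1 \<longrightarrow> ?F j \<longrightarrow> j < k"
      "nbrs_bound V E k l" "nbrs_bound V E l m"
      "?F x \<and> (\<forall>i<m. g (2 * i) = 1 \<longleftrightarrow> (i, x) \<in> E) \<or> \<not> fin_deg_above V E m \<and> nbrs_bound V E m x"
      by (auto simp: admissible_at_def)
    have "\<forall>j\<in>H. j < x \<longrightarrow> ?F j \<longrightarrow> j < k" using klm(2) by (simp add: H_def)
    moreover have "k \<le> l" "l \<le> m" using klm(3,4) by (simp_all add: nbrs_bound_def)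
    ultimately show ?thesis using klm(1,3-5) by (intro exI conjI)
  qed
  \<comment> \<open>\<open>h\<close> is below \<open>k\<close>, so its neighbour \<open>v\<close> is
    below \<open>l\<close>, so the neighbour \<open>x\<close> of \<open>v\<close> is below
    \<open>m\<close>, although \<open>m \<le> x\<close>.\<close>
  have small: "\<not> ((h, v) \<in> E \<and> (x, v) \<in> E)" if "h \<in> H" "x \<in> H" "?F h" "h < x" "?F v" for h x v
  proof
    assume E: "(h, v) \<in> E \<and> (x, v) \<in> E"
    obtain k l m where klm: "m \<le> x" "\<forall>j\<in>H. j < x \<longrightarrow> ?F j \<longrightarrow> j < k"
      "nbrs_bound V E k l" "nbrs_bound V E l m" using adm[OF \<open>x \<in> H\<close>] by metis
    then have "h < k" using that by blast
    then have "v < l" using klm that E unfolding nbrs_bound_def by blast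
    then have "x < m" using klm that E sym unfolding nbrs_bound_def by blast
    with klm show False by simp
  qed
  \<comment> \<open>A chosen vertex of infinite degree entered by the second alternative: the
    vertices of finite degree lie below \<open>m\<close>, and their neighbours below
    \<open>x\<close>.\<close>
  have large: "(x, v) \<notin> E" if x: "x \<in> H" "\<not> ?F x" and "?F v" for x v
  proof
    assume "(x, v) \<in> E"
    obtain m where m: "\<not> fin_deg_above V E m" "nbrs_bound V E m x"
      using adm[OF x(1)] x(2) by metis
    then have "v < m" using that by (metis fin_deg_above_def not_le)
    then show False using m that \<open>(x, v) \<in> E\<close> sym unfolding nbrs_bound_def by blast
  qed
  have le1: "finite A \<and> card A \<le> 1" if "\<And>a b. a \<in> A \<Longrightarrow> b \<in> A \<Longrightarrow> a < b \<Longrightarrow> False" for A :: "nat set"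
  proof -
    have "A = {} \<or> (\<exists>a. A = {a})" using that by (metis ex_in_conv insertI1 nat_neq_iff singletonD subsetI subset_antisym insert_subset)
    then show ?thesis by auto
  qed
  have Fdeg: "finite (H \<inter> nbrs E v) \<and> card (H \<inter> nbrs E v) \<le> 1" if "?F v" for v
  proof (rule le1)
    fix a b assume "a \<in> H \<inter> nbrs E v" "b \<in> H \<inter> nbrs E v" "a < b"
    then show False using large[of a v] small[of a b v] that sym by (auto simp: nbrs_def)
  qed
  have indep: "H \<inter> nbrs E v = {}" if "v \<in> H" "?F v" for v
  proof (rule ccontr)
    assume "H \<inter> nbrs E v \<noteq> {}"
    then obtain u where u: "u \<in> H" "(v, u) \<in> E" by (auto simp: nbrs_def)
    have "?F u" using large[of u v] u that sym by blast
    \<comment> \<open>\<open>a\<close> is below \<open>k\<close>, so its neighbour \<open>b\<close>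
      would be below \<open>l\<close>, although \<open>l \<le> b\<close>.\<close>
    have *: False if "a \<in> H" "b \<in> H" "?F a" "?F b" "a < b" "(a, b) \<in> E" for a b
    proof -
      obtain k l m where klm: "l \<le> b" "\<forall>j\<in>H. j < b \<longrightarrow> ?F j \<longrightarrow> j < k" "nbrs_bound V E k l"
        using adm[OF \<open>b \<in> H\<close>] by (metis le_trans)
      then have "b < l" using that unfolding nbrs_bound_def by blast
      with klm show False by simp
    qed
    have "u \<noteq> v" using u irr by metis
    then show False using *[of u v] *[of v u] u that \<open>?F u\<close> sym by (metis nat_neq_iff)
  qed
  have main: "infinite H \<and> (\<forall>v\<in>V. \<not> ?F v \<longrightarrow> infinite (H \<inter> nbrs E v) \<or>
      (finite (H \<inter> nbrs E v) \<and> card (H \<inter> nbrs E v) \<le> 1)) \<and>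
      (\<forall>v\<in>H. \<not> ?F v \<longrightarrow> infinite (H \<inter> nbrs E v))"
  proof (cases "\<forall>m. fin_deg_above V E m")
    case True
    have HF: "?F x" if "x \<in> H" for x using adm[OF that] True by metis
    \<comment> \<open>If \<open>H\<close> were finite, the path condition at a sufficiently large
      \<open>m\<close> would provide one more admissible vertex.\<close>
    have inf_H: "infinite H"
    proof
      assume "finite H"
      then obtain k where k: "\<forall>j\<in>H. j < k" using finite_nat_set_iff_bounded by blast
      obtain l m where lm: "nbrs_bound V E k l" "nbrs_bound V E l m" using bound by blast
      then have le: "k \<le> l" "l \<le> m" by (auto simp: nbrs_bound_def)
      obtain x where x: "x \<ge> m" "?F x" "\<forall>i<m. g (2 * i) = 1 \<longleftrightarrow> (i, x) \<in> E"
        using C[of m] True unfolding fin_deg_in_cell_def by blast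
      have "x \<in> V" using x(2) by (simp add: fin_deg_def)
      moreover have "\<forall>j<x. g (Suc (2 * j)) = 1 \<longrightarrow> ?F j \<longrightarrow> j < k" using k by (simp add: H_def)
      ultimately have "admissible_at V E g x k l m" using lm x by (simp add: admissible_at_def)
      moreover have "k \<le> x" "l \<le> x" using le x(1) by simp_all
      ultimately have "admissible V E g x"
        unfolding admissible_def using x(1) \<open>x \<in> V\<close> by blast
      then have "x \<in> H" by (simp add: H)
      with k le x show False by (meson le_trans not_le)
    qed
    have "infinite (H \<inter> nbrs E v) \<or> (finite (H \<inter> nbrs E v) \<and> card (H \<inter> nbrs E v) \<le> 1)"
      if v: "v \<in> V" "\<not> ?F v" for v
    proof (cases "g (2 * v) = 1")
      case True
      obtain h where h: "h \<in> H" "h > v"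
        using inf_H unfolding finite_nat_set_iff_bounded_le by (meson not_le)
      \<comment> \<open>Here \<open>v < h < k \<le> m\<close>, so the cell condition on
        \<open>x\<close> covers \<open>v\<close>.\<close>
      have "x \<in> nbrs E v" if x: "x \<in> H" "x > h" for x
      proof -
        obtain k l m where klm: "k \<le> l" "l \<le> m" "\<forall>j\<in>H. j < x \<longrightarrow> ?F j \<longrightarrow> j < k"
          "\<forall>i<m. g (2 * i) = 1 \<longleftrightarrow> (i, x) \<in> E"
          using adm[OF x(1)] \<open>\<forall>m. fin_deg_above V E m\<close> by metis
        then have "h < k" using h x HF by blast
        then have "v < m" using klm h by simp
        then show ?thesis using klm True by (simp add: nbrs_def)
      qed
      then have "H - {..h} \<subseteq> H \<inter> nbrs E v" by (metis Diff_iff IntI atMost_iff not_le subsetI)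
      moreover have "infinite (H - {..h})" using inf_H by simp
      ultimately have "infinite (H \<inter> nbrs E v)" using finite_subset by blast
      then show ?thesis ..
    next
      case False
      \<comment> \<open>An earlier chosen neighbour \<open>a\<close> is below \<open>k\<close>,
        hence \<open>v\<close> is below \<open>l\<close>, and the cell condition on \<open>b\<close>
        forbids its edge to \<open>v\<close>.\<close>
      have "finite (H \<inter> nbrs E v) \<and> card (H \<inter> nbrs E v) \<le> 1"
      proof (rule le1)
        fix a b assume ab: "a \<in> H \<inter> nbrs E v" "b \<in> H \<inter> nbrs E v" "a < b"
        obtain k l m where klm: "l \<le> m" "\<forall>j\<in>H. j < b \<longrightarrow> ?F j \<longrightarrow> j < k" "nbrs_bound V E k l"
          "\<forall>i<m. g (2 * i) = 1 \<longleftrightarrow> (i, b) \<in> E"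
          using adm[of b] ab \<open>\<forall>m. fin_deg_above V E m\<close> by (metis IntD1)
        then have "a < k" using ab HF by blast
        then have "v < l" using klm ab HF sym unfolding nbrs_bound_def by (auto simp: nbrs_def)
        then show False using klm ab False by (auto simp: nbrs_def)
      qed
      then show ?thesis ..
    qed
    with inf_H HF show ?thesis by blast
  next
    case False
    then obtain a where a: "\<not> fin_deg_above V E a" by blast
    obtain k l m where klm: "nbrs_bound V E a k" "nbrs_bound V E k l" "nbrs_bound V E l m" using bound by blast
    obtain n where n: "nbrs_bound V E m n" using bound by blast
    have le: "a \<le> k" "k \<le> l" "l \<le> m" "m \<le> n" using klm n by (auto simp: nbrs_bound_def)
    \<comment> \<open>Beyond \<open>n\<close> the second alternative always applies, as all vertices
      of finite degree lie below \<open>a\<close>.\<close>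
    have "x \<in> H" if "x \<in> V" "x \<ge> n" for x
    proof -
      have "\<forall>j<x. g (Suc (2 * j)) = 1 \<longrightarrow> ?F j \<longrightarrow> j < k"
        using a le unfolding fin_deg_above_def by (meson le_trans not_le)
      moreover have "\<not> fin_deg_above V E m" using a le unfolding fin_deg_above_def by (meson le_trans)
      ultimately have "admissible_at V E g x k l m"
        using klm mono[OF n that(2)] by (simp add: admissible_at_def)
      moreover have "k \<le> x" "l \<le> x" "m \<le> x" using le that by simp_all
      ultimately show ?thesis unfolding H admissible_def using that(1) by blast
    qed
    then have *: "X - {..<n} \<subseteq> H" if "X \<subseteq> V" for X
      using that by (metis Diff_iff lessThan_iff not_le subset_eq)
    have **: "infinite (H \<inter> X)" if "X \<subseteq> V" "infinite X" for X
    proof -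
      have "X - {..<n} \<subseteq> H \<inter> X" using *[OF that(1)] by blast
      moreover have "infinite (X - {..<n})" using that by simp
      ultimately show ?thesis using finite_subset by blast
    qed
    have "infinite (H \<inter> nbrs E v)" if "v \<in> V" "\<not> ?F v" for v
      using that by (intro **) (use inV inf[OF that] in \<open>auto simp: nbrs_def\<close>)
    with **[of V] V \<open>H \<subseteq> V\<close> show ?thesis by auto
  qed
  then show "infinite H" by blast
  show "\<forall>v\<in>V. infinite (H \<inter> nbrs E v) \<or> (finite (H \<inter> nbrs E v) \<and> card (H \<inter> nbrs E v) \<le> 1)"
    using main Fdeg by blast
  show "\<forall>v\<in>H. infinite (H \<inter> nbrs E v) \<or> H \<inter> nbrs E v = {}"
    using main indep by blast
qed

section \<open>The tree is a double limit, uniformly in the name of the graph\<close>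

lemma delta3_subst:
  assumes "delta3 R" "computable_on UNIV X"
  shows "delta3 (\<lambda>p n. R p (X p n))"
proof -
  obtain r l where r: "decidable_on UNIV r"
    "\<And>p n s. \<forall>\<^sub>F t in sequentially. r p (prod_encode (prod_encode (n, s), t)) = l p n s"
    "\<And>p n. \<forall>\<^sub>F s in sequentially. l p n s = R p n"
    using delta3E[OF assms(1)] by blast
  show ?thesis
  proof (rule delta3I)
    show "decidable_on UNIV (\<lambda>p m. r p (prod_encode (prod_encode (X p (pfst (pfst m)), psnd (pfst m)), psnd m)))"
      by (intro comp_intros computable_on_compose[OF r(1)] computable_on_compose[OF assms(2)])
    show "\<forall>\<^sub>F t in sequentially. r p (prod_encode (prod_encode (X p (pfst (pfst (prod_encode (prod_encode (n, s), t)))),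
        psnd (pfst (prod_encode (prod_encode (n, s), t)))), psnd (prod_encode (prod_encode (n, s), t)))) = l p (X p n) s" for p n s
      using r(2)[of p "X p n" s] by simp
    show "\<forall>\<^sub>F s in sequentially. l p (X p n) s = R p (X p n)" for p n
      by (rule r(3))
  qed
qed

lemma delta3_subst2:
  assumes "delta3 (\<lambda>p m. R p (pfst m) (psnd m))" "computable_on UNIV X" "computable_on UNIV Y"
  shows "delta3 (\<lambda>p n. R p (X p n) (Y p n))"
  using delta3_subst[OF assms(1) computable_on_pair[OF assms(2,3)]] by simp

text \<open>Read off from an arbitrary oracle, so that the tree is defined even for oracles that
  name no graph.\<close>

definition name_vertices :: "baire \<Rightarrow> nat set" where
  "name_vertices p = {x. p (2 * x) = 1}"

definition name_edges :: "baire \<Rightarrow> (nat \<times> nat) set" where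
  "name_edges p = {(x, y). p (Suc (2 * prod_encode (x, y))) = 1}"

lemma name_graph_name [simp]:
  "name_vertices (graph_name V E) = V" "name_edges (graph_name V E) = E"
  by (auto simp: name_vertices_def name_edges_def graph_name_def chi_def inj_image_mem_iff[OF inj_prod_encode])

lemma decidable_on_name [comp_intros]:
  assumes "computable_on S F"
  shows "decidable_on S (\<lambda>p n. F p n \<in> name_vertices p)"
  and "computable_on S G \<Longrightarrow> decidable_on S (\<lambda>p n. (F p n, G p n) \<in> name_edges p)"
  unfolding name_vertices_def name_edges_def mem_Collect_eq prod.case
  by (intro comp_intros assms; assumption)+

text \<open>Merges two existential quantifiers into one, as \<open>delta3_sigma2\<close> accepts
  only one.\<close>

lemma ex_prod_encode: "(\<exists>z. P (pfst z) (psnd z)) \<longleftrightarrow> (\<exists>x y. P x y)"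
  by (metis fst_conv snd_conv prod_encode_inverse)

lemma delta3_fin_deg [delta3_intros]:
  assumes "computable_on UNIV X"
  shows "delta3 (\<lambda>p n. fin_deg (name_vertices p) (name_edges p) (X p n))"
proof (rule delta3_subst[OF _ assms])
  have *: "fin_deg V E x \<longleftrightarrow> (\<exists>a. \<forall>b. x \<in> V \<and> (a \<le> b \<longrightarrow> (x, b) \<notin> E))" for V E x
    by (auto simp: fin_deg_def)
  show "delta3 (\<lambda>p n. fin_deg (name_vertices p) (name_edges p) n)"
    unfolding * by (intro delta3_sigma2 comp_intros)
qed

lemma delta3_fin_deg_above [delta3_intros]:
  assumes "computable_on UNIV X"
  shows "delta3 (\<lambda>p n. fin_deg_above (name_vertices p) (name_edges p) (X p n))"
proof (rule delta3_subst[OF _ assms])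
  have *: "fin_deg_above V E m \<longleftrightarrow>
    (\<exists>z. \<forall>b. m \<le> pfst z \<and> pfst z \<in> V \<and> (psnd z \<le> b \<longrightarrow> (pfst z, b) \<notin> E))" for V E m
    unfolding ex_prod_encode[of "\<lambda>x a. \<forall>b. m \<le> x \<and> x \<in> V \<and> (a \<le> b \<longrightarrow> (x, b) \<notin> E)"]
    by (auto simp: fin_deg_above_def fin_deg_def)
  show "delta3 (\<lambda>p n. fin_deg_above (name_vertices p) (name_edges p) n)"
    unfolding * by (intro delta3_sigma2 comp_intros)
qed

lemma delta3_fin_deg_in_cell [delta3_intros]:
  assumes "computable_on UNIV X" "computable_on UNIV Y"
  shows "delta3 (\<lambda>p n. fin_deg_in_cell (name_vertices p) (name_edges p) (code_nth (X p n)) (Y p n))"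
proof (rule delta3_subst2[OF _ assms])
  have *: "fin_deg_in_cell V E g m \<longleftrightarrow>
    (\<exists>z. \<forall>b. m \<le> pfst z \<and> pfst z \<in> V \<and> (psnd z \<le> b \<longrightarrow> (pfst z, b) \<notin> E) \<and>
      (\<forall>i<m. g (2 * i) = 1 \<longleftrightarrow> (i, pfst z) \<in> E))" for V E g m
    unfolding ex_prod_encode[of "\<lambda>x a. \<forall>b. m \<le> x \<and> x \<in> V \<and> (a \<le> b \<longrightarrow> (x, b) \<notin> E) \<and>
      (\<forall>i<m. g (2 * i) = 1 \<longleftrightarrow> (i, x) \<in> E)"]
    by (auto simp: fin_deg_in_cell_def fin_deg_def)
  show "delta3 (\<lambda>p m. fin_deg_in_cell (name_vertices p) (name_edges p) (code_nth (pfst m)) (psnd m))"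
    unfolding * by (intro delta3_sigma2 comp_intros)
qed

lemma delta3_nbrs_bound [delta3_intros]:
  assumes "computable_on UNIV X" "computable_on UNIV Y"
  shows "delta3 (\<lambda>p n. nbrs_bound (name_vertices p) (name_edges p) (X p n) (Y p n))"
proof (rule delta3_subst2[OF _ assms])
  \<comment> \<open>The vacuous quantifier over \<open>b\<close> brings an existential statement
    into the form of \<open>delta3_sigma2\<close>.\<close>
  have *: "(\<forall>y. (i, y) \<in> E \<longrightarrow> y < m) \<longleftrightarrow> \<not> (\<exists>y. \<forall>b::nat. (i, y) \<in> E \<and> \<not> y < m)"
    for i m :: nat and E by blast
  show "delta3 (\<lambda>p m. nbrs_bound (name_vertices p) (name_edges p) (pfst m) (psnd m))"
    unfolding nbrs_bound_def * by (intro delta3_intros delta3_decidable delta3_sigma2 comp_intros)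
qed

lemma delta3_admissible [delta3_intros]:
  assumes "computable_on UNIV X" "computable_on UNIV Y"
  shows "delta3 (\<lambda>p n. admissible (name_vertices p) (name_edges p) (code_nth (X p n)) (Y p n))"
proof (rule delta3_subst2[OF _ assms])
  show "delta3 (\<lambda>p m. admissible (name_vertices p) (name_edges p) (code_nth (pfst m)) (psnd m))"
    unfolding admissible_def admissible_at_def
    by (intro delta3_intros comp_intros delta3_decidable)
qed

lemma delta3_rs_tree:
  "delta3 (\<lambda>p n. n \<in> list_encode ` rs_tree (name_vertices p) (name_edges p))"
proof -
  have "n \<in> list_encode ` rs_tree V E \<longleftrightarrow>
    (\<forall>k<code_length n. code_nth n k < 2 \<and> rs_ok V E (code_nth n) k)" for n V E
  proof -
    obtain \<sigma> where n: "n = list_encode \<sigma>" by (metis list_decode_inverse)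
    \<comment> \<open>List access and \<open>code_nth\<close> are compared only below the length,
      which suffices since the condition at \<open>k\<close> looks no further.\<close>
    have "rs_ok V E ((!) \<sigma>) k \<longleftrightarrow> rs_ok V E (code_nth n) k" if "k < length \<sigma>" for k
      by (rule rs_ok_cong) (use that n in simp)
    then show ?thesis by (auto simp: n inj_image_mem_iff[OF inj_list_encode] rs_tree_def)
  qed
  then show ?thesis
    unfolding rs_ok_def by (simp only:) (intro delta3_intros comp_intros delta3_decidable)
qed

section \<open>The reductions of RSg to RSgr and of RSgr to the double jump of WKL\<close>

lemma graph_name_inject [simp]: "graph_name V E = graph_name V' E' \<longleftrightarrow> V = V' \<and> E = E'"
  by (metis name_graph_name)

lemma RSgr_graph_name:
  "RSgr (graph_name V E) = {h. graph V E \<and> infinite V \<and> (\<exists>H. h = chi H \<and> H \<subseteq> V \<and> infinite H \<and>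
     (\<forall>v\<in>V. infinite (H \<inter> nbrs E v) \<or> (finite (H \<inter> nbrs E v) \<and> card (H \<inter> nbrs E v) \<le> 1)) \<and>
     (\<forall>v\<in>H. infinite (H \<inter> nbrs E v) \<or> H \<inter> nbrs E v = {}))}"
  unfolding RSgr_def by auto

lemma RSgr_nonempty:
  assumes "graph V E" "infinite V"
  shows "graph_name V E \<in> pdom RSgr"
proof -
  obtain g where "g \<in> cantor" "\<forall>n. restr g n \<in> rs_tree V E"
    using weak_koenig[OF binary_tree_rs_tree infinite_rs_tree] by blast
  then have "\<forall>k. rs_ok V E g k" using rs_tree_path by blast
  then have "chi {x. g (Suc (2 * x)) = 1} \<in> RSgr (graph_name V E)"
    using assms rs_solution[OF assms, of g] unfolding RSgr_graph_name by blast
  then show ?thesis unfolding pdom_def by blast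
qed

lemma RSgr_le_WKL_jump_jump: "RSgr \<le>\<^sub>W jump (jump WKL)"
proof -
  obtain K where K: "computable_on UNIV K"
    "\<And>p. jump (jump WKL) (K p) = WKL (tree_name (rs_tree (name_vertices p) (name_edges p)))"
    using WKL_jump_jump_name[OF delta3_rs_tree] by blast
  show ?thesis
  proof (rule weihrauch_leI)
    show "computable_on (pdom RSgr) K" by (rule computable_on_subset[OF K(1)]) simp
    show "K p \<in> pdom (jump (jump WKL))" for p
      using tree_name_in_pdom_WKL[OF binary_tree_rs_tree infinite_rs_tree] by (simp add: pdom_def K)
    \<comment> \<open>The path is the odd half of the oracle, and its own odd bits are the chosen
      vertices.\<close>
    show "computable_on {join p r |p r. p \<in> pdom RSgr \<and> r \<in> jump (jump WKL) (K p)}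
        (\<lambda>x n. x (Suc (2 * Suc (2 * n))))" by (intro comp_intros)
    fix p r assume "p \<in> pdom RSgr" "r \<in> jump (jump WKL) (K p)"
    then obtain V E where VE: "p = graph_name V E" "graph V E" "infinite V"
      and r: "r \<in> WKL (tree_name (rs_tree V E))"
      by (auto simp: pdom_def RSgr_def K)
    from r have g: "r \<in> cantor" "\<forall>k. rs_ok V E r k"
      using rs_tree_path[of r V E]
      by (auto simp: WKL_tree_name[OF binary_tree_rs_tree infinite_rs_tree])
    have "r k \<in> {0, 1}" for k using g(1) by (auto simp: cantor_def)
    then have "(\<lambda>n. join p r (Suc (2 * Suc (2 * n)))) = chi {x. r (Suc (2 * x)) = 1}"
      by (force simp: chi_def fun_eq_iff simp del: mult_Suc_right)
    then show "(\<lambda>n. join p r (Suc (2 * Suc (2 * n)))) \<in> RSgr p"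
      using VE g rs_solution[of V E r] by (simp add: RSgr_graph_name)
  qed
qed

lemma weihrauch_le_refine:
  assumes "\<And>p. p \<in> pdom F \<Longrightarrow> p \<in> pdom G \<and> G p \<subseteq> F p"
  shows "F \<le>\<^sub>W G"
proof (rule weihrauch_leI)
  show "computable_on (pdom F) (\<lambda>p n. p n)" by (intro comp_intros)
  show "computable_on {join p r |p r. p \<in> pdom F \<and> r \<in> G p} (\<lambda>x n. x (Suc (2 * n)))" by (intro comp_intros)
qed (use assms in auto)

lemma RSgr_subset_RSg: "RSgr p \<subseteq> RSg p"
  by (fastforce simp: RSgr_def RSg_def)

lemma RSg_le_RSgr: "RSg \<le>\<^sub>W RSgr"
proof (rule weihrauch_le_refine)
  fix p assume "p \<in> pdom RSg"
  then obtain V E where VE: "p = graph_name V E" "graph V E" "infinite V"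
    by (auto simp: pdom_def RSg_def)
  with RSgr_nonempty RSgr_subset_RSg show "p \<in> pdom RSgr \<and> RSgr p \<subseteq> RSg p" by blast
qed

section \<open>The graph of a sequence of sets\<close>

definition name_seq :: "baire \<Rightarrow> nat \<Rightarrow> nat set" where
  "name_seq p i = {x. p (Suc (2 * prod_encode (i, x))) = 1}"

lemma name_seq_join [simp]: "name_seq (join f (seq_name A)) = A"
  by (auto simp: name_seq_def seq_name_def chi_def fun_eq_iff)

lemma join_inject [simp]: "join f g = join f' g' \<longleftrightarrow> f = f' \<and> g = g'"
  by (metis ext join_even join_odd)

lemma seq_name_inject [simp]: "seq_name A = seq_name B \<longleftrightarrow> A = B"
  by (metis name_seq_join)

lemma decidable_on_name_seq [comp_intros]:
  assumes "computable_on S F" "computable_on S G"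
  shows "decidable_on S (\<lambda>p n. F p n \<in> name_seq p (G p n))"
  unfolding name_seq_def mem_Collect_eq by (intro comp_intros assms)

text \<open>
  In the coded graph \<open>3 * x\<close> is the vertex of the number \<open>x\<close>, \<open>3 * i + 1\<close> is the vertex of the set \<open>A i\<close>
  and \<open>3 * prod_encode (i, j) + 2\<close> is the vertex of the pair of \<open>i\<close> and \<open>j\<close>.
\<close>

definition link :: "baire \<Rightarrow> (nat \<Rightarrow> nat set) \<Rightarrow> nat \<Rightarrow> nat \<Rightarrow> bool" where
  "link f A u v \<longleftrightarrow>
     u mod 3 = 0 \<and>
       (v mod 3 = 0 \<and> u < v \<and> f (prod_encode (u div 3, v div 3)) \<noteq> 1 \<or>
        v mod 3 = 1 \<and> u div 3 \<in> A (v div 3) \<or>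
        v mod 3 = 2 \<and> v div 3 < u div 3) \<or>
     u mod 3 = 2 \<and> v mod 3 = 1 \<and> (v div 3 = pfst (u div 3) \<or> v div 3 = psnd (u div 3))"

definition coded_edges :: "baire \<Rightarrow> (nat \<Rightarrow> nat set) \<Rightarrow> (nat \<times> nat) set" where
  "coded_edges f A = {(u, v). link f A u v \<or> link f A v u}"

lemma graph_coded_edges: "graph UNIV (coded_edges f A)"
  by (auto simp: graph_def coded_edges_def sym_def irrefl_def link_def)

lemma computable_on_graph_name_coded_edges:
  "computable_on S (\<lambda>p. graph_name UNIV (coded_edges (\<lambda>k. p (2 * k)) (name_seq p)))"
proof -
  have "graph_name UNIV (coded_edges f A) =
      join (\<lambda>n. 1) (\<lambda>n. of_bool (link f A (pfst n) (psnd n) \<or> link f A (psnd n) (pfst n)))" for f A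
  proof -
    have "n \<in> prod_encode ` R \<longleftrightarrow> prod_decode n \<in> R" for n R
      by (metis image_iff inj_image_mem_iff inj_prod_encode prod_decode_inverse)
    then show ?thesis
      by (auto simp: graph_name_def chi_def fun_eq_iff join_def coded_edges_def split_beta)
  qed
  then show ?thesis
    unfolding link_def by (simp only:) (intro comp_intros)
qed

lemma coded_solution:
  assumes f: "approximates f (chi Z)" and Z: "infinite Z" and A: "\<forall>z\<in>Z. finite {i. z \<in> A i}"
    and H: "infinite H"
    and rs: "\<And>v. infinite (H \<inter> nbrs (coded_edges f A) v) \<or>
      (finite (H \<inter> nbrs (coded_edges f A) v) \<and> card (H \<inter> nbrs (coded_edges f A) v) \<le> 1)"
  defines "D \<equiv> {x. 3 * x \<in> H}"
  shows "infinite D" "finite (D - Z)"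
    "\<forall>i. infinite (D \<inter> A i) \<or> (finite (D \<inter> A i) \<and> card (D \<inter> A i) \<le> 1)"
    "\<forall>v\<in>H. infinite (H \<inter> nbrs (coded_edges f A) v) \<or> H \<inter> nbrs (coded_edges f A) v = {} \<Longrightarrow> D \<subseteq> Z"
proof -
  let ?N = "nbrs (coded_edges f A)"
  let ?W = "{u. \<exists>k. u = Suc (Suc (3 * k))}"
  \<comment> \<open>\<open>B\<close> collects the vertices that must be rare in \<open>H\<close>:
    each of them is adjacent to almost all numbers.\<close>
  define B where "B = (*) 3 ` (- Z) \<union> ?W"
  have [simp]: "Suc (3 * y) div 3 = y" "Suc (Suc (3 * y)) div 3 = y"
    "Suc (3 * y) mod 3 = 1" "Suc (Suc (3 * y)) mod 3 = 2" for y :: nat by presburger+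
  have mod3: "\<exists>x. v = 3 * x \<or> v = Suc (3 * x) \<or> v = Suc (Suc (3 * x))" for v :: nat by presburger
  have N: "v \<in> ?N u \<longleftrightarrow> link f A u v \<or> link f A v u" for u v
    by (simp add: nbrs_def coded_edges_def)
  have sym: "v \<in> ?N u \<longleftrightarrow> u \<in> ?N v" for u v by (auto simp: N)
  have ev: "\<forall>\<^sub>F y in sequentially. f (prod_encode (x, y)) = chi Z x" for x
    using f by (simp add: approximates_eventually)
  have two: False if "a \<in> X" "b \<in> X" "a \<noteq> b" "card X \<le> 1" "finite X" for X :: "nat set" and a b
    using that by (metis card_le_Suc0_iff_eq One_nat_def)
  \<comment> \<open>From stage \<open>n\<close> on \<open>x\<close> is believed to be in
    \<open>Z\<close>, so no larger number from \<open>n\<close> on is joined to it; it lies in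
    finitely many sets, and only smaller pairs are joined to it.\<close>
  have fin: "finite (?N (3 * x))" if x: "x \<in> Z" for x
  proof -
    obtain n where n: "\<And>y. y \<ge> n \<Longrightarrow> f (prod_encode (x, y)) = 1"
      using ev[of x] x by (auto simp: eventually_sequentially chi_def)
    have "?N (3 * x) \<subseteq> (*) 3 ` {..x + n} \<union> (\<lambda>i. Suc (3 * i)) ` {i. x \<in> A i} \<union> (\<lambda>k. Suc (Suc (3 * k))) ` {..x}"
    proof
      fix v assume v: "v \<in> ?N (3 * x)"
      obtain y where "v = 3 * y \<or> v = Suc (3 * y) \<or> v = Suc (Suc (3 * y))" using mod3 by blast
      then show "v \<in> (*) 3 ` {..x + n} \<union> (\<lambda>i. Suc (3 * i)) ` {i. x \<in> A i} \<union> (\<lambda>k. Suc (Suc (3 * k))) ` {..x}"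
      proof (elim disjE)
        assume vy: "v = 3 * y"
        have "y \<le> x + n"
        proof (rule ccontr)
          assume "\<not> y \<le> x + n"
          then have "x < y" "n \<le> y" by auto
          then show False using v n[of y] by (simp add: vy N link_def)
        qed
        then show ?thesis using vy by blast
      next
        assume vy: "v = Suc (3 * y)"
        then have "x \<in> A y" using v by (simp add: N link_def)
        then show ?thesis using vy by blast
      next
        assume vy: "v = Suc (Suc (3 * y))"
        then have "y \<le> x" using v by (simp add: N link_def)
        then show ?thesis using vy by blast
      qed
    qed
    moreover have "finite \<dots>" using A x by simp
    ultimately show ?thesis by (rule finite_subset)
  qed
  have adj: "\<exists>n. \<forall>x\<ge>n. u \<in> ?N (3 * x)" if uB: "u \<in> B" for u
  proof -
    consider y where "u = 3 * y" "y \<notin> Z" | k where "u = Suc (Suc (3 * k))"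
      using uB by (auto simp: B_def)
    then show ?thesis
    proof cases
      case 1
      then obtain n where n: "\<And>x. x \<ge> n \<Longrightarrow> f (prod_encode (y, x)) = 0"
        using ev[of y] by (auto simp: eventually_sequentially chi_def)
      have "u \<in> ?N (3 * x)" if "x \<ge> max n (Suc y)" for x
      proof -
        have "x \<ge> n" "y < x" using that by auto
        then show ?thesis using n[of x] 1 by (simp add: N link_def)
      qed
      then show ?thesis by blast
    next
      case 2
      then have "\<forall>x\<ge>Suc k. u \<in> ?N (3 * x)" by (simp add: N link_def Suc_le_eq)
      then show ?thesis by blast
    qed
  qed
  have large: "\<exists>x\<in>Z. x \<ge> n" for n
    using Z by (meson finite_nat_set_iff_bounded not_le)
  \<comment> \<open>Two such vertices would share a neighbour \<open>3 * x\<close> with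
    \<open>x\<close> in \<open>Z\<close>; its degree is finite, so it may have at most one neighbour
    in \<open>H\<close>.\<close>
  have one: "a = b" if ab: "a \<in> H \<inter> B" "b \<in> H \<inter> B" for a b
  proof (rule ccontr)
    assume "a \<noteq> b"
    obtain n m where nm: "\<And>x. x \<ge> n \<Longrightarrow> a \<in> ?N (3 * x)" "\<And>x. x \<ge> m \<Longrightarrow> b \<in> ?N (3 * x)"
      using adj ab by blast
    obtain x where x: "x \<in> Z" "x \<ge> max n m" using large by blast
    have "finite (H \<inter> ?N (3 * x))" using fin[OF x(1)] by blast
    with rs[of "3 * x"] have "card (H \<inter> ?N (3 * x)) \<le> 1" by blast
    with two[of a "H \<inter> ?N (3 * x)" b] nm[of x] x ab \<open>a \<noteq> b\<close> \<open>finite (H \<inter> ?N (3 * x))\<close>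
    show False by simp
  qed
  have finB: "finite (H \<inter> B)"
  proof (cases "H \<inter> B = {}")
    case False
    then obtain a where "a \<in> H \<inter> B" by blast
    then have "H \<inter> B \<subseteq> {a}" using one by blast
    then show ?thesis by (rule finite_subset) simp
  qed simp
  have inj3: "inj_on ((*) (3::nat)) X" for X by (simp add: inj_on_def)
  have fin3: "finite ((*) 3 ` X) \<longleftrightarrow> finite X" for X :: "nat set" using finite_image_iff[OF inj3] .
  show "infinite D"
  proof
    \<comment> \<open>Otherwise \<open>H\<close> contains two set vertices. The vertex of their pair
      is adjacent to no other set vertices, so it has at least two, but finitely many, neighbours in
      \<open>H\<close>.\<close>
    assume D: "finite D"
    define I where "I = {i. Suc (3 * i) \<in> H}"
    have "H \<subseteq> (*) 3 ` D \<union> (\<lambda>i. Suc (3 * i)) ` I \<union> (H \<inter> B)"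
    proof
      fix v assume "v \<in> H"
      then show "v \<in> (*) 3 ` D \<union> (\<lambda>i. Suc (3 * i)) ` I \<union> (H \<inter> B)"
        using mod3[of v] by (auto simp: D_def I_def B_def)
    qed
    with H D finB have "infinite I" by (meson finite_UnI finite_imageI finite_subset)
    then obtain i where i: "i \<in> I" by (metis ex_in_conv finite.emptyI)
    from \<open>infinite I\<close> have "infinite (I - {i})" by simp
    then have "I - {i} \<noteq> {}" by (metis finite.emptyI)
    then obtain j where j: "j \<in> I" "j \<noteq> i" by blast
    let ?w = "Suc (Suc (3 * prod_encode (i, j)))"
    have sub: "H \<inter> ?N ?w \<subseteq> {Suc (3 * i), Suc (3 * j)} \<union> (*) 3 ` D"
    proof
      fix v assume v: "v \<in> H \<inter> ?N ?w"
      then show "v \<in> {Suc (3 * i), Suc (3 * j)} \<union> (*) 3 ` D"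
        using mod3[of v] by (auto simp: N link_def D_def)
    qed
    have fw: "finite (H \<inter> ?N ?w)" by (rule finite_subset[OF sub]) (use D in simp)
    have "Suc (3 * i) \<in> H \<inter> ?N ?w" "Suc (3 * j) \<in> H \<inter> ?N ?w"
      using i j by (auto simp: I_def N link_def)
    moreover have "card (H \<inter> ?N ?w) \<le> 1" using rs[of ?w] fw by blast
    moreover have "Suc (3 * i) \<noteq> Suc (3 * j)" using j(2) by simp
    ultimately show False using two fw by metis
  qed
  note infD = this
  have "(*) 3 ` (D - Z) \<subseteq> H \<inter> B" by (auto simp: D_def B_def)
  then show finDZ: "finite (D - Z)" using finite_subset[OF _ finB] fin3 by metis
  show "\<forall>i. infinite (D \<inter> A i) \<or> (finite (D \<inter> A i) \<and> card (D \<inter> A i) \<le> 1)"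
  proof
    fix i
    let ?X = "H \<inter> ?N (Suc (3 * i))"
    have sub: "(*) 3 ` (D \<inter> A i) \<subseteq> ?X" by (auto simp: D_def N link_def)
    \<comment> \<open>Apart from the elements of \<open>A i\<close>, a set vertex is adjacent only
      to pairs, and \<open>H\<close> contains finitely many of these.\<close>
    have sup: "?X \<subseteq> (*) 3 ` (D \<inter> A i) \<union> (H \<inter> B)"
    proof
      fix v assume v: "v \<in> ?X"
      then show "v \<in> (*) 3 ` (D \<inter> A i) \<union> (H \<inter> B)"
        using mod3[of v] by (auto simp: N link_def D_def B_def)
    qed
    from rs[of "Suc (3 * i)"] show "infinite (D \<inter> A i) \<or> (finite (D \<inter> A i) \<and> card (D \<inter> A i) \<le> 1)"
    proof
      assume "infinite ?X"
      then have "infinite ((*) 3 ` (D \<inter> A i))" using sup finB by (meson finite_UnI finite_subset)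
      then show ?thesis unfolding fin3 ..
    next
      assume X: "finite ?X \<and> card ?X \<le> 1"
      then have "finite (D \<inter> A i)" using finite_subset[OF sub] fin3 by metis
      moreover have "card (D \<inter> A i) \<le> card ?X"
        using card_mono[OF _ sub] X by (simp add: card_image[OF inj3])
      ultimately show ?thesis using X by linarith
    qed
  qed
  \<comment> \<open>A member of \<open>D\<close> outside \<open>Z\<close> would be adjacent to some
    late \<open>y\<close> in both \<open>D\<close> and \<open>Z\<close>; as \<open>3 * y\<close> has
    finite degree, it may have no neighbour in \<open>H\<close>.\<close>
  assume gr: "\<forall>v\<in>H. infinite (H \<inter> ?N v) \<or> H \<inter> ?N v = {}"
  show "D \<subseteq> Z"
  proof (rule ccontr)
    assume "\<not> D \<subseteq> Z"
    then obtain x where x: "x \<in> D" "x \<notin> Z" by blast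
    then obtain n where n: "\<And>y. y \<ge> n \<Longrightarrow> 3 * x \<in> ?N (3 * y)"
      using adj[of "3 * x"] by (auto simp: B_def)
    have "infinite (D \<inter> Z)" using infD finDZ by (metis Un_Diff_Int finite_UnI)
    then obtain y where y: "y \<in> D" "y \<in> Z" "y \<ge> n"
      by (metis Int_iff finite_nat_set_iff_bounded not_le)
    have "finite (H \<inter> ?N (3 * y))" using fin[OF y(2)] by blast
    moreover have "3 * y \<in> H" "3 * x \<in> H \<inter> ?N (3 * y)" using x y n by (auto simp: D_def)
    ultimately show False using gr by blast
  qed
qed

section \<open>The reductions of the INForONE problems to RSgr, to RSg and to each other\<close>

lemma RSg_graph_name:
  "RSg (graph_name V E) = {h. graph V E \<and> infinite V \<and> (\<exists>H. h = chi H \<and> H \<subseteq> V \<and> infinite H \<and>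
     (\<forall>v\<in>V. infinite (H \<inter> nbrs E v) \<or> (finite (H \<inter> nbrs E v) \<and> card (H \<inter> nbrs E v) \<le> 1)))}"
  unfolding RSg_def by auto

definition valid_instance :: "baire \<Rightarrow> (nat \<Rightarrow> nat set) \<Rightarrow> nat set \<Rightarrow> bool" where
  "valid_instance f A Z \<longleftrightarrow> approximates f (chi Z) \<and> infinite Z \<and> (\<forall>z\<in>Z. finite {i. z \<in> A i})"

lemma approximates_chi_unique: "approximates f (chi Z) \<Longrightarrow> approximates f (chi Y) \<Longrightarrow> Y = Z"
  using approximates_unique chi_inject by blast

lemma INForONE_join:
  assumes "valid_instance f A Z"
  shows "INForONE_in_Delta2 (join f (seq_name A)) = {h. \<exists>D. h = chi D \<and> infinite D \<and> D \<subseteq> Z \<and>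
     (\<forall>i. infinite (D \<inter> A i) \<or> (finite (D \<inter> A i) \<and> card (D \<inter> A i) \<le> 1))}"
  using assms unfolding INForONE_in_Delta2_def valid_instance_def
  by (auto dest: approximates_chi_unique)

lemma INForONE_star_join:
  assumes "valid_instance f A Z"
  shows "INForONE_in_star_Delta2 (join f (seq_name A)) = {h. \<exists>D. h = chi D \<and> infinite D \<and> finite (D - Z) \<and>
     (\<forall>i. infinite (D \<inter> A i) \<or> (finite (D \<inter> A i) \<and> card (D \<inter> A i) \<le> 1))}"
  using assms unfolding INForONE_in_star_Delta2_def valid_instance_def
  by (auto dest: approximates_chi_unique)

lemma pdom_INForONEE:
  assumes "p \<in> pdom INForONE_in_Delta2 \<or> p \<in> pdom INForONE_in_star_Delta2"
  obtains f A Z where "p = join f (seq_name A)" "valid_instance f A Z"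
  using assms unfolding pdom_def INForONE_in_Delta2_def INForONE_in_star_Delta2_def valid_instance_def
  by blast

definition rs_decode :: "baire \<Rightarrow> baire" where
  "rs_decode h n = h (3 * n)"

lemma rs_decode_chi: "rs_decode (chi H) = chi {x. 3 * x \<in> H}"
  by (simp add: rs_decode_def chi_def fun_eq_iff)

lemma rs_decode_RSgr:
  assumes "valid_instance f A Z" "h \<in> RSgr (graph_name UNIV (coded_edges f A))"
  shows "rs_decode h \<in> INForONE_in_Delta2 (join f (seq_name A))"
proof -
  obtain H where H: "h = chi H" "infinite H"
     "\<And>v. infinite (H \<inter> nbrs (coded_edges f A) v) \<or>
      (finite (H \<inter> nbrs (coded_edges f A) v) \<and> card (H \<inter> nbrs (coded_edges f A) v) \<le> 1)"
     "\<forall>v\<in>H. infinite (H \<inter> nbrs (coded_edges f A) v) \<or> H \<inter> nbrs (coded_edges f A) v = {}"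
    using assms(2) unfolding RSgr_graph_name by blast
  have v: "approximates f (chi Z)" "infinite Z" "\<forall>z\<in>Z. finite {i. z \<in> A i}"
    using assms(1) by (auto simp: valid_instance_def)
  show ?thesis
    unfolding INForONE_join[OF assms(1)] H(1) rs_decode_chi
    using coded_solution[OF v H(2,3)] H(4) by blast
qed

lemma rs_decode_RSg:
  assumes "valid_instance f A Z" "h \<in> RSg (graph_name UNIV (coded_edges f A))"
  shows "rs_decode h \<in> INForONE_in_star_Delta2 (join f (seq_name A))"
proof -
  obtain H where H: "h = chi H" "infinite H"
     "\<And>v. infinite (H \<inter> nbrs (coded_edges f A) v) \<or>
      (finite (H \<inter> nbrs (coded_edges f A) v) \<and> card (H \<inter> nbrs (coded_edges f A) v) \<le> 1)"
    using assms(2) unfolding RSg_graph_name by blast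
  have v: "approximates f (chi Z)" "infinite Z" "\<forall>z\<in>Z. finite {i. z \<in> A i}"
    using assms(1) by (auto simp: valid_instance_def)
  show ?thesis
    unfolding INForONE_star_join[OF assms(1)] H(1) rs_decode_chi
    using coded_solution[OF v H(2,3)] by blast
qed

lemma coded_in_pdom:
  "graph_name UNIV (coded_edges f A) \<in> pdom RSgr" "graph_name UNIV (coded_edges f A) \<in> pdom RSg"
proof -
  show "graph_name UNIV (coded_edges f A) \<in> pdom RSgr"
    by (rule RSgr_nonempty[OF graph_coded_edges]) simp
  then show "graph_name UNIV (coded_edges f A) \<in> pdom RSg"
    using RSgr_subset_RSg[of "graph_name UNIV (coded_edges f A)"] unfolding pdom_def by blast
qed

text \<open>Solvability is inherited from the graph problem, whose solutions decode to
  solutions.\<close>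

lemma INForONE_nonempty:
  assumes "valid_instance f A Z"
  shows "join f (seq_name A) \<in> pdom INForONE_in_Delta2"
proof -
  obtain h where "h \<in> RSgr (graph_name UNIV (coded_edges f A))"
    using coded_in_pdom(1)[of f A] unfolding pdom_def by blast
  from rs_decode_RSgr[OF assms this] show ?thesis unfolding pdom_def by blast
qed

lemma computable_on_rs_decode: "computable_on S (\<lambda>x. rs_decode (\<lambda>n. x (Suc (2 * n))))"
  unfolding rs_decode_def by (intro comp_intros)

lemma INForONE_le_RSgr: "INForONE_in_Delta2 \<le>\<^sub>W RSgr"
proof (rule weihrauch_leI)
  show "computable_on (pdom INForONE_in_Delta2)
      (\<lambda>p. graph_name UNIV (coded_edges (\<lambda>k. p (2 * k)) (name_seq p)))"
    by (rule computable_on_graph_name_coded_edges)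
  show "computable_on {join p r |p r. p \<in> pdom INForONE_in_Delta2 \<and>
      r \<in> RSgr (graph_name UNIV (coded_edges (\<lambda>k. p (2 * k)) (name_seq p)))}
      (\<lambda>x. rs_decode (\<lambda>n. x (Suc (2 * n))))"
    by (rule computable_on_rs_decode)
  fix p assume "p \<in> pdom INForONE_in_Delta2"
  then obtain f A Z where p: "p = join f (seq_name A)" "valid_instance f A Z"
    using pdom_INForONEE by blast
  show "graph_name UNIV (coded_edges (\<lambda>k. p (2 * k)) (name_seq p)) \<in> pdom RSgr"
    by (rule coded_in_pdom)
  fix r assume "r \<in> RSgr (graph_name UNIV (coded_edges (\<lambda>k. p (2 * k)) (name_seq p)))"
  with p show "rs_decode (\<lambda>n. join p r (Suc (2 * n))) \<in> INForONE_in_Delta2 p"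
    using rs_decode_RSgr[of f A Z r] by simp
qed

lemma INForONE_star_le_RSg: "INForONE_in_star_Delta2 \<le>\<^sub>W RSg"
proof (rule weihrauch_leI)
  show "computable_on (pdom INForONE_in_star_Delta2)
      (\<lambda>p. graph_name UNIV (coded_edges (\<lambda>k. p (2 * k)) (name_seq p)))"
    by (rule computable_on_graph_name_coded_edges)
  show "computable_on {join p r |p r. p \<in> pdom INForONE_in_star_Delta2 \<and>
      r \<in> RSg (graph_name UNIV (coded_edges (\<lambda>k. p (2 * k)) (name_seq p)))}
      (\<lambda>x. rs_decode (\<lambda>n. x (Suc (2 * n))))"
    by (rule computable_on_rs_decode)
  fix p assume "p \<in> pdom INForONE_in_star_Delta2"
  then obtain f A Z where p: "p = join f (seq_name A)" "valid_instance f A Z"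
    using pdom_INForONEE by blast
  show "graph_name UNIV (coded_edges (\<lambda>k. p (2 * k)) (name_seq p)) \<in> pdom RSg"
    by (rule coded_in_pdom)
  fix r assume "r \<in> RSg (graph_name UNIV (coded_edges (\<lambda>k. p (2 * k)) (name_seq p)))"
  with p show "rs_decode (\<lambda>n. join p r (Suc (2 * n))) \<in> INForONE_in_star_Delta2 p"
    using rs_decode_RSg[of f A Z r] by simp
qed

lemma INForONE_subset_star:
  assumes "valid_instance f A Z"
  shows "INForONE_in_Delta2 (join f (seq_name A)) \<subseteq> INForONE_in_star_Delta2 (join f (seq_name A))"
  unfolding INForONE_join[OF assms] INForONE_star_join[OF assms]
  by (auto simp: Diff_eq_empty_iff[THEN iffD2])

lemma INForONE_star_le_INForONE: "INForONE_in_star_Delta2 \<le>\<^sub>W INForONE_in_Delta2"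
proof (rule weihrauch_le_refine)
  fix p assume "p \<in> pdom INForONE_in_star_Delta2"
  then obtain f A Z where p: "p = join f (seq_name A)" "valid_instance f A Z"
    using pdom_INForONEE by blast
  then show "p \<in> pdom INForONE_in_Delta2 \<and> INForONE_in_Delta2 p \<subseteq> INForONE_in_star_Delta2 p"
    using INForONE_nonempty INForONE_subset_star by simp
qed

section \<open>Certificates of computations\<close>

lemma decidable_on_if [comp_intros]:
  assumes "decidable_on S R" "decidable_on S P" "decidable_on S Q"
  shows "decidable_on S (\<lambda>p n. if R p n then P p n else Q p n)"
proof -
  have "decidable_on S (\<lambda>p n. (R p n \<longrightarrow> P p n) \<and> (\<not> R p n \<longrightarrow> Q p n))" by (intro comp_intros assms)
  then show ?thesis by (simp only: if_bool_eq_conj)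
qed

text \<open>Stands for the claim that the program with code \<open>e\<close> maps \<open>n\<close>
  to \<open>v\<close>.\<close>

definition triple :: "nat \<Rightarrow> nat \<Rightarrow> nat \<Rightarrow> nat" where
  "triple e n v = prod_encode (e, prod_encode (n, v))"

text \<open>One evaluation step with its premises looked up in \<open>S\<close>. It is phrased on
  codes in order to be decidable; residues modulo 4 tell the compound programs apart, as in
  \<open>prog_encode\<close>.\<close>

definition justified :: "baire \<Rightarrow> nat set \<Rightarrow> nat \<Rightarrow> nat \<Rightarrow> nat \<Rightarrow> bool" where
  "justified X S e n v \<longleftrightarrow>
    (if e = 0 then v = 0
     else if e = 1 then v = Suc n
     else if e = 2 then v = pfst n
     else if e = 3 then v = psnd n
     else if e = 4 then v = X n
     else if e mod 4 = 1 then \<exists>u w. triple (pfst ((e - 5) div 4)) n u \<in> S \<and>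
       triple (psnd ((e - 5) div 4)) n w \<in> S \<and> v = prod_encode (u, w)
     else if e mod 4 = 2 then \<exists>u. triple (psnd ((e - 5) div 4)) n u \<in> S \<and>
       triple (pfst ((e - 5) div 4)) u v \<in> S
     else if e mod 4 = 3 then
       (if psnd n = 0 then triple (pfst ((e - 5) div 4)) (pfst n) v \<in> S
        else \<exists>u. triple e (prod_encode (pfst n, psnd n - 1)) u \<in> S \<and>
          triple (psnd ((e - 5) div 4)) (prod_encode (pfst n, prod_encode (psnd n - 1, u))) v \<in> S)
     else triple ((e - 5) div 4) (prod_encode (n, v)) 0 \<in> S \<and>
       (\<forall>i<v. \<exists>u. triple ((e - 5) div 4) (prod_encode (n, i)) (Suc u) \<in> S))"

text \<open>
  The entries of a certificate need not be ordered: every justification refers to subprograms, or to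
  the same recursion with a smaller argument, so soundness follows by induction on the program.
  Hence certificates are closed under unions.
\<close>

definition certificate :: "baire \<Rightarrow> nat set \<Rightarrow> bool" where
  "certificate X S \<longleftrightarrow> (\<forall>e n v. triple e n v \<in> S \<longrightarrow> justified X S e n v)"

lemma triple_inject [simp]: "triple e n v = triple e' n' v' \<longleftrightarrow> e = e' \<and> n = n' \<and> v = v'"
  by (auto simp: triple_def)

lemma code_arith [simp]:
  "(5 + 4 * x) mod 4 = 1" "(6 + 4 * x) mod 4 = 2" "(7 + 4 * x) mod 4 = 3" "(8 + 4 * x) mod 4 = 0"
  "Suc (4 * x) div 4 = x" "Suc (Suc (4 * x)) div 4 = x" "(3 + 4 * x) div 4 = x" for x :: nat
  by presburger+

lemma justified_simps [simp]:
  "justified X S (prog_encode Zero) n v \<longleftrightarrow> v = 0"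
  "justified X S (prog_encode Succ) n v \<longleftrightarrow> v = Suc n"
  "justified X S (prog_encode Fst) n v \<longleftrightarrow> v = pfst n"
  "justified X S (prog_encode Snd) n v \<longleftrightarrow> v = psnd n"
  "justified X S (prog_encode Query) n v \<longleftrightarrow> v = X n"
  "justified X S (prog_encode (Pair c d)) n v \<longleftrightarrow>
     (\<exists>u w. triple (prog_encode c) n u \<in> S \<and> triple (prog_encode d) n w \<in> S \<and> v = prod_encode (u, w))"
  "justified X S (prog_encode (Comp c d)) n v \<longleftrightarrow>
     (\<exists>u. triple (prog_encode d) n u \<in> S \<and> triple (prog_encode c) u v \<in> S)"
  "justified X S (prog_encode (Prec c d)) n v \<longleftrightarrow>
     (if psnd n = 0 then triple (prog_encode c) (pfst n) v \<in> S
      else \<exists>u. triple (prog_encode (Prec c d)) (prod_encode (pfst n, psnd n - 1)) u \<in> S \<and>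
        triple (prog_encode d) (prod_encode (pfst n, prod_encode (psnd n - 1, u))) v \<in> S)"
  "justified X S (prog_encode (Mu c)) n v \<longleftrightarrow>
     triple (prog_encode c) (prod_encode (n, v)) 0 \<in> S \<and>
     (\<forall>i<v. \<exists>u. triple (prog_encode c) (prod_encode (n, i)) (Suc u) \<in> S)"
  by (simp_all add: justified_def)

lemma run_Prec_0: "run (Prec c d) p (prod_encode (a, 0)) = run c p a"
  by simp

lemma run_Prec_Suc: "run (Prec c d) p (prod_encode (a, Suc m)) =
  Option.bind (run (Prec c d) p (prod_encode (a, m))) (\<lambda>v. run d p (prod_encode (a, prod_encode (m, v))))"
  by simp

lemma run_Mu_eq_Some: "run (Mu c) p n = Some v \<longleftrightarrow> run c p (prod_encode (n, v)) = Some 0 \<and>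
  (\<forall>i<v. \<exists>u. run c p (prod_encode (n, i)) = Some (Suc u))"
proof -
  define Q where "Q = (\<lambda>m. run c p (prod_encode (n, m)) = Some 0 \<and>
      (\<forall>i<m. \<exists>v>0. run c p (prod_encode (n, i)) = Some v))"
  have uniq: "m = m'" if "Q m" "Q m'" for m m'
    using that unfolding Q_def by (metis less_irrefl nat_neq_iff option.inject)
  have "run (Mu c) p n = (if \<exists>m. Q m then Some (LEAST m. Q m) else None)"
    by (simp add: Q_def Let_def)
  also have "\<dots> = Some v \<longleftrightarrow> Q v"
    using uniq by (auto intro: LeastI Least_equality)
  finally show ?thesis by (simp add: Q_def gr0_conv_Suc) blast
qed

lemma certificate_sound:
  assumes "certificate X S" "triple (prog_encode P) n v \<in> S"
  shows "run P X n = Some v"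
  using assms(2)
proof (induction P arbitrary: n v)
  case (Prec c d)
  have "run (Prec c d) X (prod_encode (a, m)) = Some w"
    if "triple (prog_encode (Prec c d)) (prod_encode (a, m)) w \<in> S" for a m w
    using that
  proof (induction m arbitrary: w)
    case 0
    then have "justified X S (prog_encode (Prec c d)) (prod_encode (a, 0)) w"
      using assms(1) unfolding certificate_def by blast
    then show ?case unfolding run_Prec_0 justified_simps by (auto intro: Prec.IH(1))
  next
    case (Suc m)
    then have "justified X S (prog_encode (Prec c d)) (prod_encode (a, Suc m)) w"
      using assms(1) unfolding certificate_def by blast
    then obtain u where "triple (prog_encode (Prec c d)) (prod_encode (a, m)) u \<in> S"
      "triple (prog_encode d) (prod_encode (a, prod_encode (m, u))) w \<in> S"
      unfolding justified_simps by auto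
    then have "run (Prec c d) X (prod_encode (a, m)) = Some u"
      "run d X (prod_encode (a, prod_encode (m, u))) = Some w"
      using Suc.IH Prec.IH(2) by blast+
    then show ?case unfolding run_Prec_Suc by simp
  qed
  from this[of "pfst n" "psnd n"] Prec.prems show ?case by simp
next
  case (Mu c)
  then have "justified X S (prog_encode (Mu c)) n v"
    using assms(1) unfolding certificate_def by blast
  then show ?case unfolding run_Mu_eq_Some justified_simps using Mu.IH by blast
next
  case (Pair c d)
  then have "justified X S (prog_encode (Pair c d)) n v"
    using assms(1) unfolding certificate_def by blast
  then obtain u w where "run c X n = Some u" "run d X n = Some w" "v = prod_encode (u, w)"
    unfolding justified_simps using Pair.IH by blast
  then show ?case by simp
next
  case (Comp c d)
  then have "justified X S (prog_encode (Comp c d)) n v"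
    using assms(1) unfolding certificate_def by blast
  then obtain u where "run d X n = Some u" "run c X u = Some v"
    unfolding justified_simps using Comp.IH by blast
  then show ?case by simp
next
  case Zero
  then have "justified X S (prog_encode Zero) n v"
    using assms(1) unfolding certificate_def by blast
  then show ?case unfolding justified_simps by simp
next
  case Succ
  then have "justified X S (prog_encode Succ) n v"
    using assms(1) unfolding certificate_def by blast
  then show ?case unfolding justified_simps by simp
next
  case Fst
  then have "justified X S (prog_encode Fst) n v"
    using assms(1) unfolding certificate_def by blast
  then show ?case unfolding justified_simps by simp
next
  case Snd
  then have "justified X S (prog_encode Snd) n v"
    using assms(1) unfolding certificate_def by blast
  then show ?case unfolding justified_simps by simp
next
  case Query
  then have "justified X S (prog_encode Query) n v"
    using assms(1) unfolding certificate_def by blast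
  then show ?case unfolding justified_simps by simp
qed

lemma justified_mono:
  assumes "justified X S e n v" "S \<subseteq> S'"
  shows "justified X S' e n v"
proof -
  obtain P where P: "e = prog_encode P" by (metis surj_prog_encode)
  show ?thesis
  proof (cases P)
    case (Prec c d)
    with assms show ?thesis unfolding P Prec justified_simps by (auto split: if_splits)
  next
    case (Mu c)
    with assms show ?thesis unfolding P Mu justified_simps by blast
  qed (use assms in \<open>unfold P, simp only: justified_simps, blast?\<close>)+
qed

definition certified :: "baire \<Rightarrow> nat \<Rightarrow> bool" where
  "certified X t \<longleftrightarrow> (\<exists>S. finite S \<and> certificate X S \<and> t \<in> S)"

lemma certificate_Un:
  "certificate X S \<Longrightarrow> certificate X S' \<Longrightarrow> certificate X (S \<union> S')"
  unfolding certificate_def using justified_mono by (metis Un_iff Un_upper1 Un_upper2)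

lemma certified_common:
  assumes "finite F" "\<And>t. t \<in> F \<Longrightarrow> certified X t"
  shows "\<exists>S. finite S \<and> certificate X S \<and> F \<subseteq> S"
  using assms
proof (induction F)
  case empty
  have "certificate X {}" by (simp add: certificate_def)
  then show ?case by blast
next
  case (insert t F)
  then obtain S S' where "finite S" "certificate X S" "F \<subseteq> S" "finite S'" "certificate X S'" "t \<in> S'"
    unfolding certified_def by (metis insertI1 insertI2)
  then show ?case by (intro exI[of _ "S \<union> S'"]) (auto intro: certificate_Un)
qed

text \<open>Certificates of finitely many premises merge by union, and the conclusion may be added
  because justification is monotone in \<open>S\<close>.\<close>

lemma certifiedI:
  assumes "finite F" "\<And>t. t \<in> F \<Longrightarrow> certified X t" "justified X F e n v"
  shows "certified X (triple e n v)"
proof -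
  obtain S where S: "finite S" "certificate X S" "F \<subseteq> S"
    using certified_common[OF assms(1,2)] by blast
  let ?S = "insert (triple e n v) S"
  have "justified X ?S e n v" by (rule justified_mono[OF assms(3)]) (use S in blast)
  moreover have "justified X ?S e' n' v'" if "triple e' n' v' \<in> S" for e' n' v'
    using S that unfolding certificate_def by (metis justified_mono subset_insertI)
  ultimately have "certificate X ?S" unfolding certificate_def by auto
  with S(1) show ?thesis unfolding certified_def by (intro exI[of _ ?S]) simp
qed

lemma certificate_complete: "run P X n = Some v \<Longrightarrow> certified X (triple (prog_encode P) n v)"
proof (induction P arbitrary: n v)
  case (Pair c d)
  then obtain u w where "run c X n = Some u" "run d X n = Some w" "v = prod_encode (u, w)"
    by (auto simp: Option.bind_eq_Some_conv)
  then show ?case using Pair.IH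
    by (intro certifiedI[of "{triple (prog_encode c) n u, triple (prog_encode d) n w}"])
      (auto simp del: prog_encode.simps)
next
  case (Comp c d)
  then obtain u where "run d X n = Some u" "run c X u = Some v"
    by (auto simp: Option.bind_eq_Some_conv)
  then show ?case using Comp.IH
    by (intro certifiedI[of "{triple (prog_encode d) n u, triple (prog_encode c) u v}"])
      (auto simp del: prog_encode.simps)
next
  case (Prec c d)
  have "certified X (triple (prog_encode (Prec c d)) (prod_encode (a, m)) w)"
    if "run (Prec c d) X (prod_encode (a, m)) = Some w" for a m w
    using that
  proof (induction m arbitrary: w)
    case 0
    then have "run c X a = Some w" unfolding run_Prec_0 .
    then show ?case using Prec.IH(1)
      by (intro certifiedI[of "{triple (prog_encode c) a w}"]) (auto simp del: prog_encode.simps)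
  next
    case (Suc m)
    then obtain u where "run (Prec c d) X (prod_encode (a, m)) = Some u"
      "run d X (prod_encode (a, prod_encode (m, u))) = Some w"
      unfolding run_Prec_Suc Option.bind_eq_Some_conv by blast
    then show ?case using Suc.IH Prec.IH(2)
      by (intro certifiedI[of "{triple (prog_encode (Prec c d)) (prod_encode (a, m)) u,
          triple (prog_encode d) (prod_encode (a, prod_encode (m, u))) w}"])
        (auto simp del: prog_encode.simps)
  qed
  from this[of "pfst n" "psnd n"] Prec.prems show ?case by (simp del: prog_encode.simps run.simps)
next
  case (Mu c)
  then obtain f where f: "run c X (prod_encode (n, v)) = Some 0"
    "\<And>i. i < v \<Longrightarrow> run c X (prod_encode (n, i)) = Some (Suc (f i))"
    unfolding run_Mu_eq_Some by metis
  then show ?case using Mu.IH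
    by (intro certifiedI[of "insert (triple (prog_encode c) (prod_encode (n, v)) 0)
        ((\<lambda>i. triple (prog_encode c) (prod_encode (n, i)) (Suc (f i))) ` {..<v})"])
      (auto simp del: prog_encode.simps)
qed (auto intro!: certifiedI[of "{}"] simp del: prog_encode.simps)

section \<open>Certificates coded as numbers\<close>

lemma mem_set_decode_less: "x \<in> set_decode c \<Longrightarrow> x < c"
proof -
  assume "x \<in> set_decode c"
  then have "c div 2 ^ x \<noteq> 0" unfolding set_decode_def by (metis even_zero mem_Collect_eq)
  then have "2 ^ x \<le> c" by (metis div_less not_less)
  with less_exp[of x] show "x < c" by (rule less_le_trans)
qed

text \<open>The components of all entries lie below the code, which bounds the quantifiers of
  \<open>justified\<close> and makes validity decidable.\<close>

lemma triple_mem_set_decode_less: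
  assumes "triple e n v \<in> set_decode c"
  shows "e < c" "n < c" "v < c"
proof -
  have "triple e n v < c" using assms by (rule mem_set_decode_less)
  moreover have "e \<le> triple e n v" "prod_encode (n, v) \<le> triple e n v"
    "n \<le> prod_encode (n, v)" "v \<le> prod_encode (n, v)"
    unfolding triple_def by (rule le_prod_encode_1 le_prod_encode_2)+
  ultimately show "e < c" "n < c" "v < c" by linarith+
qed

definition valid_code :: "baire \<Rightarrow> nat \<Rightarrow> bool" where
  "valid_code X c \<longleftrightarrow> certificate X (set_decode c)"

definition code_yields :: "nat \<Rightarrow> nat \<Rightarrow> nat \<Rightarrow> nat \<Rightarrow> bool" where
  "code_yields c e n v \<longleftrightarrow> triple e n v \<in> set_decode c"

lemma Phi_iff_code: "Phi e X n = Some v \<longleftrightarrow> (\<exists>c. valid_code X c \<and> code_yields c e n v)"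
proof -
  obtain P where P: "e = prog_encode P" by (metis surj_prog_encode)
  show ?thesis
  proof
    assume "Phi e X n = Some v"
    then have "certified X (triple e n v)" by (simp add: P Phi_def certificate_complete)
    then obtain S where "finite S" "certificate X S" "triple e n v \<in> S"
      unfolding certified_def by blast
    then show "\<exists>c. valid_code X c \<and> code_yields c e n v"
      by (intro exI[of _ "set_encode S"]) (simp add: valid_code_def code_yields_def)
  next
    assume "\<exists>c. valid_code X c \<and> code_yields c e n v"
    then show "Phi e X n = Some v"
      by (auto simp: P Phi_def valid_code_def code_yields_def intro: certificate_sound)
  qed
qed

lemma justified_set_decode:
  "justified X (set_decode c) e n v \<longleftrightarrow>
    (if e = 0 then v = 0
     else if e = 1 then v = Suc n
     else if e = 2 then v = pfst n
     else if e = 3 then v = psnd n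
     else if e = 4 then v = X n
     else if e mod 4 = 1 then \<exists>u<c. \<exists>w<c. triple (pfst ((e - 5) div 4)) n u \<in> set_decode c \<and>
       triple (psnd ((e - 5) div 4)) n w \<in> set_decode c \<and> v = prod_encode (u, w)
     else if e mod 4 = 2 then \<exists>u<c. triple (psnd ((e - 5) div 4)) n u \<in> set_decode c \<and>
       triple (pfst ((e - 5) div 4)) u v \<in> set_decode c
     else if e mod 4 = 3 then
       (if psnd n = 0 then triple (pfst ((e - 5) div 4)) (pfst n) v \<in> set_decode c
        else \<exists>u<c. triple e (prod_encode (pfst n, psnd n - 1)) u \<in> set_decode c \<and>
          triple (psnd ((e - 5) div 4)) (prod_encode (pfst n, prod_encode (psnd n - 1, u))) v \<in> set_decode c)
     else triple ((e - 5) div 4) (prod_encode (n, v)) 0 \<in> set_decode c \<and>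
       (\<forall>i<v. \<exists>u<c. triple ((e - 5) div 4) (prod_encode (n, i)) (Suc u) \<in> set_decode c))"
proof -
  have 1: "(\<exists>u. triple e n u \<in> set_decode c \<and> R u) \<longleftrightarrow> (\<exists>u<c. triple e n u \<in> set_decode c \<and> R u)" for e n R
    using triple_mem_set_decode_less(3) by meson
  have 2: "(\<exists>u w. triple e n u \<in> set_decode c \<and> triple e' n w \<in> set_decode c \<and> R u w) \<longleftrightarrow>
    (\<exists>u<c. \<exists>w<c. triple e n u \<in> set_decode c \<and> triple e' n w \<in> set_decode c \<and> R u w)" for e e' n R
    using triple_mem_set_decode_less(3) by meson
  have 3: "(\<exists>u. triple e n (Suc u) \<in> set_decode c) \<longleftrightarrow> (\<exists>u<c. triple e n (Suc u) \<in> set_decode c)" for e n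
    using triple_mem_set_decode_less(3) Suc_lessD by meson
  show ?thesis unfolding justified_def by (simp only: 1 2 3)
qed

lemma valid_code_iff: "valid_code X c \<longleftrightarrow>
  (\<forall>e<c. \<forall>n<c. \<forall>v<c. code_yields c e n v \<longrightarrow> justified X (set_decode c) e n v)"
  unfolding valid_code_def certificate_def code_yields_def using triple_mem_set_decode_less by blast

text \<open>The use of a certificate is finite: a recorded query has an argument below
  \<open>c\<close>.\<close>

lemma valid_code_cong:
  assumes "\<And>n. n < c \<Longrightarrow> X n = Y n"
  shows "valid_code X c \<longleftrightarrow> valid_code Y c"
proof -
  have "justified X S e n v \<longleftrightarrow> justified Y S e n v" if "n < c" for S e n v
    using assms[OF that] by (simp add: justified_def)
  then show ?thesis unfolding valid_code_iff by blast
qed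

lemma computable_on_triple [comp_intros]:
  assumes "computable_on S F" "computable_on S G" "computable_on S H"
  shows "computable_on S (\<lambda>p n. triple (F p n) (G p n) (H p n))"
  unfolding triple_def by (intro comp_intros assms)

lemma decidable_on_code_yields [comp_intros]:
  assumes "computable_on S C" "computable_on S F" "computable_on S G" "computable_on S H"
  shows "decidable_on S (\<lambda>p n. code_yields (C p n) (F p n) (G p n) (H p n))"
  unfolding code_yields_def by (intro comp_intros assms)

lemma decidable_on_valid_code:
  assumes X: "computable_on S (\<lambda>p m. X p (pfst m) (psnd m))" and "computable_on S C"
  shows "decidable_on S (\<lambda>p n. valid_code (X p n) (C p n))"
  unfolding valid_code_iff justified_set_decode
  by (intro comp_intros computable_on_compose[OF assms(2)] computable_on_compose2[OF X] assms(2))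

section \<open>Guessing values of programs with oracle the double jump\<close>

definition halts_by :: "baire \<Rightarrow> nat \<Rightarrow> nat \<Rightarrow> bool" where
  "halts_by X t e \<longleftrightarrow> (\<exists>c\<le>t. valid_code X c \<and> (\<exists>v<c. code_yields c e e v))"

lemma code_yields_less: "code_yields c e n v \<Longrightarrow> v < c"
  unfolding code_yields_def by (rule triple_mem_set_decode_less(3))

lemma turing_jump_eq: "turing_jump X e = of_bool (\<exists>t. halts_by X t e)"
proof -
  have "Phi e X e \<noteq> None \<longleftrightarrow> (\<exists>v. Phi e X e = Some v)" by auto
  also have "\<dots> \<longleftrightarrow> (\<exists>t. halts_by X t e)"
    unfolding Phi_iff_code halts_by_def using code_yields_less by (metis order_refl)
  finally show ?thesis by (simp add: turing_jump_def)
qed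

lemma eventually_halts_by:
  "\<forall>\<^sub>F t in sequentially. of_bool (halts_by X t e) = turing_jump X e"
proof (cases "\<exists>t. halts_by X t e")
  case True
  then obtain t where "halts_by X t e" by blast
  then have "halts_by X u e" if "u \<ge> t" for u
    using that unfolding halts_by_def by (meson le_trans)
  then show ?thesis using True by (intro eventually_sequentiallyI[of t]) (simp add: turing_jump_eq)
next
  case False
  then show ?thesis by (simp add: turing_jump_eq)
qed

lemma halts_by_cong:
  assumes "\<And>n. n < t \<Longrightarrow> X n = Y n"
  shows "halts_by X t e \<longleftrightarrow> halts_by Y t e"
proof -
  have "valid_code X c \<longleftrightarrow> valid_code Y c" if "c \<le> t" for c
    using assms that by (intro valid_code_cong) simp
  then show ?thesis unfolding halts_by_def by blast
qed

text \<open>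
  Only the first code counts, since a code that is valid for an approximation of the oracle may yield
  a wrong value.
\<close>

definition first_yields_1 :: "baire \<Rightarrow> nat \<Rightarrow> nat \<Rightarrow> bool" where
  "first_yields_1 X e t \<longleftrightarrow> (\<exists>c\<le>t. valid_code X c \<and> code_yields c e e 1 \<and>
     (\<forall>c'<c. \<not> (valid_code X c' \<and> (\<exists>v<c'. code_yields c' e e v))))"

text \<open>Let \<open>c\<close> be the least code valid for the true oracle that yields a value.
  Once the approximation is correct below \<open>c\<close>, the same codes up to \<open>c\<close>
  are valid, so \<open>c\<close> is the first one and yields \<open>v\<close>.\<close>

lemma eventually_first_yields_1:
  assumes X: "\<And>n. \<forall>\<^sub>F s in sequentially. Y s n = X n" and v: "Phi e X e = Some v"
  shows "\<forall>\<^sub>F s in sequentially. first_yields_1 (Y s) e s \<longleftrightarrow> v = 1"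
proof -
  let ?P = "\<lambda>X c. valid_code X c \<and> (\<exists>v<c. code_yields c e e v)"
  have val: "w = v" if "valid_code X c" "code_yields c e e w" for c w
    using that v Phi_iff_code[of e X e w] by auto
  have ex: "\<exists>c. ?P X c" using v code_yields_less unfolding Phi_iff_code by blast
  define c where "c = (LEAST c. ?P X c)"
  have c: "?P X c" "\<And>c'. c' < c \<Longrightarrow> \<not> ?P X c'"
    unfolding c_def by (fact LeastI_ex[OF ex], fact not_less_Least)
  from c(1) obtain w where w: "valid_code X c" "code_yields c e e w" by blast
  then have "w = v" by (rule val)
  then have cv: "code_yields c e e u \<longleftrightarrow> u = v" for u
    using val[OF w(1), of u] w(2) by auto
  have "\<forall>\<^sub>F s in sequentially. \<forall>n\<in>{..<c}. Y s n = X n"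
    by (intro eventually_ball_finite) (auto intro: X)
  then show ?thesis
    using eventually_ge_at_top[of c]
  proof eventually_elim
    case (elim s)
    have eq: "valid_code (Y s) c' \<longleftrightarrow> valid_code X c'" if "c' \<le> c" for c'
      by (rule valid_code_cong) (use elim that in auto)
    have Pc: "?P (Y s) c" using c(1) eq[of c] by simp
    have least: "\<not> ?P (Y s) c'" if "c' < c" for c' using c(2)[OF that] eq[of c'] that by simp
    show ?case
    proof
      assume "first_yields_1 (Y s) e s"
      then obtain c' where c': "valid_code (Y s) c'" "code_yields c' e e 1" "\<forall>d<c'. \<not> ?P (Y s) d"
        unfolding first_yields_1_def by blast
      then have "?P (Y s) c'" using code_yields_less by blast
      then have "c' = c" using Pc least c'(3) by (metis nat_neq_iff)
      then show "v = 1" using c'(2) cv[of 1] by simp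
    next
      assume "v = 1"
      then have yields: "code_yields c e e 1" using cv[of 1] by simp
      show "first_yields_1 (Y s) e s"
        unfolding first_yields_1_def
      proof (intro exI[of _ c] conjI allI impI)
        show "\<not> ?P (Y s) c'" if "c' < c" for c' using that by (rule least)
      qed (use Pc yields elim(2) in simp_all)
    qed
  qed
qed

definition jump_approx :: "baire \<Rightarrow> nat \<Rightarrow> baire" where
  "jump_approx p t e = of_bool (halts_by p t e)"

definition jump2_approx :: "baire \<Rightarrow> nat \<Rightarrow> nat \<Rightarrow> baire" where
  "jump2_approx p s t e = of_bool (halts_by (jump_approx p t) s e)"

definition guess :: "baire \<Rightarrow> nat \<Rightarrow> nat \<Rightarrow> nat \<Rightarrow> bool" where
  "guess p e s t \<longleftrightarrow> first_yields_1 (jump2_approx p s t) e s"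

definition limit_guess :: "baire \<Rightarrow> nat \<Rightarrow> nat \<Rightarrow> bool" where
  "limit_guess p e s \<longleftrightarrow> first_yields_1 (jump_approx (turing_jump p) s) e s"

text \<open>At outer stage \<open>s\<close> only bits of the first jump below \<open>s\<close> are
  consulted, so the limit in \<open>t\<close> exists even if the value guessed about is
  undefined.\<close>

lemma eventually_guess: "\<forall>\<^sub>F t in sequentially. guess p e s t = limit_guess p e s"
proof -
  have "\<forall>\<^sub>F t in sequentially. \<forall>n\<in>{..<s}. jump_approx p t n = turing_jump p n"
    unfolding jump_approx_def
    by (intro eventually_ball_finite) (simp_all add: eventually_halts_by)
  then show ?thesis
  proof eventually_elim
    case (elim t)
    have "jump2_approx p s t n = jump_approx (turing_jump p) s n" for n
      unfolding jump2_approx_def jump_approx_def[of "turing_jump p"]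
      using elim halts_by_cong[of s "jump_approx p t" "turing_jump p" n] by simp
    then have "jump2_approx p s t = jump_approx (turing_jump p) s" by (rule ext)
    then show ?case by (simp add: guess_def limit_guess_def)
  qed
qed

lemma eventually_limit_guess:
  assumes "Phi e (turing_jump (turing_jump p)) e = Some v"
  shows "\<forall>\<^sub>F s in sequentially. limit_guess p e s \<longleftrightarrow> v = 1"
  unfolding limit_guess_def
  by (rule eventually_first_yields_1[OF _ assms]) (simp add: jump_approx_def eventually_halts_by)

text \<open>Minimality of the modulus keeps every stage from occurring more than once in \<open>moduli p\<close>.\<close>

definition new_modulus :: "baire \<Rightarrow> nat \<Rightarrow> nat \<Rightarrow> bool" where
  "new_modulus p s u \<longleftrightarrow> u = 0 \<or> (\<exists>e\<le>s. guess p e s (u - 1) \<noteq> guess p e s u)"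

definition stable_upto :: "baire \<Rightarrow> nat \<Rightarrow> nat \<Rightarrow> nat \<Rightarrow> bool" where
  "stable_upto p s u t \<longleftrightarrow> (\<forall>e\<le>s. \<forall>u'\<le>t. u \<le> u' \<longrightarrow> guess p e s u' = guess p e s u)"

definition moduli :: "baire \<Rightarrow> nat set" where
  "moduli p = {z. (\<forall>t. stable_upto p (pfst z) (psnd z) t) \<and> new_modulus p (pfst z) (psnd z)}"

definition moduli_approx :: "baire \<Rightarrow> baire" where
  "moduli_approx p n = of_bool (stable_upto p (pfst (pfst n)) (psnd (pfst n)) (psnd n) \<and>
     new_modulus p (pfst (pfst n)) (psnd (pfst n)))"

definition guess_seq :: "baire \<Rightarrow> nat \<Rightarrow> nat set" where
  "guess_seq p e = {z. guess p e (pfst z) (psnd z)}"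

text \<open>Instability, once observed, persists, so the approximation changes at most once.\<close>

lemma approximates_moduli: "approximates (moduli_approx p) (chi (moduli p))"
  unfolding approximates_eventually
proof
  fix z
  show "\<forall>\<^sub>F t in sequentially. moduli_approx p (prod_encode (z, t)) = chi (moduli p) z"
  proof (cases "\<forall>t. stable_upto p (pfst z) (psnd z) t")
    case True
    then show ?thesis by (simp add: moduli_approx_def chi_def moduli_def)
  next
    case False
    then obtain u where u: "\<not> stable_upto p (pfst z) (psnd z) u" by blast
    have "\<not> stable_upto p (pfst z) (psnd z) t" if "t \<ge> u" for t
      using u that unfolding stable_upto_def by (meson le_trans)
    then have "moduli_approx p (prod_encode (z, t)) = chi (moduli p) z" if "t \<ge> u" for t
      using that False by (simp add: moduli_approx_def chi_def moduli_def)
    then show ?thesis by (rule eventually_sequentiallyI)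
  qed
qed

lemma stableD:
  assumes "z \<in> moduli p" "e \<le> pfst z" "psnd z \<le> u"
  shows "guess p e (pfst z) u = guess p e (pfst z) (psnd z)"
proof -
  have "stable_upto p (pfst z) (psnd z) u" using assms(1) by (simp add: moduli_def)
  with assms(2,3) show ?thesis unfolding stable_upto_def by blast
qed

lemma guess_moduli:
  assumes "z \<in> moduli p" "e \<le> pfst z"
  shows "guess p e (pfst z) (psnd z) = limit_guess p e (pfst z)"
proof -
  obtain t where "\<And>u. u \<ge> t \<Longrightarrow> guess p e (pfst z) u = limit_guess p e (pfst z)"
    using eventually_guess unfolding eventually_sequentially by blast
  then have "guess p e (pfst z) (max t (psnd z)) = limit_guess p e (pfst z)" by simp
  with stableD[OF assms, of "max t (psnd z)"] show ?thesis by simp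
qed

lemma inj_on_pfst_moduli: "inj_on pfst (moduli p)"
proof (rule inj_onI)
  have *: "\<not> psnd z < psnd y" if z: "z \<in> moduli p" and y: "y \<in> moduli p" and "pfst z = pfst y" for y z
  proof
    assume less: "psnd z < psnd y"
    \<comment> \<open>A nonzero minimal modulus comes right after a change of some guess, whereas
      from \<open>psnd z\<close> on there is no change.\<close>
    then obtain e where "e \<le> pfst y" "guess p e (pfst y) (psnd y - 1) \<noteq> guess p e (pfst y) (psnd y)"
      using y unfolding moduli_def new_modulus_def by auto
    moreover have "psnd z \<le> psnd y - 1" using less by simp
    ultimately show False
      using stableD[OF z, of e "psnd y - 1"] stableD[OF z, of e "psnd y"] less \<open>pfst z = pfst y\<close> by simp
  qed
  fix y z assume "y \<in> moduli p" "z \<in> moduli p" "pfst y = pfst z"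
  then have "psnd y = psnd z" using * by (metis nat_neq_iff)
  with \<open>pfst y = pfst z\<close> show "y = z" by (metis prod_decode_inverse prod.expand)
qed

lemma infinite_moduli: "infinite (moduli p)"
proof -
  have "s \<in> pfst ` moduli p" for s
  proof -
    let ?P = "\<lambda>u. \<forall>t. stable_upto p s u t"
    have "\<forall>\<^sub>F t in sequentially. \<forall>e\<in>{..s}. guess p e s t = limit_guess p e s"
      by (intro eventually_ball_finite) (simp_all add: eventually_guess)
    then obtain u where u: "\<And>t e. t \<ge> u \<Longrightarrow> e \<le> s \<Longrightarrow> guess p e s t = limit_guess p e s"
      unfolding eventually_sequentially by auto
    have ex: "?P u" unfolding stable_upto_def using u by simp
    define t where "t = (LEAST u. ?P u)"
    have t: "?P t" "\<And>t'. t' < t \<Longrightarrow> \<not> ?P t'"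
      unfolding t_def by (fact LeastI[of ?P, OF ex], fact not_less_Least)
    \<comment> \<open>If no guess changed between \<open>t - 1\<close> and \<open>t\<close>, then
      \<open>t - 1\<close> would be a smaller modulus.\<close>
    have "new_modulus p s t"
    proof (cases t)
      case (Suc t')
      then obtain v where "\<not> stable_upto p s t' v" using t(2)[of t'] by blast
      then obtain e w where w: "e \<le> s" "t' \<le> w" "guess p e s w \<noteq> guess p e s t'"
        unfolding stable_upto_def by blast
      have "w \<noteq> t'" using w(3) by metis
      then have "t \<le> w" using w(2) Suc by simp
      moreover have "stable_upto p s t w" using t(1) by blast
      ultimately have "guess p e s w = guess p e s t" using w(1) unfolding stable_upto_def by blast
      then show ?thesis using Suc w unfolding new_modulus_def by auto
    qed (simp add: new_modulus_def)
    with t(1) have "prod_encode (s, t) \<in> moduli p" by (simp add: moduli_def)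
    then show ?thesis by (force intro: image_eqI[of _ _ "prod_encode (s, t)"])
  qed
  then have "pfst ` moduli p = UNIV" by blast
  then show ?thesis by (metis finite_imageI infinite_UNIV_nat)
qed

section \<open>Cells, and the reduction of 3-DNR to oCOH\<close>

lemma cell_Nil [simp]: "cell A [] = UNIV"
  by (simp add: cell_def)

lemma mem_cell: "x \<in> cell A \<sigma> \<longleftrightarrow> (\<forall>i<length \<sigma>. (\<sigma> ! i = 0 \<longrightarrow> x \<notin> A i) \<and> (\<sigma> ! i = 1 \<longrightarrow> x \<in> A i))"
  by (auto simp: cell_def)

lemma cell_snoc:
  "cell A (\<sigma> @ [0]) = cell A \<sigma> - A (length \<sigma>)" "cell A (\<sigma> @ [1]) = cell A \<sigma> \<inter> A (length \<sigma>)"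
  by (auto simp: mem_cell nth_append less_Suc_eq)

lemma infinite_cell_snoc:
  assumes "infinite (Z \<inter> cell A \<sigma>)"
  shows "infinite (Z \<inter> cell A (\<sigma> @ [0])) \<or> infinite (Z \<inter> cell A (\<sigma> @ [1]))"
proof -
  have "Z \<inter> cell A \<sigma> = (Z \<inter> cell A (\<sigma> @ [0])) \<union> (Z \<inter> cell A (\<sigma> @ [1]))"
    unfolding cell_snoc by blast
  with assms show ?thesis by (metis finite_UnI)
qed

lemma oCOH_join:
  assumes "approximates f (chi Z)" "infinite Z"
  shows "oCOH_in_Delta2 (join f (seq_name A)) = {p \<in> cantor. \<forall>n. infinite (Z \<inter> cell A (restr p n))}"
  using assms unfolding oCOH_in_Delta2_def by (auto dest: approximates_chi_unique)

lemma oCOH_nonempty: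
  assumes "approximates f (chi Z)" "infinite Z"
  shows "join f (seq_name A) \<in> pdom oCOH_in_Delta2"
proof -
  obtain g where g: "g \<in> cantor" "\<forall>n. infinite (Z \<inter> cell A (restr g n))"
    using ex_path[of "\<lambda>\<sigma>. infinite (Z \<inter> cell A \<sigma>)"] infinite_cell_snoc assms(2) by auto
  then have "g \<in> oCOH_in_Delta2 (join f (seq_name A))" by (simp add: oCOH_join[OF assms])
  then show ?thesis unfolding pdom_def by blast
qed

lemma computable_on_halts_by [comp_intros]:
  assumes X: "computable_on S (\<lambda>p m. X p (pfst m) (psnd m))"
    and "computable_on S T" "computable_on S E"
  shows "decidable_on S (\<lambda>p n. halts_by (X p n) (T p n) (E p n))"
  unfolding halts_by_def
  by (intro comp_intros decidable_on_valid_code computable_on_compose2[OF X]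
      computable_on_compose[OF assms(2)] computable_on_compose[OF assms(3)] assms(2,3))

lemma decidable_on_first_yields_1 [comp_intros]:
  assumes X: "computable_on S (\<lambda>p m. X p (pfst m) (psnd m))"
    and "computable_on S E" "computable_on S T"
  shows "decidable_on S (\<lambda>p n. first_yields_1 (X p n) (E p n) (T p n))"
  unfolding first_yields_1_def
  by (intro comp_intros decidable_on_valid_code computable_on_compose2[OF X]
      computable_on_compose[OF assms(2)] computable_on_compose[OF assms(3)] assms(2,3))

lemma decidable_on_guess [comp_intros]:
  assumes "computable_on S E" "computable_on S U" "computable_on S T"
  shows "decidable_on S (\<lambda>p n. guess p (E p n) (U p n) (T p n))"
proof -
  have "decidable_on S (\<lambda>p m. guess p (pfst m) (pfst (psnd m)) (psnd (psnd m)))"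
    unfolding guess_def jump2_approx_def jump_approx_def by (intro comp_intros)
  from computable_on_compose[OF this computable_on_pair[OF assms(1) computable_on_pair[OF assms(2,3)]]]
  show ?thesis by simp
qed

lemma three_DNR2_le_oCOH: "three_DNR2 \<le>\<^sub>W oCOH_in_Delta2"
proof (rule weihrauch_leI)
  let ?K = "\<lambda>p. join (moduli_approx p) (seq_name (guess_seq p))"
  have seq: "seq_name (guess_seq p) = (\<lambda>n. of_bool (guess p (pfst n) (pfst (psnd n)) (psnd (psnd n))))" for p
  proof
    fix n
    obtain i z where "n = prod_encode (i, z)" by (metis prod_decode_inverse surj_pair)
    then show "seq_name (guess_seq p) n = of_bool (guess p (pfst n) (pfst (psnd n)) (psnd (psnd n)))"
      by (auto simp: seq_name_def chi_def guess_seq_def)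
  qed
  show "computable_on (pdom three_DNR2) ?K"
    unfolding seq moduli_approx_def stable_upto_def new_modulus_def by (intro comp_intros)
  show "?K p \<in> pdom oCOH_in_Delta2" for p
    by (rule oCOH_nonempty[OF approximates_moduli infinite_moduli])
  \<comment> \<open>If the diagonal value at \<open>e\<close> exists, bit \<open>e\<close> of the
    path is 1 exactly if this value is 1, so the complement of the bit differs from it.\<close>
  show "computable_on {join p r |p r. p \<in> pdom three_DNR2 \<and> r \<in> oCOH_in_Delta2 (?K p)}
      (\<lambda>x n. 1 - x (Suc (2 * n)))"
    by (intro comp_intros)
  fix p r assume "r \<in> oCOH_in_Delta2 (?K p)"
  then have r: "r \<in> cantor" "\<And>n. infinite (moduli p \<inter> cell (guess_seq p) (restr r n))"
    by (auto simp: oCOH_join[OF approximates_moduli infinite_moduli])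
  have "1 - r e \<noteq> v" if v: "Phi e (turing_jump (turing_jump p)) e = Some v" for e v
  proof -
    obtain s where s: "\<And>u. u \<ge> s \<Longrightarrow> limit_guess p e u \<longleftrightarrow> v = 1"
      using eventually_limit_guess[OF v] unfolding eventually_sequentially by blast
    let ?C = "moduli p \<inter> cell (guess_seq p) (restr r (Suc e))"
    \<comment> \<open>Distinct elements have distinct stages, so the infinite set \<open>?C\<close>
      contains one whose stage is late enough for a correct guess.\<close>
    have "inj_on pfst ?C" by (rule inj_on_subset[OF inj_on_pfst_moduli]) blast
    then have "infinite (pfst ` ?C)" using r(2) finite_image_iff by blast
    then obtain m where "m \<in> pfst ` ?C" "m \<ge> max s e"
      unfolding finite_nat_set_iff_bounded by (meson not_le)
    then obtain z where z: "z \<in> ?C" "pfst z \<ge> max s e" by blast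
    then have "guess p e (pfst z) (psnd z) \<longleftrightarrow> v = 1"
      using guess_moduli[of z p e] s[of "pfst z"] by simp
    moreover have "(r e = 0 \<longrightarrow> z \<notin> guess_seq p e) \<and> (r e = 1 \<longrightarrow> z \<in> guess_seq p e)"
      using z(1) unfolding mem_cell Int_iff by (metis length_restr lessI nth_restr)
    moreover have "r e \<in> {0, 1}" using r(1) by (auto simp: cantor_def)
    ultimately show ?thesis by (auto simp: guess_seq_def)
  qed
  then show "(\<lambda>n. 1 - join p r (Suc (2 * n))) \<in> three_DNR2 p"
    by (auto simp: three_DNR2_def dnr_def cantor_def)
qed

section \<open>Avoiding dying strings\<close>

text \<open>An instance of the s-m-n theorem: the program ignores its input, so evaluating it on the
  diagonal yields the value of \<open>c\<close> at \<open>k\<close>.\<close>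

definition index_at :: "prog \<Rightarrow> nat \<Rightarrow> nat" where
  "index_at c k = prog_encode (Comp c (const_prog k))"

lemma Phi_index_at: "Phi (index_at c k) p n = run c p k"
  by (simp add: index_at_def Phi_def del: prog_encode.simps)

lemma turing_jump_index_at: "turing_jump p (index_at c k) = of_bool (run c p k \<noteq> None)"
  by (simp add: turing_jump_def Phi_index_at)

lemma computable_on_index_at [comp_intros]:
  assumes "computable_on S F"
  shows "computable_on S (\<lambda>p n. index_at c (F p n))"
proof -
  \<comment> \<open>The codes of the constant programs obey this recursion, since
    \<open>Succ\<close> has code 1.\<close>
  have "prog_encode (const_prog k) = rec_nat 0 (\<lambda>_ v. 6 + 4 * prod_encode (1, v)) k" for k
    by (induction k) simp_all
  then have *: "index_at c k = 6 + 4 * prod_encode (prog_encode c,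
      rec_nat 0 (\<lambda>_ v. 6 + 4 * prod_encode (1, v)) k)" for k
    by (simp add: index_at_def)
  show ?thesis unfolding * by (intro comp_intros assms)
qed

text \<open>The jump decides whether \<open>h\<close> keeps the value \<open>v\<close> from stage
  \<open>t\<close> on, since a counterexample can be searched for. So \<open>D\<close> looks for a
  pair of such \<open>t\<close> and \<open>v\<close> and returns \<open>v\<close>.\<close>

lemma limit_lemma:
  "\<exists>D. \<forall>p h g. (\<forall>n. run c p n = Some (h n)) \<longrightarrow> approximates h g \<longrightarrow>
    (\<forall>n. run D (turing_jump p) n = Some (g n))"
proof -
  define S where "S = {p. \<forall>n. run c p n \<noteq> None}"
  have h: "computable_on S (\<lambda>p n. the (run c p n))"
    by (rule computable_onI[where c = c]) (simp add: S_def)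
  \<comment> \<open>\<open>k\<close> codes an argument, a stage and a value; \<open>t\<close>
    refutes that the value is kept from that stage on.\<close>
  define R where "R p k t \<longleftrightarrow> pfst (psnd k) \<le> t \<and> the (run c p (prod_encode (pfst k, t))) \<noteq> psnd (psnd k)"
    for p k t
  have "decidable_on S (\<lambda>p m. R p (pfst m) (psnd m))"
    unfolding R_def by (intro comp_intros computable_on_compose[OF h])
  then obtain s where s: "\<And>p n. p \<in> S \<Longrightarrow> run s p n = (if \<exists>m. R p n m then Some (LEAST m. R p n m) else None)"
    using decidable_on_search by blast
  define Q where "Q X n m \<longleftrightarrow> X (index_at s (prod_encode (n, m))) = 0" for X :: baire and n m
  define S' where "S' = {X. \<forall>n. \<exists>m. Q X n m}"
  have "computable_on S' (\<lambda>X n. LEAST m. Q X n m)"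
  proof (rule computable_on_Least)
    show "decidable_on S' (\<lambda>X m. Q X (pfst m) (psnd m))" unfolding Q_def by (intro comp_intros)
  qed (simp add: S'_def)
  then have "computable_on S' (\<lambda>X n. psnd (LEAST m. Q X n m))" by (rule computable_on_psnd)
  then obtain D where D: "\<And>X n. X \<in> S' \<Longrightarrow> run D X n = Some (psnd (LEAST m. Q X n m))"
    unfolding computable_on_def by blast
  show ?thesis
  proof (intro exI[of _ D] allI impI)
    fix p h g n assume ph: "\<forall>n. run c p n = Some (h n)" and g: "approximates h g"
    have p: "p \<in> S" using ph by (simp add: S_def)
    have Q: "Q (turing_jump p) n (prod_encode (t, v)) \<longleftrightarrow> (\<forall>u\<ge>t. h (prod_encode (n, u)) = v)" for n t v
      unfolding Q_def turing_jump_index_at s[OF p] R_def ph[rule_format] by auto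
    have lim: "\<exists>t. \<forall>u\<ge>t. h (prod_encode (n, u)) = g n" for n
      using g unfolding approximates_eventually eventually_sequentially by blast
    then have ex: "\<exists>m. Q (turing_jump p) n m" for n using Q by meson
    have "psnd (LEAST m. Q (turing_jump p) n m) = g n" for n
    proof -
      obtain t v where m: "(LEAST m. Q (turing_jump p) n m) = prod_encode (t, v)"
        by (metis prod_decode_inverse surj_pair)
      have "Q (turing_jump p) n (prod_encode (t, v))"
        using LeastI_ex[OF ex[of n]] unfolding m .
      then have v: "\<forall>u\<ge>t. h (prod_encode (n, u)) = v" unfolding Q .
      obtain w where "\<forall>u\<ge>w. h (prod_encode (n, u)) = g n" using lim by blast
      \<comment> \<open>Both constants are attained at the later of the two stages.\<close>
      then have "v = g n" using v by (metis max.cobounded1 max.cobounded2)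
      then show ?thesis by (simp add: m)
    qed
    moreover have "turing_jump p \<in> S'" using ex by (simp add: S'_def)
    ultimately show "run D (turing_jump p) n = Some (g n)" using D by simp
  qed
qed

text \<open>Among the binary strings of length \<open>N\<close> the constant string 1 has the
  largest code, so a whole level can be inspected below it.\<close>

definition binary_code_bound :: "nat \<Rightarrow> nat" where
  "binary_code_bound N = list_encode (replicate N 1)"

lemma list_encode_le_binary_code_bound:
  "\<tau> \<in> lists {0, 1} \<Longrightarrow> list_encode \<tau> \<le> binary_code_bound (length \<tau>)"
proof (induction \<tau>)
  case (Cons x \<tau>)
  have mono: "prod_encode (a, b) \<le> prod_encode (c, d)" if "a \<le> c" "b \<le> d" for a b c d
  proof -
    have "triangle (a + b) \<le> triangle (c + d)"
      unfolding triangle_def using that by (intro div_le_mono mult_le_mono) simp_all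
    with that show ?thesis by (simp add: prod_encode_def)
  qed
  have "list_encode \<tau> \<le> list_encode (replicate (length \<tau>) 1)" "x \<le> 1"
    using Cons by (auto simp: binary_code_bound_def)
  then show ?case using mono[of x 1] by (simp add: binary_code_bound_def)
qed (simp add: binary_code_bound_def)

lemma computable_on_binary_code_bound [comp_intros]:
  assumes "computable_on S F"
  shows "computable_on S (\<lambda>p n. binary_code_bound (F p n))"
proof -
  have "binary_code_bound N = rec_nat 0 (\<lambda>_ v. Suc (prod_encode (1, v))) N" for N
    by (induction N) (simp_all add: binary_code_bound_def)
  then show ?thesis by (simp only:) (intro comp_intros assms)
qed

text \<open>In the following a string \<open>\<sigma>\<close> is represented by the code of its reversal, so that
  appending a bit amounts to a single pairing.\<close>

definition dies :: "baire \<Rightarrow> nat \<Rightarrow> nat \<Rightarrow> nat \<Rightarrow> bool" where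
  "dies t c b N \<longleftrightarrow> code_length c < N \<and>
     (\<forall>k\<le>binary_code_bound N. t k = 1 \<longrightarrow> code_length k = N \<longrightarrow>
       \<not> (code_nth k (code_length c) = b \<and>
          (\<forall>i<code_length c. code_nth k i = code_nth c (code_length c - Suc i))))"

lemma dies_tree_name:
  assumes T: "binary_tree T"
  shows "dies (tree_name T) (list_encode (rev \<sigma>)) b N \<longleftrightarrow>
    length \<sigma> < N \<and> \<not> (\<exists>\<tau>\<in>T. length \<tau> = N \<and> take (length (\<sigma> @ [b])) \<tau> = \<sigma> @ [b])"
proof (cases "length \<sigma> < N")
  case True
  have *: "code_nth (list_encode \<tau>) (length \<sigma>) = b \<and>
      (\<forall>i<length \<sigma>. code_nth (list_encode \<tau>) i = code_nth (list_encode (rev \<sigma>)) (length \<sigma> - Suc i)) \<longleftrightarrow>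
      take (length (\<sigma> @ [b])) \<tau> = \<sigma> @ [b]" if "length \<tau> = N" for \<tau>
  proof -
    have \<tau>: "length \<sigma> < length \<tau>" using True that by simp
    have "take (length (\<sigma> @ [b])) \<tau> = take (length \<sigma>) \<tau> @ [\<tau> ! length \<sigma>]"
      using \<tau> by (simp add: take_Suc_conv_app_nth)
    moreover have "take (length \<sigma>) \<tau> = \<sigma> \<longleftrightarrow> (\<forall>i<length \<sigma>. \<tau> ! i = \<sigma> ! i)"
      using \<tau> by (simp add: list_eq_iff_nth_eq min_absorb2)
    moreover have "code_nth (list_encode \<tau>) i = \<tau> ! i" if "i \<le> length \<sigma>" for i
      using that \<tau> by simp
    moreover have "code_nth (list_encode (rev \<sigma>)) (length \<sigma> - Suc i) = \<sigma> ! i" if "i < length \<sigma>" for i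
      using that by (simp add: rev_nth)
    ultimately show ?thesis by auto
  qed
  have Q: "(\<forall>k\<le>binary_code_bound N. tree_name T k = 1 \<longrightarrow> code_length k = N \<longrightarrow> \<not> P k) \<longleftrightarrow>
      (\<forall>\<tau>\<in>T. length \<tau> = N \<longrightarrow> \<not> P (list_encode \<tau>))" (is "?L \<longleftrightarrow> ?R") for P
  proof
    assume L: ?L
    show ?R
    proof (intro ballI impI)
      fix \<tau> assume \<tau>: "\<tau> \<in> T" "length \<tau> = N"
      then have "list_encode \<tau> \<le> binary_code_bound N"
        using T list_encode_le_binary_code_bound[of \<tau>] unfolding binary_tree_def by auto
      with L \<tau> show "\<not> P (list_encode \<tau>)" by (simp add: tree_name_def chi_def)
    qed
  next
    assume R: ?R
    show ?L
    proof (intro allI impI)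
      fix k assume k: "tree_name T k = 1" "code_length k = N"
      then have "k \<in> list_encode ` T"
        by (cases "k \<in> list_encode ` T") (auto simp: tree_name_def chi_def)
      then obtain \<tau> where "\<tau> \<in> T" "k = list_encode \<tau>" by blast
      moreover from this have "length \<tau> = N" using k(2) by simp
      ultimately show "\<not> P k" using R by blast
    qed
  qed
  let ?P = "\<lambda>k. code_nth k (length \<sigma>) = b \<and>
      (\<forall>i<length \<sigma>. code_nth k i = code_nth (list_encode (rev \<sigma>)) (length \<sigma> - Suc i))"
  have "dies (tree_name T) (list_encode (rev \<sigma>)) b N \<longleftrightarrow>
      (\<forall>k\<le>binary_code_bound N. tree_name T k = 1 \<longrightarrow> code_length k = N \<longrightarrow> \<not> ?P k)"
    using True by (simp add: dies_def)
  also have "\<dots> \<longleftrightarrow> (\<forall>\<tau>\<in>T. length \<tau> = N \<longrightarrow> \<not> ?P (list_encode \<tau>))" by (rule Q)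
  also have "\<dots> \<longleftrightarrow> \<not> (\<exists>\<tau>\<in>T. length \<tau> = N \<and> take (length (\<sigma> @ [b])) \<tau> = \<sigma> @ [b])"
    using * by blast
  finally show ?thesis using True by simp
qed (simp add: dies_def)

lemma not_alive_iff_dies:
  assumes "binary_tree T"
  shows "\<not> alive T (\<sigma> @ [b]) \<longleftrightarrow> (\<exists>N. dies (tree_name T) (list_encode (rev \<sigma>)) b N)"
  unfolding dies_tree_name[OF assms] alive_def by (simp add: Suc_le_eq)

text \<open>\<open>P\<close> searches for the first level at which a child of
  \<open>\<sigma>\<close> has no descendant and returns that child. It halts unless both children
  are extendible, and the other child survives because \<open>\<sigma>\<close> is
  extendible.\<close>

lemma first_dying:
  "\<exists>P. \<forall>p T \<sigma>. (\<forall>n. run c p n = Some (tree_name T n)) \<longrightarrow> binary_tree T \<longrightarrow> alive T \<sigma> \<longrightarrow>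
    alive T (\<sigma> @ [0]) \<and> alive T (\<sigma> @ [1]) \<or>
    (\<exists>b. run P p (list_encode (rev \<sigma>)) = Some b \<and> (b = 0 \<or> b = 1) \<and> alive T (\<sigma> @ [1 - b]))"
proof -
  define S where "S = {p. \<forall>n. run c p n \<noteq> None}"
  have h: "computable_on S (\<lambda>p n. the (run c p n))"
    by (rule computable_onI[where c = c]) (simp add: S_def)
  have dec: "decidable_on S (\<lambda>p n. dies (\<lambda>n. the (run c p n)) (F p n) (G p n) (H p n))"
    if "computable_on S F" "computable_on S G" "computable_on S H" for F G H
  proof -
    have "decidable_on S (\<lambda>p m. dies (\<lambda>n. the (run c p n)) (pfst m) (pfst (psnd m)) (psnd (psnd m)))"
      unfolding dies_def by (intro comp_intros computable_on_compose[OF h])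
    from computable_on_compose[OF this computable_on_pair[OF that(1) computable_on_pair[OF that(2,3)]]]
    show ?thesis by simp
  qed
  define R where "R p k N \<longleftrightarrow> dies (\<lambda>n. the (run c p n)) k 0 N \<or> dies (\<lambda>n. the (run c p n)) k 1 N" for p k N
  have "decidable_on S (\<lambda>p m. R p (pfst m) (psnd m))"
    unfolding R_def by (intro comp_intros dec)
  then obtain s where s: "\<And>p n. p \<in> S \<Longrightarrow> run s p n = (if \<exists>m. R p n m then Some (LEAST m. R p n m) else None)"
    using decidable_on_search by blast
  have "decidable_on S (\<lambda>p m. \<not> dies (\<lambda>n. the (run c p n)) (pfst m) 0 (psnd m))"
    by (intro comp_intros dec)
  then obtain u where u: "\<And>p m. p \<in> S \<Longrightarrow>
      run u p m = Some (of_bool (\<not> dies (\<lambda>n. the (run c p n)) (pfst m) 0 (psnd m)))"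
    unfolding computable_on_def by blast
  show ?thesis
  \<comment> \<open>\<open>s\<close> finds the level, and \<open>u\<close> tells from the string and
    the level which child has died.\<close>
  proof (intro exI[of _ "Comp u (Pair (Pair Fst Snd) s)"] allI impI)
    fix p T \<sigma> assume p: "\<forall>n. run c p n = Some (tree_name T n)" and T: "binary_tree T" "alive T \<sigma>"
    have pS: "p \<in> S" using p by (simp add: S_def)
    have t: "(\<lambda>n. the (run c p n)) = tree_name T" using p by simp
    let ?k = "list_encode (rev \<sigma>)"
    show "alive T (\<sigma> @ [0]) \<and> alive T (\<sigma> @ [1]) \<or>
      (\<exists>b. run (Comp u (Pair (Pair Fst Snd) s)) p ?k = Some b \<and> (b = 0 \<or> b = 1) \<and> alive T (\<sigma> @ [1 - b]))"
    proof (cases "alive T (\<sigma> @ [0]) \<and> alive T (\<sigma> @ [1])")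
      case False
      then have ex: "\<exists>N. R p ?k N" unfolding R_def t using not_alive_iff_dies[OF T(1)] by blast
      define N where "N = (LEAST N. R p ?k N)"
      have RN: "R p ?k N" unfolding N_def using ex by (rule LeastI_ex)
      define b :: nat where "b = of_bool (\<not> dies (tree_name T) ?k 0 N)"
      have "dies (tree_name T) ?k b N" using RN by (auto simp: b_def R_def t)
      then have "\<not> alive T (\<sigma> @ [b])" using not_alive_iff_dies[OF T(1)] by blast
      moreover have b: "b = 0 \<or> b = 1" by (simp add: b_def)
      ultimately have "alive T (\<sigma> @ [1 - b])" using alive_append[OF T] by auto
      moreover have "run (Comp u (Pair (Pair Fst Snd) s)) p ?k = Some b"
        using ex by (simp add: s[OF pS] u[OF pS] b_def t N_def)
      ultimately show ?thesis using b by blast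
    qed blast
  qed
qed

text \<open>Course-of-values recursion: the initial segment is carried along as a reversed code, to
  which each new bit is prepended.\<close>

lemma computable_on_path:
  assumes "computable_on S (\<lambda>p c. r p c)"
  shows "\<exists>G. computable_on S G \<and> (\<forall>p n. G p n = r p (list_encode (rev (restr (G p) n))))"
proof (intro exI conjI allI)
  define C where "C p n = rec_nat 0 (\<lambda>_ c. Suc (prod_encode (r p c, c))) n" for p n
  define G where "G p n = r p (C p n)" for p n
  have "computable_on S C"
    unfolding C_def by (intro comp_intros computable_on_compose[OF assms])
  then show "computable_on S G" unfolding G_def by (rule computable_on_compose[OF assms])
  have "C p n = list_encode (rev (restr (G p) n))" for p n
    by (induction n) (simp_all add: C_def G_def restr_Suc, simp add: restr_def)
  then show "G p n = r p (list_encode (rev (restr (G p) n)))" for p n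
    by (simp add: G_def[of p n])
qed

lemma dnr_exists: "\<exists>f\<in>cantor. dnr q f"
  by (rule bexI[of _ "\<lambda>e. of_bool (Phi e q e = Some 0)"]) (auto simp: dnr_def cantor_def)

lemma WKL_jump_jump_le_three_DNR2: "jump (jump WKL) \<le>\<^sub>W three_DNR2"
proof -
  \<comment> \<open>\<open>D\<close> computes the intermediate function from the first jump, and
    \<open>D'\<close> computes the tree from the second.\<close>
  obtain D where D: "\<forall>p h g. (\<forall>n. run Query p n = Some (h n)) \<longrightarrow> approximates h g \<longrightarrow>
      (\<forall>n. run D (turing_jump p) n = Some (g n))"
    using limit_lemma ..
  obtain D' where D': "\<forall>p h g. (\<forall>n. run D p n = Some (h n)) \<longrightarrow> approximates h g \<longrightarrow>
      (\<forall>n. run D' (turing_jump p) n = Some (g n))"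
    using limit_lemma ..
  obtain P where P: "\<forall>p T \<sigma>. (\<forall>n. run D' p n = Some (tree_name T n)) \<longrightarrow> binary_tree T \<longrightarrow> alive T \<sigma> \<longrightarrow>
      alive T (\<sigma> @ [0]) \<and> alive T (\<sigma> @ [1]) \<or>
      (\<exists>b. run P p (list_encode (rev \<sigma>)) = Some b \<and> (b = 0 \<or> b = 1) \<and> alive T (\<sigma> @ [1 - b]))"
    using first_dying ..
  \<comment> \<open>The solution is read at the index whose diagonal value is the answer of
    \<open>P\<close> on \<open>c\<close>, so its bit avoids the child that dies.\<close>
  define r where "r x c = x (Suc (2 * index_at P c))" for x :: baire and c
  have "computable_on UNIV r" unfolding r_def by (intro comp_intros)
  then obtain G where G: "computable_on UNIV G"
    "\<And>x n. G x n = r x (list_encode (rev (restr (G x) n)))"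
    using computable_on_path[of UNIV r] by auto
  show ?thesis
  proof (rule weihrauch_leI)
    show "computable_on (pdom (jump (jump WKL))) (\<lambda>p n. p n)" by (intro comp_intros)
    show "p \<in> pdom three_DNR2" for p
      using dnr_exists[of "turing_jump (turing_jump p)"] unfolding pdom_def three_DNR2_def by blast
    show "computable_on {join p r |p r. p \<in> pdom (jump (jump WKL)) \<and> r \<in> three_DNR2 p} G"
      by (rule computable_on_subset[OF G(1)]) simp
    fix f q assume f: "f \<in> pdom (jump (jump WKL))" and q: "q \<in> three_DNR2 f"
    let ?f'' = "turing_jump (turing_jump f)"
    obtain g where g: "g \<in> pdom (jump WKL)" "approximates f g" using f by (rule pdom_jumpE)
    obtain t where t: "t \<in> pdom WKL" "approximates g t" using g(1) by (rule pdom_jumpE)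
    obtain T where T: "binary_tree T" "infinite T" "t = tree_name T" using t(1) by (rule pdom_WKLE)
    have "\<forall>n. run D (turing_jump f) n = Some (g n)" 
      using D[rule_format, of f f g] g(2) by simp
    then have run: "\<forall>n. run D' ?f'' n = Some (tree_name T n)"
      using D'[rule_format, of "turing_jump f" g t] t(2) T(3) by simp
    have q2: "q \<in> cantor" "dnr ?f'' q" using q by (auto simp: three_DNR2_def)
    let ?x = "join f q"
    have bit: "r ?x c \<in> {0, 1}" for c using q2(1) by (auto simp: r_def cantor_def)
    have "alive T (restr (G ?x) n)" for n
    proof (rule recursive_path[of "alive T" "\<lambda>\<sigma>. r ?x (list_encode (rev \<sigma>))"])
      show "alive T []" by (rule alive_Nil[OF T(1,2)])
      fix \<sigma> assume a: "alive T \<sigma>"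
      let ?b = "r ?x (list_encode (rev \<sigma>))"
      have b: "?b = 0 \<or> ?b = 1" using bit by blast
      show "alive T (\<sigma> @ [?b])"
      proof (cases "alive T (\<sigma> @ [0]) \<and> alive T (\<sigma> @ [1])")
        case True
        then show ?thesis using b by metis
      next
        case False
        then obtain d where d: "run P ?f'' (list_encode (rev \<sigma>)) = Some d" "d = 0 \<or> d = 1" "alive T (\<sigma> @ [1 - d])"
          using P[rule_format, OF run[rule_format] T(1) a] by blast
        then have "?b \<noteq> d" using q2(2) unfolding dnr_def by (simp add: r_def Phi_index_at)
        then have "?b = 1 - d" using b d(2) by auto
        then show ?thesis using d(3) by simp
      qed
    qed (rule G(2))
    then have "\<forall>n. restr (G ?x) n \<in> T" using aliveD by blast
    moreover have "G ?x \<in> cantor"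
    proof -
      have "G ?x n \<in> {0, 1}" for n by (subst G(2)) (rule bit)
      then show ?thesis unfolding cantor_def by (intro CollectI image_subsetI)
    qed
    ultimately have "G ?x \<in> WKL (tree_name T)" by (simp add: WKL_tree_name[OF T(1,2)])
    then show "G ?x \<in> jump (jump WKL) f"
      using jump_approximates[OF g(2), of "jump WKL"] jump_approximates[OF t(2), of WKL] T(3) by simp
  qed
qed

section \<open>Searching for infinite cells\<close>

text \<open>\<open>t\<close> may be partial; the invariant \<open>I\<close> makes it halt along this
  particular iteration, so primitive recursion over it is still total on \<open>S\<close>.\<close>

lemma computable_on_partial_iterate:
  assumes "\<And>x. x \<in> S \<Longrightarrow> I x 0"
    and "\<And>x c. x \<in> S \<Longrightarrow> I x c \<Longrightarrow> \<exists>c'. run t x c = Some c' \<and> I x c'"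
  shows "\<exists>C. computable_on S C \<and> (\<forall>x\<in>S. C x 0 = 0 \<and>
    (\<forall>n. I x (C x n) \<and> run t x (C x n) = Some (C x (Suc n))))"
proof -
  define C where "C x n = ((\<lambda>c. the (run t x c)) ^^ n) 0" for x n
  have I: "I x (C x n)" if x: "x \<in> S" for x n
  proof (induction n)
    case 0
    show ?case using assms(1)[OF that] by (simp add: C_def)
  next
    case (Suc n)
    then obtain c' where "run t x (C x n) = Some c'" "I x c'" using assms(2)[OF x] by blast
    then show ?case by (simp add: C_def)
  qed
  have step: "run t x (C x n) = Some (C x (Suc n))" if x: "x \<in> S" for x n
  proof -
    obtain c' where "run t x (C x n) = Some c'" using assms(2)[OF x I[OF x]] by blast
    then show ?thesis by (simp add: C_def)
  qed
  \<comment> \<open>The step receives the parameter, the counter and the previous value;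
    \<open>Comp Snd Snd\<close> extracts the latter.\<close>
  let ?c = "Prec Zero (Comp t (Comp Snd Snd))"
  have "run ?c x (prod_encode (0, n)) = Some (C x n)" if "x \<in> S" for x n
  proof (induction n)
    case 0
    show ?case by (simp add: C_def)
  next
    case (Suc n)
    then show ?case unfolding run_Prec_Suc by (simp add: step[OF that] del: run.simps(8))
  qed
  then have "computable_on S C"
    by (intro computable_onI[where c = "Comp ?c (Pair Zero (Pair Fst Snd))"]) (simp del: run.simps(8))
  moreover have "C x 0 = 0" for x by (simp add: C_def)
  ultimately show ?thesis using I step by blast
qed

text \<open>
  The codes serve as indices of the sets, and the condition \<open>c \<le> x\<close> leaves every number in only
  finitely many of them. As above, codes represent reversed strings.
\<close>

definition string_cells :: "(nat \<Rightarrow> nat set) \<Rightarrow> nat \<Rightarrow> nat set" where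
  "string_cells A c = {x. c \<le> x \<and> x \<in> cell A (rev (list_decode c))}"

lemma mem_string_cells: "x \<in> string_cells A c \<longleftrightarrow> c \<le> x \<and>
  (\<forall>i<code_length c. (code_nth c (code_length c - Suc i) = 0 \<longrightarrow> x \<notin> A i) \<and>
     (code_nth c (code_length c - Suc i) = 1 \<longrightarrow> x \<in> A i))"
proof -
  obtain \<sigma> where c: "c = list_encode (rev \<sigma>)" by (metis list_decode_inverse rev_rev_ident)
  have "code_nth c (code_length c - Suc i) = \<sigma> ! i" if "i < length \<sigma>" for i
    using that by (simp add: c rev_nth)
  then show ?thesis by (simp add: string_cells_def mem_cell c)
qed

lemma valid_instance_string_cells:
  assumes "approximates f (chi Z)" "infinite Z"
  shows "valid_instance f (string_cells A) Z"
proof -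
  have "{c. z \<in> string_cells A c} \<subseteq> {..z}" for z by (auto simp: string_cells_def)
  then have "finite {c. z \<in> string_cells A c}" for z by (rule finite_subset) simp
  with assms show ?thesis by (simp add: valid_instance_def)
qed

text \<open>Two witnesses for the child \<open>b\<close> of the string coded by \<open>c\<close>:
  prepending \<open>b\<close> to the reversed list gives the code
  \<open>Suc (prod_encode (b, c))\<close>. They are packed into one number \<open>m\<close> to be
  searched for.\<close>

definition splitting :: "(nat \<Rightarrow> nat set) \<Rightarrow> nat set \<Rightarrow> nat \<Rightarrow> nat \<Rightarrow> nat \<Rightarrow> bool" where
  "splitting A D b c m \<longleftrightarrow> pfst m < psnd m \<and>
     pfst m \<in> D \<and> pfst m \<in> string_cells A (Suc (prod_encode (b, c))) \<and>
     psnd m \<in> D \<and> psnd m \<in> string_cells A (Suc (prod_encode (b, c)))"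

lemma ex_splitting:
  assumes "infinite (D \<inter> cell A (rev (list_decode c) @ [b]))"
  shows "\<exists>m. splitting A D b c m"
proof -
  let ?C = "D \<inter> cell A (rev (list_decode c) @ [b])" and ?k = "Suc (prod_encode (b, c))"
  \<comment> \<open>Late elements are taken because \<open>string_cells\<close> omits numbers below
    the code.\<close>
  have large: "\<exists>x\<in>?C. n \<le> x" for n
    using assms unfolding finite_nat_set_iff_bounded by (meson not_le)
  obtain x where x: "x \<in> ?C" "?k \<le> x" using large by blast
  obtain y where y: "y \<in> ?C" "Suc x \<le> y" using large by blast
  have "splitting A D b c (prod_encode (x, y))"
    using x y by (simp add: splitting_def string_cells_def)
  then show ?thesis ..
qed

text \<open>Two distinct elements exclude the alternative of at most one, so finite evidence shows
  the set to be infinite.\<close>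

lemma infinite_cell_of_splitting:
  assumes D: "infinite (D \<inter> string_cells A (Suc (prod_encode (b, c)))) \<or>
      (finite (D \<inter> string_cells A (Suc (prod_encode (b, c)))) \<and>
       card (D \<inter> string_cells A (Suc (prod_encode (b, c)))) \<le> 1)"
    and m: "splitting A D b c m"
  shows "infinite (D \<inter> cell A (rev (list_decode c) @ [b]))"
proof -
  let ?X = "D \<inter> string_cells A (Suc (prod_encode (b, c)))"
  have "pfst m \<in> ?X" "psnd m \<in> ?X" "pfst m \<noteq> psnd m" using m by (auto simp: splitting_def)
  then have "\<not> (finite ?X \<and> card ?X \<le> 1)" by (metis One_nat_def card_le_Suc0_iff_eq)
  with D have "infinite ?X" by blast
  moreover have "?X \<subseteq> D \<inter> cell A (rev (list_decode c) @ [b])" by (auto simp: string_cells_def)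
  ultimately show ?thesis using finite_subset by blast
qed

lemma INForONE_star_nonempty:
  assumes "valid_instance f A Z"
  shows "join f (seq_name A) \<in> pdom INForONE_in_star_Delta2"
proof -
  obtain h where "h \<in> INForONE_in_Delta2 (join f (seq_name A))"
    using INForONE_nonempty[OF assms] unfolding pdom_def by blast
  then have "h \<in> INForONE_in_star_Delta2 (join f (seq_name A))"
    using INForONE_subset_star[OF assms] by blast
  then show ?thesis unfolding pdom_def by blast
qed

lemma oCOH_le_INForONE_star: "oCOH_in_Delta2 \<le>\<^sub>W INForONE_in_star_Delta2"
proof -
  let ?K = "\<lambda>p. join (\<lambda>n. p (2 * n)) (seq_name (string_cells (name_seq p)))"
  define S where "S = {join p r |p r. p \<in> pdom oCOH_in_Delta2 \<and> r \<in> INForONE_in_star_Delta2 (?K p)}"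
  define A :: "baire \<Rightarrow> nat \<Rightarrow> nat set" where "A x = name_seq (\<lambda>n. x (2 * n))" for x
  define D :: "baire \<Rightarrow> nat set" where "D x = {n. x (Suc (2 * n)) = 1}" for x
  \<comment> \<open>The invariant of the search: the cell of the current string is infinite within
    the solution, which makes the next search succeed.\<close>
  define I where "I x c \<longleftrightarrow> infinite (D x \<inter> cell (A x) (rev (list_decode c))) \<and> set (list_decode c) \<subseteq> {0, 1}" for x c
  define bit :: "baire \<Rightarrow> nat \<Rightarrow> nat \<Rightarrow> nat" where
    "bit x c m = of_bool (\<not> splitting (A x) (D x) 0 c m)" for x c m
  have dec_cells: "decidable_on S' (\<lambda>p n. F p n \<in> string_cells (name_seq p) (G p n))"
    if F: "computable_on S' F" and G: "computable_on S' G" for S' F G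
    unfolding mem_string_cells by (intro comp_intros F G computable_on_compose[OF F] computable_on_compose[OF G])
  have dec_cells': "decidable_on S' (\<lambda>p n. F p n \<in> string_cells (A p) (G p n))"
    if F: "computable_on S' F" and G: "computable_on S' G" for S' F G
    unfolding mem_string_cells A_def name_seq_def mem_Collect_eq
    by (intro comp_intros F G computable_on_compose[OF F] computable_on_compose[OF G])
  have dec_split: "decidable_on S' (\<lambda>x n. splitting (A x) (D x) b (F x n) (G x n))"
    if "computable_on S' F" "computable_on S' G" for S' F G b
    unfolding splitting_def D_def mem_Collect_eq by (intro comp_intros dec_cells' that)
  define R where "R x c m \<longleftrightarrow> splitting (A x) (D x) 0 c m \<or> splitting (A x) (D x) 1 c m" for x c m
  have "decidable_on S (\<lambda>x m. R x (pfst m) (psnd m))"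
    unfolding R_def by (intro comp_intros dec_split)
  then obtain s where s: "\<And>x c. x \<in> S \<Longrightarrow> run s x c = (if \<exists>m. R x c m then Some (LEAST m. R x c m) else None)"
    using decidable_on_search by blast
  have "computable_on UNIV (\<lambda>x n. Suc (prod_encode (bit x (pfst n) (psnd n), pfst n)))"
    unfolding bit_def by (intro comp_intros dec_split)
  then obtain u where u: "\<And>x n. run u x n = Some (Suc (prod_encode (bit x (pfst n) (psnd n), pfst n)))"
    unfolding computable_on_def by blast
  define t where "t = Comp u (Pair (Pair Fst Snd) s)"
  have t: "run t x c = Some (Suc (prod_encode (bit x c (LEAST m. R x c m), c)))"
    if "x \<in> S" "\<exists>m. R x c m" for x c
    using that by (simp add: t_def s u)
  have inst: "\<exists>f Z. p = join f (seq_name (A x)) \<and> approximates f (chi Z) \<and> infinite Z \<and> r = chi (D x) \<and>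
      infinite (D x) \<and> finite (D x - Z) \<and>
      (\<forall>c. infinite (D x \<inter> string_cells (A x) c) \<or>
        (finite (D x \<inter> string_cells (A x) c) \<and> card (D x \<inter> string_cells (A x) c) \<le> 1))"
    if p: "p \<in> pdom oCOH_in_Delta2" and r: "r \<in> INForONE_in_star_Delta2 (?K p)" and x: "x = join p r" for x p r
  proof -
    obtain f B Z where f: "p = join f (seq_name B)" "approximates f (chi Z)" "infinite Z"
      using p unfolding pdom_def oCOH_in_Delta2_def by blast
    have AB: "A x = B" by (simp add: A_def x f(1))
    have v: "valid_instance f (string_cells B) Z" by (rule valid_instance_string_cells[OF f(2,3)])
    have "?K p = join f (seq_name (string_cells B))" by (simp add: f(1))
    with r obtain E where E: "r = chi E" "infinite E" "finite (E - Z)"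
      "\<forall>c. infinite (E \<inter> string_cells B c) \<or>
        (finite (E \<inter> string_cells B c) \<and> card (E \<inter> string_cells B c) \<le> 1)"
      using INForONE_star_join[OF v] by auto
    have "D x = E" by (auto simp: D_def x E(1) chi_def)
    with AB E f show ?thesis by blast
  qed
  have I_step: "\<exists>c'. run t x c = Some c' \<and> I x c'" if x: "x \<in> S" and I: "I x c" for x c
  proof -
    obtain p r where pr: "p \<in> pdom oCOH_in_Delta2" "r \<in> INForONE_in_star_Delta2 (?K p)" "x = join p r"
      using x unfolding S_def by blast
    have D: "infinite (D x \<inter> string_cells (A x) c) \<or>
        (finite (D x \<inter> string_cells (A x) c) \<and> card (D x \<inter> string_cells (A x) c) \<le> 1)" for c
      using inst[OF pr] by blast
    have "infinite (D x \<inter> cell (A x) (rev (list_decode c) @ [0])) \<or>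
        infinite (D x \<inter> cell (A x) (rev (list_decode c) @ [1]))"
      using I infinite_cell_snoc unfolding I_def by blast
    then have ex: "\<exists>m. R x c m" unfolding R_def using ex_splitting by blast
    define m where "m = (LEAST m. R x c m)"
    have m: "R x c m" unfolding m_def using ex by (rule LeastI_ex)
    have "splitting (A x) (D x) (bit x c m) c m" using m by (auto simp: bit_def R_def)
    from infinite_cell_of_splitting[OF D this] I have "I x (Suc (prod_encode (bit x c m, c)))"
      by (simp add: I_def bit_def)
    with t[OF x ex] show ?thesis unfolding m_def by blast
  qed
  have "\<exists>C. computable_on S C \<and> (\<forall>x\<in>S. C x 0 = 0 \<and>
    (\<forall>n. I x (C x n) \<and> run t x (C x n) = Some (C x (Suc n))))"
  proof (rule computable_on_partial_iterate[OF _ I_step])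
    fix x assume "x \<in> S"
    then obtain p r where "p \<in> pdom oCOH_in_Delta2" "r \<in> INForONE_in_star_Delta2 (?K p)" "x = join p r"
      unfolding S_def by blast
    then have "infinite (D x)" using inst by blast
    then show "I x 0" by (simp add: I_def)
  qed
  then obtain C where C: "computable_on S C" and CS: "\<forall>x\<in>S. C x 0 = 0 \<and>
    (\<forall>n. I x (C x n) \<and> run t x (C x n) = Some (C x (Suc n)))"
    by blast
  have C0: "C x 0 = 0" and CI: "I x (C x n)" and Ct: "run t x (C x n) = Some (C x (Suc n))"
    if "x \<in> S" for x n
    using bspec[OF CS that] by simp_all
  \<comment> \<open>The newest bit is the head of the reversed string; subtracting 1 undoes the
    successor in \<open>list_encode\<close>.\<close>
  define L :: "baire \<Rightarrow> baire" where "L x n = pfst (C x (Suc n) - 1)" for x n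
  have C_code: "C x n = list_encode (rev (restr (L x) n))" if x: "x \<in> S" for x n
  proof (induction n)
    case 0
    show ?case using C0[OF x] by (simp add: restr_def)
  next
    case (Suc n)
    \<comment> \<open>The step is known to halt, so the search inside it has a witness.\<close>
    have "\<exists>m. R x (C x n) m"
    proof (rule ccontr)
      assume "\<not> ?thesis"
      then have "run t x (C x n) = None" using s[OF x] by (simp add: t_def)
      with Ct[OF x, of n] show False by simp
    qed
    from t[OF x this] Ct[OF x, of n] obtain b where "C x (Suc n) = Suc (prod_encode (b, C x n))" by auto
    moreover from this have "b = L x n" by (simp add: L_def)
    ultimately show ?case using Suc by (simp add: restr_Suc)
  qed
  show ?thesis
  proof (rule weihrauch_leI)
    have seq: "seq_name B = (\<lambda>n. of_bool (psnd n \<in> B (pfst n)))" for B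
    proof
      fix n
      obtain i z where "n = prod_encode (i, z)" by (metis prod_decode_inverse surj_pair)
      then show "seq_name B n = of_bool (psnd n \<in> B (pfst n))" by (auto simp: seq_name_def chi_def)
    qed
    show "computable_on (pdom oCOH_in_Delta2) ?K"
      unfolding seq by (intro comp_intros dec_cells)
    show "?K p \<in> pdom INForONE_in_star_Delta2" if p: "p \<in> pdom oCOH_in_Delta2" for p
    proof -
      obtain f B Z where f: "p = join f (seq_name B)" "approximates f (chi Z)" "infinite Z"
        using p unfolding pdom_def oCOH_in_Delta2_def by blast
      have v: "valid_instance f (string_cells B) Z" by (rule valid_instance_string_cells[OF f(2,3)])
      have "?K p = join f (seq_name (string_cells B))" by (simp add: f(1))
      then show ?thesis using INForONE_star_nonempty[OF v] by simp
    qed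
    show "computable_on {join p r |p r. p \<in> pdom oCOH_in_Delta2 \<and> r \<in> INForONE_in_star_Delta2 (?K p)} L"
      unfolding S_def[symmetric]
      unfolding L_def by (intro comp_intros computable_on_compose[OF C])
    fix p r assume pr: "p \<in> pdom oCOH_in_Delta2" "r \<in> INForONE_in_star_Delta2 (?K p)"
    let ?x = "join p r"
    have x: "?x \<in> S" using pr unfolding S_def by blast
    obtain f Z where f: "p = join f (seq_name (A ?x))" "approximates f (chi Z)" "infinite Z"
      and D: "finite (D ?x - Z)"
      using inst[OF pr refl] by blast
    have LI: "infinite (D ?x \<inter> cell (A ?x) (restr (L ?x) n))" "set (restr (L ?x) n) \<subseteq> {0, 1}" for n
      using CI[OF x, of n] unfolding I_def C_code[OF x] by simp_all
    \<comment> \<open>\<open>D ?x\<close> is almost contained in \<open>Z\<close>, so a cell that is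
      infinite within \<open>D ?x\<close> is infinite within \<open>Z\<close>.\<close>
    have "infinite (Z \<inter> cell (A ?x) (restr (L ?x) n))" for n
    proof
      assume "finite (Z \<inter> cell (A ?x) (restr (L ?x) n))"
      with D have "finite ((D ?x - Z) \<union> (Z \<inter> cell (A ?x) (restr (L ?x) n)))" by blast
      moreover have "D ?x \<inter> cell (A ?x) (restr (L ?x) n) \<subseteq> (D ?x - Z) \<union> (Z \<inter> cell (A ?x) (restr (L ?x) n))"
        by blast
      ultimately show False using LI(1)[of n] finite_subset by blast
    qed
    moreover have "L ?x \<in> cantor"
    proof -
      have "L ?x n \<in> {0, 1}" for n using LI(2)[of "Suc n"] by (simp add: restr_Suc)
      then show ?thesis unfolding cantor_def by (intro CollectI image_subsetI)
    qed
    ultimately show "L ?x \<in> oCOH_in_Delta2 p"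
      by (subst f(1)) (simp add: oCOH_join[OF f(2,3)])
  qed
qed

theorem theorem5p10:
  shows "(\<forall>F \<in> {jump (jump WKL), RSg, RSgr, three_DNR2,
                 oCOH_in_Delta2, INForONE_in_Delta2, INForONE_in_star_Delta2}.
           \<forall>G \<in> {jump (jump WKL), RSg, RSgr, three_DNR2,
                 oCOH_in_Delta2, INForONE_in_Delta2, INForONE_in_star_Delta2}.
             F \<equiv>\<^sub>W G)
       \<and> (jump (jump WKL) \<equiv>\<^sub>W RSg \<and> RSg \<equiv>\<^sub>W RSgr)"
proof -
  let ?W = "jump (jump WKL)"
  let ?P = "{?W, RSg, RSgr, three_DNR2, oCOH_in_Delta2, INForONE_in_Delta2, INForONE_in_star_Delta2}"
  note trans = weihrauch_le_trans
  have dnr: "?W \<le>\<^sub>W three_DNR2" by (rule WKL_jump_jump_le_three_DNR2)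
  have coh: "?W \<le>\<^sub>W oCOH_in_Delta2" by (rule trans[OF dnr three_DNR2_le_oCOH])
  have star: "?W \<le>\<^sub>W INForONE_in_star_Delta2" by (rule trans[OF coh oCOH_le_INForONE_star])
  have inf: "?W \<le>\<^sub>W INForONE_in_Delta2" by (rule trans[OF star INForONE_star_le_INForONE])
  have rsg: "?W \<le>\<^sub>W RSg" by (rule trans[OF star INForONE_star_le_RSg])
  have rsgr: "?W \<le>\<^sub>W RSgr" by (rule trans[OF rsg RSg_le_RSgr])
  have rsg': "RSg \<le>\<^sub>W ?W" by (rule trans[OF RSg_le_RSgr RSgr_le_WKL_jump_jump])
  have inf': "INForONE_in_Delta2 \<le>\<^sub>W ?W" by (rule trans[OF INForONE_le_RSgr RSgr_le_WKL_jump_jump])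
  have star': "INForONE_in_star_Delta2 \<le>\<^sub>W ?W" by (rule trans[OF INForONE_star_le_INForONE inf'])
  have coh': "oCOH_in_Delta2 \<le>\<^sub>W ?W" by (rule trans[OF oCOH_le_INForONE_star star'])
  have dnr': "three_DNR2 \<le>\<^sub>W ?W" by (rule trans[OF three_DNR2_le_oCOH coh'])
  \<comment> \<open>Comparing every problem with \<open>?W\<close> suffices, since transitivity then
    gives all pairs.\<close>
  have "F \<le>\<^sub>W ?W \<and> ?W \<le>\<^sub>W F" if "F \<in> ?P" for F
    using that dnr coh star inf rsg rsgr rsg' inf' star' coh' dnr' RSgr_le_WKL_jump_jump
      trans[OF dnr dnr'] by blast
  then have "F \<equiv>\<^sub>W G" if "F \<in> ?P" "G \<in> ?P" for F G
    using that trans unfolding weihrauch_eq_def by blast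
  then show ?thesis by simp
qed

end
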